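(* Let $D\subset\mathbf{R}^2$ be a convex compact set with $0\in\operatorname{int}D$. For each $n\ge 3$ let $P_n$ be a minimizer for $L_n(D)$, let $E_n$ be its edge set, and let $C_n=\operatorname{conv}E_n$. Then there is a unique $C\in\mathcal{K}$ such that $$\lim_{n\to\infty}\operatorname{dist}\big((\operatorname{Area}C_n)^{-1/2}C_n,\,C\big)=0.$$ Moreover, the centre of gravity of $C$ is the origin, and $\lim_{n\to\infty}n^{-3/2}L_n(D)$ exists and equals $$\frac{\pi}{\sqrt6}\int_C\|x\|_D\,dx.$$
   Context: The (not necessarily symmetric) norm defined by $D$ is $\|x\|_D=\min\{t\ge0: x\in tD\}$. For $n\ge3$, $\mathcal{P}_n$ is the set of all convex lattice $n$-gons, i.e. convex polygons with exactly $n$ vertices, all in $\mathbf{Z}^2$. If $P\in\mathcal{P}_n$ has vertices $z_1,\dots,z_n$ in anticlockwise order (and $z_{n+1}=z_1$), its $D$-perimeter is $\operatorname{Per}_DP=\sum_{i=1}^n\|z_{i+1}-z_i\|_D$, and its edge set is $\{z_2-z_1,\dots,z_n-z_{n-1},z_1-z_n\}$. Put $L_n(D)=\min\{\operatorname{Per}_DP:P\in\mathcal{P}_n\}$; a minimizer for $L_n(D)$ is a $P\in\mathcal{P}_n$ with $\operatorname{Per}_DP=L_n(D)$. $\mathcal{K}$ is the family of all convex compact sets in $\mathbf{R}^2$ with non-empty interior, and $\operatorname{dist}$ is the Hausdorff distance. *)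

theory Defs
  imports "HOL-Analysis.Analysis"
begin

(* The infimum is a minimum whenever D is compact and 0 is an interior point of D. *)
definition norm_D :: "(real^2) set \<Rightarrow> real^2 \<Rightarrow> real" where
  "norm_D D x = Inf {t. 0 \<le> t \<and> x \<in> (\<lambda>y. t *\<^sub>R y) ` D}"

definition lattice_point :: "real^2 \<Rightarrow> bool" where
  "lattice_point z \<longleftrightarrow> (\<forall>i. z $ i \<in> \<int>)"

(* The vertices of a polygon are its extreme points.  Used for n >= 3 only, which makes the
   polygon two-dimensional. *)
definition lattice_ngons :: "nat \<Rightarrow> (real^2) set set" where
  "lattice_ngons n = {P. polytope P \<and> card {z. z extreme_point_of P} = n \<and>
                         (\<forall>z. z extreme_point_of P \<longrightarrow> lattice_point z)}"

(* Cyclic successor: the vertex after the last one is the first one. *)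
definition next_vertex :: "(real^2) list \<Rightarrow> nat \<Rightarrow> real^2" where
  "next_vertex zs i = zs ! (Suc i mod length zs)"

(* zs enumerates each vertex of P exactly once, and P lies on the left of every directed
   line from a vertex to its successor, i.e. the boundary is traversed anticlockwise. *)
definition anticlockwise_vertices :: "(real^2) set \<Rightarrow> (real^2) list \<Rightarrow> bool" where
  "anticlockwise_vertices P zs \<longleftrightarrow>
     distinct zs \<and> set zs = {z. z extreme_point_of P} \<and>
     (\<forall>i<length zs. \<forall>x\<in>P.
        0 \<le> det (vector [next_vertex zs i - zs ! i, x - zs ! i] :: real^2^2))"

(* The enumeration is unique up to the choice of the starting vertex, which affects neither
   the perimeter nor the edge set. *)
definition vertices :: "(real^2) set \<Rightarrow> (real^2) list" where
  "vertices P = (SOME zs. anticlockwise_vertices P zs)"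

definition Per :: "(real^2) set \<Rightarrow> (real^2) set \<Rightarrow> real" where
  "Per D P = (\<Sum>i<length (vertices P). norm_D D (next_vertex (vertices P) i - vertices P ! i))"

definition edge_set :: "(real^2) set \<Rightarrow> (real^2) set" where
  "edge_set P = (\<lambda>i. next_vertex (vertices P) i - vertices P ! i) ` {..<length (vertices P)}"

(* For D compact with 0 in its interior and n >= 3 the infimum is attained: only finitely
   many lattice vectors have norm_D below a given bound. *)
definition L :: "nat \<Rightarrow> (real^2) set \<Rightarrow> real" where
  "L n D = (INF P\<in>lattice_ngons n. Per D P)"

definition minimizer :: "nat \<Rightarrow> (real^2) set \<Rightarrow> (real^2) set \<Rightarrow> bool" where
  "minimizer n D P \<longleftrightarrow> P \<in> lattice_ngons n \<and> Per D P = L n D"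

definition convex_bodies :: "(real^2) set set" where
  "convex_bodies = {C. convex C \<and> compact C \<and> interior C \<noteq> {}}"

(* Meaningful for nonempty bounded sets. *)
definition hausdorff_dist :: "'a::metric_space set \<Rightarrow> 'a set \<Rightarrow> real" where
  "hausdorff_dist A B = max (SUP a\<in>A. infdist a B) (SUP b\<in>B. infdist b A)"

abbreviation area :: "(real^2) set \<Rightarrow> real" where
  "area S \<equiv> measure lebesgue S"

definition centre_of_gravity :: "(real^2) set \<Rightarrow> real^2" where
  "centre_of_gravity C = (1 / area C) *\<^sub>R integral C (\<lambda>x. x)"

(* C is the limit of the area-normalised convex hulls of the edge sets of P n. *)
definition limit_shape :: "(nat \<Rightarrow> (real^2) set) \<Rightarrow> (real^2) set \<Rightarrow> bool" where
  "limit_shape P C \<longleftrightarrow>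
     (\<lambda>n. hausdorff_dist
            ((\<lambda>x. (area (convex hull edge_set (P n)) powr (-1/2)) *\<^sub>R x)
               ` (convex hull edge_set (P n)))
            C) \<longlonglongrightarrow> 0"

end

theory Submission
  imports Defs
begin

text \<open>
  The edges of a convex lattice \<open>n\<close>-gon form a set of \<open>n\<close> non-zero lattice vectors with sum \<open>0\<close> and
  pairwise distinct directions, and every such set (a \<open>lattice fan\<close>) comes from a polygon.  Because the
  sum is \<open>0\<close>, the total norm of a fan changes only by the factor \<open>\<mu>\<close> when the norm is replaced by
  \<open>H x = (norm_D D x - u \<bullet> x) / \<mu>\<close>.  The Lagrange multipliers \<open>\<mu>, u\<close> are chosen such that
  \<open>C = {x. H x \<le> 1}\<close> has area \<open>1\<close> and centroid \<open>0\<close>; they minimise a convex function.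

  Put \<open>t = sqrt (n pi\<^sup>2 / 6)\<close>.  Primitive vectors have density \<open>6 / pi\<^sup>2\<close>, so about \<open>n\<close> of them lie in
  \<open>t C\<close>, and their sum is \<open>o(t\<^sup>3)\<close>.  Bounding a fan below by its primitive directions, and correcting the
  primitive vectors of \<open>t C\<close> to a fan at cost \<open>o(t\<^sup>3)\<close>, gives the asymptotics of the minimum.  By
  stability a minimal fan contains all but \<open>o(t\<^sup>2)\<close> of the primitive vectors well inside \<open>t C\<close>.  An edge
  \<open>z\<close> far outside \<open>t C\<close> cannot exist: \<open>z\<close> could be exchanged for a free primitive vector just
  outside \<open>t C\<close>, the difference being made up by exchanging primitive vectors just inside the boundary
  for free ones just outside it, which costs almost nothing.
\<close>

section \<open>Polygons and their edges\<close>

text \<open>The condition that edges sum to 0 is what forces the tilt by \<open>u\<close>: the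
  primitive vectors in a dilate of a body that is not centred have a sum of order t^3, as large as
  the total norm. The multipliers come from Lagrangian duality for minimising the integral of the
  norm over sets of area 1 and centroid 0. The dual function is an integral of a positive part, and
  its stationarity conditions say exactly area 1 and centroid 0. It is integrated over a box first;
  a bound on the optimal set that does not depend on the box then removes the truncation.

  The main obstacle is the Hausdorff metric. Near-minimality up to o(t^3) controls all but o(t^2) of
  the edges, but it tolerates a single edge much longer than t, which would spoil the limit of the
  hulls. Excluding it takes exact minimality. The displacement from the far edge to its substitute
  is cut into pieces of length comparable to t, each realised by one swap. Both the number of swaps
  and the gain are linear in the length of the edge, while the loss per swap is an arbitrarily small
  multiple of t, so the gain wins for every length.\<close>

definition cross2 :: "real^2 \<Rightarrow> real^2 \<Rightarrow> real" where
  "cross2 a b = a$1 * b$2 - a$2 * b$1"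

lemma det_vector_2: "det (vector [a, b] :: real^2^2) = cross2 a b"
  by (simp add: cross2_def det_2 vector_2)

lemma vec2_eq_iff: "(a::real^2) = b \<longleftrightarrow> a$1 = b$1 \<and> a$2 = b$2"
  by (simp add: vec_eq_iff forall_2)

lemma inner_vec2: "(a::real^2) \<bullet> b = a$1 * b$1 + a$2 * b$2"
  by (simp add: inner_vec_def sum_2)

lemma cross2_linear: "linear (cross2 a)"
  by (rule linearI) (simp_all add: cross2_def algebra_simps)

lemma cross2_scaleR_right [simp]: "cross2 a (c *\<^sub>R b) = c * cross2 a b"
  and cross2_scaleR_left [simp]: "cross2 (c *\<^sub>R a) b = c * cross2 a b"
  and cross2_self [simp]: "cross2 a a = 0"
  and cross2_zero [simp]: "cross2 a 0 = 0" "cross2 0 a = 0"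
  by (simp_all add: cross2_def algebra_simps)

lemma cross2_add_right: "cross2 a (b + c) = cross2 a b + cross2 a c"
  and cross2_add_left: "cross2 (a + b) c = cross2 a c + cross2 b c"
  and cross2_diff_right: "cross2 a (b - c) = cross2 a b - cross2 a c"
  by (simp_all add: cross2_def algebra_simps)

lemma cross2_sum_right: "cross2 a (sum f S) = (\<Sum>x\<in>S. cross2 a (f x))"
  using linear_sum[OF cross2_linear] by blast

lemma cross2_eq_0D:
  assumes "cross2 v w = 0" "v \<noteq> 0"
  shows "w = ((v \<bullet> w) / (v \<bullet> v)) *\<^sub>R v"
proof -
  have n: "v$1 * v$1 + v$2 * v$2 \<noteq> 0"
    using assms(2) by (simp add: vec2_eq_iff sum_squares_eq_zero_iff)
  have "v$1 * w$2 = v$2 * w$1" using assms(1) by (simp add: cross2_def)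
  then have "(v$1 * v$1 + v$2 * v$2) * w$1 = (v$1 * w$1 + v$2 * w$2) * v$1"
    "(v$1 * v$1 + v$2 * v$2) * w$2 = (v$1 * w$1 + v$2 * w$2) * v$2"
    by algebra+
  then show ?thesis using n
    by (simp add: vec2_eq_iff inner_vec2 field_simps)
qed

section \<open>Orientation of triples and the anticlockwise enumeration of the vertices\<close>

definition orient :: "real^2 \<Rightarrow> real^2 \<Rightarrow> real^2 \<Rightarrow> real" where
  "orient a b c = cross2 (b - a) (c - a)"

lemma orient_rotate: "orient a b c = orient b c a"
  by (simp add: orient_def cross2_def algebra_simps)

lemma orient_swap: "orient a b c = - orient a c b"
  by (simp add: orient_def cross2_def algebra_simps)

lemma extreme_point_not_in_hull:
  assumes "convex P" "b extreme_point_of P" "T \<subseteq> P" "b \<notin> T"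
  shows "b \<notin> convex hull T"
proof -
  have "convex (P - {b})"
    using assms(1,2) extreme_point_of_stillconvex by blast
  moreover have "T \<subseteq> P - {b}" using assms by auto
  ultimately have "convex hull T \<subseteq> P - {b}" by (simp add: hull_minimal)
  then show ?thesis by auto
qed

text \<open>Of three collinear points one lies in the segment spanned by the other two, which an
  extreme point cannot do.\<close>

lemma extreme_points_not_collinear:
  assumes P: "convex P" and e: "a extreme_point_of P" "b extreme_point_of P" "c extreme_point_of P"
    and d: "a \<noteq> b" "a \<noteq> c" "b \<noteq> c"
  shows "orient a b c \<noteq> 0"
proof
  assume "orient a b c = 0"
  then have "c - a = ((b - a) \<bullet> (c - a) / ((b - a) \<bullet> (b - a))) *\<^sub>R (b - a)"
    using d unfolding orient_def by (intro cross2_eq_0D) auto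
  then have "collinear {0, b - a, c - a}" unfolding collinear_lemma by blast
  moreover have "NO_MATCH 0 b" by (simp add: NO_MATCH_def)
  ultimately have "collinear {b, a, c}" using collinear_3 by blast
  then have "collinear {a, b, c}" by (simp add: insert_commute)
  then consider "a \<in> closed_segment b c" | "b \<in> closed_segment c a" | "c \<in> closed_segment a b"
    unfolding collinear_between_cases between_mem_segment by blast
  then show False
  proof cases
    case 1 then show False using extreme_point_not_in_hull[OF P e(1), of "{b,c}"] e d
      by (auto simp: segment_convex_hull extreme_point_of_def)
  next
    case 2 then show False using extreme_point_not_in_hull[OF P e(2), of "{c,a}"] e d
      by (auto simp: segment_convex_hull extreme_point_of_def)
  next
    case 3 then show False using extreme_point_not_in_hull[OF P e(3), of "{a,b}"] e d
      by (auto simp: segment_convex_hull extreme_point_of_def)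
  qed
qed

text \<open>Seen from \<open>v\<close> the points appear in the order \<open>a\<close>,
  \<open>b\<close>, \<open>c\<close>. Without a left turn at \<open>b\<close>, the point
  \<open>b\<close> would lie in the triangle \<open>v\<close>, \<open>a\<close>,
  \<open>c\<close>.\<close>

lemma orient_pos_of_fan:
  assumes P: "convex P" and e: "v extreme_point_of P" "a extreme_point_of P"
      "b extreme_point_of P" "c extreme_point_of P"
    and o: "orient v a b > 0" "orient v b c > 0" "orient v a c > 0"
  shows "orient a b c > 0"
proof (rule ccontr)
  assume n: "\<not> orient a b c > 0"
  \<comment> \<open>Barycentric coordinates of \<open>b\<close> in the triangle, by Cramer's rule.
    Their sum is at most 1 because the turn at \<open>b\<close> is not to the left.\<close>
  define \<alpha> \<beta> where "\<alpha> = orient v b c / orient v a c" and "\<beta> = orient v a b / orient v a c"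
  have pos: "\<alpha> > 0" "\<beta> > 0" using o by (auto simp: \<alpha>_def \<beta>_def)
  have "orient a b c = orient v a b + orient v b c - orient v a c"
    by (simp add: orient_def cross2_def algebra_simps)
  with n have "orient v a b + orient v b c \<le> orient v a c" by simp
  then have le: "\<alpha> + \<beta> \<le> 1" using o by (simp add: \<alpha>_def \<beta>_def field_simps)
  have "orient v a c *\<^sub>R (b - v) = orient v b c *\<^sub>R (a - v) + orient v a b *\<^sub>R (c - v)"
    by (simp add: vec2_eq_iff orient_def cross2_def algebra_simps)
  then have "(1 / orient v a c) *\<^sub>R (orient v a c *\<^sub>R (b - v)) = \<alpha> *\<^sub>R (a - v) + \<beta> *\<^sub>R (c - v)"
    by (simp add: \<alpha>_def \<beta>_def scaleR_add_right)
  then have "b - v = \<alpha> *\<^sub>R (a - v) + \<beta> *\<^sub>R (c - v)" using o by simp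
  then have "b = (1 - \<alpha> - \<beta>) *\<^sub>R v + \<alpha> *\<^sub>R a + \<beta> *\<^sub>R c"
    by (simp add: algebra_simps)
  then have "b \<in> convex hull {v, a, c}"
    unfolding convex_hull_3 using pos le
    by (intro CollectI exI[of _ "1 - \<alpha> - \<beta>"] exI[of _ \<alpha>] exI[of _ \<beta>]) auto
  moreover have "b \<notin> {v, a, c}" using o by (auto simp: orient_def)
  ultimately show False
    using extreme_point_not_in_hull[OF P e(3), of "{v,a,c}"] e by (auto simp: extreme_point_of_def)
qed

text \<open>All of \<open>W\<close> lies in an open half-plane bounded by a line through
  \<open>v\<close>, so the angle around \<open>v\<close> is a linear order without
  wrap-around.\<close>

lemma exists_fan_order:
  fixes W :: "(real^2) set"
  assumes fin: "finite W" and pos: "\<And>w. w \<in> W \<Longrightarrow> e \<bullet> (w - v) > 0"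
    and nc: "\<And>a b. a \<in> W \<Longrightarrow> b \<in> W \<Longrightarrow> a \<noteq> b \<Longrightarrow> orient v a b \<noteq> 0"
  shows "\<exists>xs. set xs = W \<and> distinct xs \<and> (\<forall>i j. i < j \<longrightarrow> j < length xs \<longrightarrow> orient v (xs!i) (xs!j) > 0)"
proof -
  \<comment> \<open>The tangent of the angle from \<open>e\<close> to \<open>w - v\<close>; on the
    half-plane it increases with the angle.\<close>
  define k where "k w = cross2 e (w - v) / (e \<bullet> (w - v))" for w
  have id: "(e \<bullet> e) * cross2 a b = (e \<bullet> a) * cross2 e b - (e \<bullet> b) * cross2 e a" for a b
    by (simp add: inner_vec2 cross2_def algebra_simps)
  have e0: "e \<bullet> e > 0" if "a \<in> W" for a using pos[OF that] by (auto simp: inner_gt_zero_iff)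
  have kl: "orient v a b > 0 \<longleftrightarrow> k a < k b" if "a \<in> W" "b \<in> W" for a b
  proof -
    have "k a < k b \<longleftrightarrow> 0 < (e \<bullet> e) * cross2 (a - v) (b - v)"
      using pos[OF that(1)] pos[OF that(2)] unfolding id k_def by (simp add: field_simps)
    then show ?thesis using e0[OF that(1)] by (simp add: orient_def zero_less_mult_iff)
  qed
  have inj: "inj_on k W"
  proof (rule inj_onI, rule ccontr)
    fix a b assume ab: "a \<in> W" "b \<in> W" "k a = k b" "a \<noteq> b"
    then have "\<not> orient v a b > 0" "\<not> orient v b a > 0" using kl by auto
    then show False using nc[OF ab(1,2,4)] orient_swap[of v a b] by linarith
  qed
  define ks where "ks = sorted_list_of_set (k ` W)"
  define xs where "xs = map (inv_into W k) ks"
  have ks: "set ks = k ` W" "distinct ks" "sorted_wrt (<) ks"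
    using fin by (auto simp: ks_def)
  have "set xs = W" unfolding xs_def set_map ks by (simp add: inj image_image)
  moreover have "distinct xs" unfolding xs_def distinct_map ks using ks(2)
    by (simp add: inj_on_inv_into)
  moreover have "orient v (xs!i) (xs!j) > 0" if ij: "i < j" "j < length xs" for i j
  proof -
    have m: "ks!i \<in> k ` W" "ks!j \<in> k ` W" using ij ks(1) by (metis length_map less_trans nth_mem xs_def)+
    have "k (xs!i) = ks!i" "k (xs!j) = ks!j" "xs!i \<in> W" "xs!j \<in> W"
      using ij m by (auto simp: xs_def f_inv_into_f inv_into_into)
    then show ?thesis using kl ks(3) ij by (auto simp: sorted_wrt_iff_nth_less xs_def)
  qed
  ultimately show ?thesis by blast
qed

lemma anticlockwise_vertices_exists:
  assumes pt: "polytope P" and card: "card {z. z extreme_point_of P} \<ge> 2"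
  shows "\<exists>zs. anticlockwise_vertices P zs"
proof -
  define V where "V = {z. z extreme_point_of P}"
  have P: "convex P" "compact P" using pt polytope_imp_convex polytope_imp_compact by auto
  have fin: "finite V" using card unfolding V_def by (metis card.infinite not_numeral_le_zero)
  have hull: "P = convex hull V" unfolding V_def using Krein_Milman_Minkowski P by blast
  have "V \<noteq> {}" using card unfolding V_def by (metis card.empty not_numeral_le_zero)
  \<comment> \<open>With a vertex of largest norm the polygon lies in a disc that has
    \<open>v\<close> on its boundary, so all other vertices are strictly on the inner side of the
    tangent at \<open>v\<close>, as \<open>exists_fan_order\<close> requires.\<close>
  then obtain v where v: "v \<in> V" and max: "\<And>w. w \<in> V \<Longrightarrow> norm w \<le> norm v"
    using ex_is_arg_min_if_finite[OF fin, of "\<lambda>w. - norm w"] by (auto simp: is_arg_min_linorder)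
  define W where "W = V - {v}"
  have pos: "(- v) \<bullet> (w - v) > 0" if "w \<in> W" for w
  proof -
    have w: "w \<noteq> v" "norm w \<le> norm v" using that max by (auto simp: W_def)
    have "0 < (w - v) \<bullet> (w - v)" using w by simp
    also have "\<dots> = w \<bullet> w + v \<bullet> v - 2 * (v \<bullet> w)" by (simp add: inner_diff inner_commute)
    also have "\<dots> \<le> 2 * (v \<bullet> v) - 2 * (v \<bullet> w)"
      using power_mono[OF w(2), of 2] by (simp add: power2_norm_eq_inner)
    finally show ?thesis by (simp add: inner_diff)
  qed
  have nc: "orient v a b \<noteq> 0" if "a \<in> W" "b \<in> W" "a \<noteq> b" for a b
    using extreme_points_not_collinear[OF P(1), of v a b] that v by (auto simp: W_def V_def)
  obtain xs where xs: "set xs = W" "distinct xs"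
    "\<And>i j. i < j \<Longrightarrow> j < length xs \<Longrightarrow> orient v (xs!i) (xs!j) > 0"
    using exists_fan_order[of W "- v" v] pos nc fin unfolding W_def by blast
  define zs where "zs = v # xs"
  have set: "set zs = V" using v by (auto simp: zs_def xs(1) W_def)
  have ex: "zs!i extreme_point_of P" if "i < length zs" for i
    using that set by (metis V_def mem_Collect_eq nth_mem)
  have o: "orient (zs!i) (zs!j) (zs!k) > 0" if "i < j" "j < k" "k < length zs" for i j k
  proof (cases i)
    case 0 then show ?thesis using that xs(3)[of "j - 1" "k - 1"] by (simp add: zs_def)
  next
    case (Suc i')
    show ?thesis
      by (rule orient_pos_of_fan[OF P(1), of v])
        (use that ex[of 0] ex[of i] ex[of j] ex[of k] Suc xs(3)[of "i - 1" "j - 1"]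
           xs(3)[of "j - 1" "k - 1"] xs(3)[of "i - 1" "k - 1"] in \<open>auto simp: zs_def\<close>)
  qed
  have left: "orient (zs!i) (next_vertex zs i) (zs!k) \<ge> 0" if i: "i < length zs" and k: "k < length zs" for i k
  proof (cases "Suc i < length zs")
    case True
    then have nx: "next_vertex zs i = zs ! Suc i" by (simp add: next_vertex_def)
    consider "k < i" | "k = i" | "k = Suc i" | "k > Suc i" by linarith
    then show ?thesis
      by cases (use o[of k i "Suc i"] o[of i "Suc i" k] True i k orient_rotate[of "zs!k" "zs!i" "zs!Suc i"]
        in \<open>auto simp: nx orient_def\<close>)
  next
    case False
    then have nx: "next_vertex zs i = zs ! 0" "i = length zs - 1"
      using i by (auto simp: next_vertex_def) (metis Suc_lessI mod_self)
    consider "k = 0" | "k = i" | "0 < k" "k < i" using k nx(2) by linarith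
    then show ?thesis
      by cases (use o[of 0 k i] i orient_rotate[of "zs!i" "zs!0" "zs!k"] in \<open>auto simp: nx(1) orient_def\<close>)
  qed
  have "0 \<le> orient (zs!i) (next_vertex zs i) x" if i: "i < length zs" and x: "x \<in> P" for i x
  proof -
    let ?H = "{x. 0 \<le> orient (zs!i) (next_vertex zs i) x}"
    have H: "?H = {x. (vector [- (next_vertex zs i - zs!i)$2, (next_vertex zs i - zs!i)$1] :: real^2) \<bullet> x
        \<ge> (vector [- (next_vertex zs i - zs!i)$2, (next_vertex zs i - zs!i)$1]) \<bullet> (zs!i)}"
      by (auto simp: orient_def cross2_def inner_vec2 vector_2 algebra_simps)
    have "convex ?H" unfolding H by (rule convex_halfspace_ge)
    moreover have "V \<subseteq> ?H" using left[OF i] unfolding set[symmetric] by (auto simp: in_set_conv_nth)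
    ultimately have "P \<subseteq> ?H" unfolding hull by (simp add: subset_hull)
    then show ?thesis using x by auto
  qed
  then have "anticlockwise_vertices P zs"
    unfolding anticlockwise_vertices_def det_vector_2 using set xs(1,2)
    by (auto simp: V_def zs_def W_def orient_def)
  then show ?thesis ..
qed

section \<open>Lattice fans and the edges of a polygon\<close>

definition pos_parallel :: "real^2 \<Rightarrow> real^2 \<Rightarrow> bool" where
  "pos_parallel x y \<longleftrightarrow> (\<exists>c>0. y = c *\<^sub>R x)"

text \<open>The edge sets of convex lattice polygons, described without polygons. Two edges of equal
  direction would merge into one; opposite directions are allowed.\<close>

definition lattice_fans :: "nat \<Rightarrow> (real^2) set set" where
  "lattice_fans n = {E. finite E \<and> card E = n \<and> (\<forall>z\<in>E. lattice_point z \<and> z \<noteq> 0) \<and>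
     (\<forall>x\<in>E. \<forall>y\<in>E. pos_parallel x y \<longrightarrow> x = y) \<and> \<Sum>E = 0}"

definition edge :: "(real^2) list \<Rightarrow> nat \<Rightarrow> real^2" where
  "edge zs i = next_vertex zs i - zs ! i"

lemma anticlockwise_left:
  assumes "anticlockwise_vertices P zs" "i < length zs" "x \<in> P"
  shows "0 \<le> orient (zs!i) (next_vertex zs i) x"
  using assms unfolding anticlockwise_vertices_def det_vector_2 orient_def by blast

lemma next_vertex_mem: "i < length zs \<Longrightarrow> next_vertex zs i \<in> set zs"
  unfolding next_vertex_def by (metis length_0_conv length_greater_0_conv less_zeroE mod_less_divisor nth_mem)

lemma next_vertex_neq:
  assumes "distinct zs" "length zs \<ge> 2" "i < length zs"
  shows "next_vertex zs i \<noteq> zs ! i"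
proof -
  have "Suc i mod length zs \<noteq> i" using assms(2,3) by (cases "Suc i = length zs") auto
  moreover have "Suc i mod length zs < length zs" using assms(2) by (intro mod_less_divisor) auto
  ultimately show ?thesis using assms by (simp add: next_vertex_def nth_eq_iff_index_eq)
qed

lemma sum_edges: "(\<Sum>i<length zs. edge zs i) = 0"
proof (cases "length zs")
  case 0 then show ?thesis by simp
next
  case (Suc m)
  have "(\<Sum>i<Suc m. next_vertex zs i) = (\<Sum>i<m. zs ! Suc i) + zs ! 0"
    by (simp add: next_vertex_def Suc)
  also have "\<dots> = (\<Sum>i<Suc m. zs ! i)" by (subst sum.lessThan_Suc_shift) (simp add: add.commute)
  finally show ?thesis by (simp only: edge_def sum_subtractf Suc) simp
qed

text \<open>\<open>P\<close> lies to the left of every edge line. Of two lines with equal direction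
  each is then to the left of the other, so they coincide, and a line contains at most two extreme
  points.\<close>

lemma edge_pos_parallel_imp_eq:
  assumes P: "convex P" and ac: "anticlockwise_vertices P zs" and len: "length zs \<ge> 2"
    and i: "i < length zs" and j: "j < length zs" and pp: "pos_parallel (edge zs i) (edge zs j)"
  shows "i = j"
proof -
  have d: "distinct zs" and V: "set zs = {z. z extreme_point_of P}"
    using ac by (auto simp: anticlockwise_vertices_def)
  define a a' b b' where "a = zs!i" "a' = next_vertex zs i" "b = zs!j" "b' = next_vertex zs j"
  note ab = a_a'_b_b'_def
  have ex: "a extreme_point_of P" "a' extreme_point_of P" "b extreme_point_of P" "b' extreme_point_of P"
    using V i j next_vertex_mem[of i zs] next_vertex_mem[of j zs] nth_mem unfolding ab by blast+
  then have mem: "a \<in> P" "b \<in> P" by (auto simp: extreme_point_of_def)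
  have ne: "a' \<noteq> a" "b' \<noteq> b" using next_vertex_neq[OF d len] i j by (auto simp: ab)
  obtain c where c: "c > 0" "b' - b = c *\<^sub>R (a' - a)"
    using pp by (auto simp: pos_parallel_def edge_def ab)
  have 1: "0 \<le> orient a a' b" "0 \<le> orient b b' a"
    using anticlockwise_left[OF ac] i j mem by (auto simp: ab)
  have "orient b b' a = - c * orient a a' b"
    by (simp only: orient_def c(2) cross2_scaleR_left cross2_diff_right) (simp add: algebra_simps)
  note eq = this
  have "c * orient a a' b \<le> 0" using 1(2) unfolding eq by linarith
  then have "orient a a' b \<le> 0" using c(1) by (meson mult_pos_pos not_le)
  then have "orient a a' b = 0" using 1(1) by linarith
  with eq have 0: "orient a a' b = 0" "orient b b' a = 0" by simp_all
  have "b = a \<or> b = a'" "a = b \<or> a = b'"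
    using extreme_points_not_collinear[OF P ex(1,2,3)] extreme_points_not_collinear[OF P ex(3,4,1)] 0 ne
    by metis+
  \<comment> \<open>The remaining case: both edges join the same two vertices in opposite order, and
    then their directions are opposite.\<close>
  moreover have "\<not> (b = a' \<and> a = b')"
  proof
    assume *: "b = a' \<and> a = b'"
    have "c *\<^sub>R (a' - a) = a - a'" using c(2) * by metis
    then have "(1 + c) *\<^sub>R (a' - a) = 0" by (simp add: algebra_simps)
    then show False using c(1) ne by simp
  qed
  ultimately have "a = b" using ne by metis
  then show ?thesis using d i j by (simp add: ab nth_eq_iff_index_eq)
qed

lemma lattice_point_diff: "lattice_point x \<Longrightarrow> lattice_point y \<Longrightarrow> lattice_point (x - y)"
  by (simp add: lattice_point_def)

lemma lattice_point_add: "lattice_point x \<Longrightarrow> lattice_point y \<Longrightarrow> lattice_point (x + y)"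
  by (simp add: lattice_point_def)

lemma lattice_point_sum: "(\<And>x. x \<in> S \<Longrightarrow> lattice_point (f x)) \<Longrightarrow> lattice_point (sum f S)"
  by (induction S rule: infinite_finite_induct) (auto simp: lattice_point_add lattice_point_def)

lemma polygon_edges:
  assumes P: "P \<in> lattice_ngons n" and n: "n \<ge> 3"
  shows "edge_set P \<in> lattice_fans n" and "Per D P = (\<Sum>e\<in>edge_set P. norm_D D e)"
proof -
  have pt: "polytope P" and card: "card {z. z extreme_point_of P} = n"
    and lat: "\<And>z. z extreme_point_of P \<Longrightarrow> lattice_point z"
    using P by (auto simp: lattice_ngons_def)
  define zs where "zs = vertices P"
  have ac: "anticlockwise_vertices P zs"
    unfolding zs_def vertices_def
    by (rule someI_ex[OF anticlockwise_vertices_exists[OF pt]]) (use card n in linarith)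
  then have d: "distinct zs" and V: "set zs = {z. z extreme_point_of P}"
    by (auto simp: anticlockwise_vertices_def)
  have len: "length zs = n" using distinct_card[OF d] V card by simp
  have inj: "i = j" if "i < n" "j < n" "pos_parallel (edge zs i) (edge zs j)" for i j
    using edge_pos_parallel_imp_eq[OF polytope_imp_convex[OF pt] ac] len n that by auto
  have inj': "inj_on (edge zs) {..<n}"
  proof (rule inj_onI)
    fix i j assume ij: "i \<in> {..<n}" "j \<in> {..<n}" "edge zs i = edge zs j"
    have "pos_parallel (edge zs i) (edge zs j)"
      unfolding pos_parallel_def ij(3) by (rule exI[of _ 1]) simp
    then show "i = j" using inj ij by simp
  qed
  have es: "edge_set P = edge zs ` {..<n}"
    by (simp add: edge_set_def edge_def zs_def[symmetric] len)
  have ls: "lattice_point (zs!i)" "lattice_point (next_vertex zs i)" if "i < n" for i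
    using lat V next_vertex_mem[of i zs] nth_mem[of i zs] that len by auto
  have nz: "edge zs i \<noteq> 0" if "i < n" for i
    using next_vertex_neq[OF d] that len n by (auto simp: edge_def)
  show "edge_set P \<in> lattice_fans n"
    unfolding lattice_fans_def es
  proof (intro CollectI conjI ballI impI)
    show "card (edge zs ` {..<n}) = n" by (simp add: card_image inj')
    show "\<Sum> (edge zs ` {..<n}) = 0" using sum_edges[of zs] by (simp add: sum.reindex inj' len)
    show "x = y" if "x \<in> edge zs ` {..<n}" "y \<in> edge zs ` {..<n}" "pos_parallel x y" for x y
      using that inj by blast
    show "lattice_point z" "z \<noteq> 0" if "z \<in> edge zs ` {..<n}" for z
      using that ls nz by (auto simp: edge_def lattice_point_diff)
  qed simp
  show "Per D P = (\<Sum>e\<in>edge_set P. norm_D D e)"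
    unfolding es by (simp add: sum.reindex inj' Per_def zs_def[symmetric] len edge_def[symmetric])
qed

text \<open>Needed because \<open>vertices\<close> is a choice. The two successors of a common
  vertex are each on the left of the line to the other, so the three points are collinear and the
  successors agree.\<close>

lemma edges_unique:
  assumes P: "convex P" and zs: "anticlockwise_vertices P zs" and ws: "anticlockwise_vertices P ws"
    and len: "length zs \<ge> 2" "length ws \<ge> 2"
  shows "edge zs ` {..<length zs} \<subseteq> edge ws ` {..<length ws}"
proof
  fix e assume "e \<in> edge zs ` {..<length zs}"
  then obtain i where i: "i < length zs" "e = edge zs i" by auto
  have V: "set zs = {z. z extreme_point_of P}" "set ws = {z. z extreme_point_of P}" "distinct zs" "distinct ws"
    using zs ws by (auto simp: anticlockwise_vertices_def)
  then obtain j where j: "j < length ws" "ws!j = zs!i" using i(1) by (metis in_set_conv_nth)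
  define v a b where "v = zs!i" "a = next_vertex zs i" "b = next_vertex ws j"
  note vab = v_a_b_def
  have ex: "v extreme_point_of P" "a extreme_point_of P" "b extreme_point_of P"
    using V i j next_vertex_mem[of i zs] next_vertex_mem[of j ws] nth_mem unfolding vab by blast+
  then have mem: "a \<in> P" "b \<in> P" by (auto simp: extreme_point_of_def)
  have ne: "v \<noteq> a" "v \<noteq> b" using next_vertex_neq[OF V(3) len(1) i(1)] next_vertex_neq[OF V(4) len(2) j(1)] j(2)
    by (auto simp: vab)
  have "0 \<le> orient v a b" "0 \<le> orient v b a"
    using anticlockwise_left[OF zs i(1) mem(2)] anticlockwise_left[OF ws j(1) mem(1)] j(2) by (auto simp: vab)
  then have "orient v a b = 0" using orient_swap[of v a b] by linarith
  then have "a = b" using extreme_points_not_collinear[OF P ex] ne by auto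
  then have "e = edge ws j" using i j by (simp add: edge_def vab)
  then show "e \<in> edge ws ` {..<length ws}" using j by auto
qed

section \<open>Reconstruction of a polygon from its fan\<close>

lemma vec2_eq_0_of_two_cross:
  assumes "cross2 p f \<noteq> 0" "cross2 p w = 0" "cross2 f w = 0"
  shows "w = 0"
proof -
  have "cross2 p f * w$1 = 0" "cross2 p f * w$2 = 0"
    using assms(2,3) by (simp_all add: cross2_def) algebra+
  then show ?thesis using assms(1) by (simp add: vec2_eq_iff)
qed

lemma extreme_point_of_hull_exposed:
  fixes \<psi> :: "'a::euclidean_space \<Rightarrow> real"
  assumes "finite S" "v \<in> S" and lin: "linear \<psi>" and lt: "\<And>x. x \<in> S \<Longrightarrow> x \<noteq> v \<Longrightarrow> \<psi> v < \<psi> x"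
  shows "v extreme_point_of (convex hull S)"
proof -
  have "convex {x. \<psi> v < \<psi> x}"
    using convex_linear_vimage[OF lin convex_real_interval(3)] by (auto simp: vimage_def greaterThan_def)
  then have "convex hull (S - {v}) \<subseteq> {x. \<psi> v < \<psi> x}" using lt by (intro hull_minimal) auto
  then have "v \<notin> convex hull (S - {v})" by auto
  then have "v extreme_point_of (convex hull (insert v (S - {v})))"
    using assms(1) by (intro extreme_point_of_convex_hull_insert) auto
  then show ?thesis using assms(2) by (simp add: insert_absorb)
qed

definition angle :: "real^2 \<Rightarrow> real" where "angle v = Arg (Complex (v$1) (v$2))"

lemma angle_bounds: "- pi < angle v" "angle v \<le> pi"
  by (auto simp: angle_def mpi_less_Arg Arg_le_pi)

lemma vec_polar: "v$1 = norm v * cos (angle v)" "v$2 = norm v * sin (angle v)"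
proof -
  let ?z = "Complex (v$1) (v$2)"
  have n: "norm ?z = norm v" by (simp add: complex_norm norm_vec_def L2_set_def sum_2)
  have *: "rcis (norm v) (angle v) = ?z" unfolding n[symmetric] angle_def by (rule rcis_cmod_Arg)
  show "v$1 = norm v * cos (angle v)" using Re_rcis[of "norm v" "angle v"] unfolding * by simp
  show "v$2 = norm v * sin (angle v)" using Im_rcis[of "norm v" "angle v"] unfolding * by simp
qed

lemma cross2_angle: "cross2 a b = norm a * norm b * sin (angle b - angle a)"
proof -
  have "cross2 a b = (norm a * cos (angle a)) * (norm b * sin (angle b))
      - (norm a * sin (angle a)) * (norm b * cos (angle b))"
    unfolding cross2_def by (simp only: vec_polar[symmetric])
  also have "\<dots> = norm a * norm b * (sin (angle b) * cos (angle a) - cos (angle b) * sin (angle a))"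
    by algebra
  finally show ?thesis by (simp only: sin_diff)
qed

lemma angle_eq_imp_pos_parallel:
  assumes "angle a = angle b" "a \<noteq> 0" "b \<noteq> 0"
  shows "pos_parallel a b"
proof -
  have "norm a * b$1 = norm b * a$1"
    by (subst (2) vec_polar(1), subst vec_polar(1)) (simp only: assms(1) mult.left_commute)
  moreover have "norm a * b$2 = norm b * a$2"
    by (subst (2) vec_polar(2), subst vec_polar(2)) (simp only: assms(1) mult.left_commute)
  ultimately have "norm a *\<^sub>R b = norm b *\<^sub>R a" by (simp only: vec2_eq_iff vector_scaleR_component real_scaleR_def)
  then have "(1 / norm a) *\<^sub>R (norm a *\<^sub>R b) = (norm b / norm a) *\<^sub>R a" by simp
  then show ?thesis using assms(2,3)
    unfolding pos_parallel_def by (intro exI[of _ "norm b / norm a"]) simp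
qed

text \<open>Edges laid end to end in order of increasing angle. Strict increase within (-pi, pi]
  encodes that no direction is repeated.\<close>

locale sorted_fan =
  fixes e :: "nat \<Rightarrow> real^2" and n :: nat
  assumes n3: "n \<ge> 3"
    and angle_less: "\<And>i j. i < j \<Longrightarrow> j < n \<Longrightarrow> angle (e i) < angle (e j)"
    and nonzero: "\<And>i. i < n \<Longrightarrow> e i \<noteq> 0"
    and closed: "(\<Sum>i<n. e i) = 0"
begin

definition vtx :: "nat \<Rightarrow> real^2" where "vtx k = (\<Sum>i<k. e i)"

lemma angle_le: "i \<le> j \<Longrightarrow> j < n \<Longrightarrow> angle (e i) \<le> angle (e j)"
  using angle_less[of i j] by (cases "i = j") auto

lemma cross2_sgn:
  assumes "i < n" "j < n"
  shows "sin (angle (e j) - angle (e i)) > 0 \<Longrightarrow> cross2 (e i) (e j) > 0"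
    "sin (angle (e j) - angle (e i)) < 0 \<Longrightarrow> cross2 (e i) (e j) < 0"
    "sin (angle (e j) - angle (e i)) = 0 \<Longrightarrow> cross2 (e i) (e j) = 0"
  using nonzero[OF assms(1)] nonzero[OF assms(2)]
  by (auto simp: cross2_angle mult_less_0_iff zero_less_mult_iff)

lemma vtx_diff: "i \<le> k \<Longrightarrow> vtx k - vtx i = (\<Sum>j\<in>{i..<k}. e j)"
  unfolding vtx_def using sum_diff_nat_ivl[of 0 i k e] by (simp add: lessThan_atLeast0)

lemma vtx_diff': 
  assumes "i \<le> k" "k \<le> n" shows "vtx k - vtx i = - (\<Sum>j\<in>{..<i} \<union> {k..<n}. e j)"
proof -
  have "vtx n - vtx k = (\<Sum>j\<in>{k..<n}. e j)" using vtx_diff assms by auto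
  moreover have "vtx n = 0" using closed by (simp add: vtx_def)
  ultimately have "(\<Sum>j\<in>{k..<n}. e j) = - vtx k" by (metis diff_0)
  moreover have "(\<Sum>j\<in>{..<i} \<union> {k..<n}. e j) = vtx i + (\<Sum>j\<in>{k..<n}. e j)"
    unfolding vtx_def using assms by (intro sum.union_disjoint) auto
  ultimately show ?thesis by simp
qed

text \<open>While the angle has advanced by at most pi, the edges between \<open>i\<close> and
  \<open>k\<close> turn to the left of \<open>e i\<close>. Once it has advanced further, all
  complementary edges turn to the right, and since the walk is closed their sum is the negative of
  the one in question.\<close>

lemma vtx_left_forward:
  assumes ik: "i < k" "k < n"
  shows "cross2 (e i) (vtx k - vtx i) \<ge> 0" "vtx k \<noteq> vtx i"
proof -
  have "cross2 (e i) (vtx k - vtx i) \<ge> 0 \<and> vtx k \<noteq> vtx i"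
  proof (cases "angle (e k) \<le> angle (e i) + pi")
    case True
    have pos: "cross2 (e i) (e j) > 0" if "j \<in> {Suc i..<k}" for j
    proof -
      have "angle (e i) < angle (e j)" "angle (e j) < angle (e k)" using that ik angle_less by auto
      then show ?thesis using that ik True by (intro cross2_sgn(1) sin_gt_zero) auto
    qed
    have eq: "cross2 (e i) (vtx k - vtx i) = (\<Sum>j\<in>{Suc i..<k}. cross2 (e i) (e j))"
      using ik by (simp add: vtx_diff sum.atLeast_Suc_lessThan cross2_add_right cross2_sum_right)
    have ge: "cross2 (e i) (vtx k - vtx i) \<ge> 0"
      unfolding eq using pos by (intro sum_nonneg) (simp add: less_imp_le)
    moreover have "vtx k \<noteq> vtx i"
    proof
      assume *: "vtx k = vtx i"
      have "{Suc i..<k} = {}"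
      proof (rule ccontr)
        assume "{Suc i..<k} \<noteq> {}"
        then have "(\<Sum>j\<in>{Suc i..<k}. cross2 (e i) (e j)) > 0" using pos by (intro sum_pos) auto
        then show False using eq * by simp
      qed
      then have "k = Suc i" using ik by auto
      then show False using * nonzero[of i] ik by (simp add: vtx_def)
    qed
    ultimately show ?thesis ..
  next
    case False
    have neg: "cross2 (e i) (e j) < 0" if "j \<in> {..<i} \<union> {k..<n}" for j
    proof (cases "j < i")
      case True
      then have "angle (e j) < angle (e i)" using angle_less ik by auto
      moreover have "angle (e i) < 0" using False angle_bounds[of "e k"] by linarith
      ultimately have "sin (angle (e i) - angle (e j)) > 0"
        using angle_bounds[of "e j"] by (intro sin_gt_zero) auto
      then have "sin (angle (e j) - angle (e i)) < 0"
        using sin_minus[of "angle (e i) - angle (e j)"] by simp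
      then show ?thesis using True ik by (intro cross2_sgn(2)) auto
    next
      case False': False
      then have j: "k \<le> j" "j < n" using that by auto
      then have "angle (e j) > angle (e i) + pi" using angle_le[of k j] False by linarith
      then have "sin (angle (e j) - angle (e i)) < 0"
        using angle_bounds[of "e j"] angle_bounds[of "e i"] by (intro sin_lt_zero) auto
      then show ?thesis using j ik by (intro cross2_sgn(2)) auto
    qed
    have "(\<Sum>j\<in>{..<i} \<union> {k..<n}. - cross2 (e i) (e j)) > 0"
      using neg ik by (intro sum_pos) auto
    then have "cross2 (e i) (vtx k - vtx i) > 0"
      using ik linear_neg[OF cross2_linear, of "e i"]
      by (simp add: vtx_diff' cross2_sum_right sum_negf)
    then show ?thesis by auto
  qed
  then show "cross2 (e i) (vtx k - vtx i) \<ge> 0" "vtx k \<noteq> vtx i" by auto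
qed

text \<open>The mirror case: now the edges from \<open>k\<close> to \<open>i\<close> turn to the
  right of \<open>e i\<close>, or else the complementary ones do not.\<close>

lemma vtx_left_backward:
  assumes ik: "k < i" "i < n"
  shows "cross2 (e i) (vtx k - vtx i) \<ge> 0"
proof (cases "angle (e k) \<ge> angle (e i) - pi")
  case True
  have "cross2 (e i) (e j) \<le> 0" if "j \<in> {k..<i}" for j
  proof -
    have "angle (e j) < angle (e i)" "angle (e k) \<le> angle (e j)" using that ik angle_less angle_le by auto
    then have "sin (angle (e i) - angle (e j)) \<ge> 0" using True by (intro sin_ge_zero) auto
    then have "sin (angle (e j) - angle (e i)) \<le> 0"
      using sin_minus[of "angle (e i) - angle (e j)"] by simp
    then show ?thesis using cross2_sgn(2,3)[of i j] that ik by force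
  qed
  then have "cross2 (e i) (vtx i - vtx k) \<le> 0"
    using ik unfolding vtx_diff[OF less_imp_le[OF ik(1)]] cross2_sum_right by (intro sum_nonpos)
  then show ?thesis by (simp add: cross2_diff_right)
next
  case False
  have nonneg: "cross2 (e i) (e j) \<ge> 0" if "j \<in> {..<k} \<union> {i..<n}" for j
  proof (cases "j < k")
    case True
    then have "angle (e j) < angle (e k)" using angle_less ik by auto
    then have "sin (angle (e j) - angle (e i) + 2 * pi) > 0"
      using False angle_bounds[of "e j"] angle_bounds[of "e i"] by (intro sin_gt_zero) auto
    then show ?thesis using cross2_sgn(1)[of i j] True ik by simp
  next
    case False': False
    then have j: "i \<le> j" "j < n" using that ik by auto
    have "angle (e i) > 0" using False angle_bounds[of "e k"] by linarith
    then have "sin (angle (e j) - angle (e i)) \<ge> 0"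
      using angle_bounds[of "e j"] angle_le[OF j] by (intro sin_ge_zero) auto
    then show ?thesis using cross2_sgn(1,3)[of i j] j ik by force
  qed
  have "0 \<le> (\<Sum>j\<in>{..<k} \<union> {i..<n}. cross2 (e i) (e j))" using nonneg by (rule sum_nonneg)
  also have "\<dots> = cross2 (e i) (vtx k - vtx i)"
    using vtx_diff'[of k i] ik unfolding cross2_sum_right[symmetric]
    by (metis less_imp_le minus_diff_eq minus_minus)
  finally show ?thesis .
qed

lemma vtx_left: "i < n \<Longrightarrow> k < n \<Longrightarrow> cross2 (e i) (vtx k - vtx i) \<ge> 0"
  using vtx_left_forward(1)[of i k] vtx_left_backward[of k i] by (cases i k rule: linorder_cases) auto

lemma vtx_inj: "inj_on vtx {..<n}"
  by (rule inj_onI) (metis lessThan_iff linorder_neqE_nat vtx_left_forward(2))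

definition verts :: "(real^2) list" where "verts = map vtx [0..<n]"

lemma length_verts: "length verts = n" and verts_nth: "i < n \<Longrightarrow> verts ! i = vtx i"
  and set_verts: "set verts = vtx ` {..<n}" and distinct_verts: "distinct verts"
  using vtx_inj by (auto simp: verts_def distinct_map atLeast0LessThan)

lemma next_verts: "i < n \<Longrightarrow> next_vertex verts i = vtx i + e i"
proof (cases "Suc i = n")
  case True
  have "vtx i + e i = vtx n" unfolding vtx_def True[symmetric] by simp
  also have "\<dots> = vtx 0" using closed by (simp add: vtx_def)
  finally show ?thesis using True n3 by (simp add: next_vertex_def length_verts verts_nth)
next
  case False
  assume "i < n"
  with False show ?thesis by (simp add: next_vertex_def length_verts verts_nth) (simp add: vtx_def)
qed

lemma edge_verts: "i < n \<Longrightarrow> edge verts i = e i"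
  by (simp add: edge_def next_verts verts_nth)

text \<open>Three different angles on one line would leave two gaps of at least pi, more than (-pi,
  pi] can hold.\<close>

lemma not_all_parallel: 
  assumes "v \<noteq> 0" shows "\<exists>i<n. cross2 v (e i) \<noteq> 0"
proof (rule ccontr)
  assume "\<not> ?thesis"
  then have c: "cross2 v (e i) = 0" if "i < n" for i using that by auto
  have v: "sin (angle (e i) - angle v) = 0" if "i < n" for i
    using c[OF that] nonzero[OF that] assms by (simp add: cross2_angle)
  have "sin (angle (e j) - angle (e i)) = 0" if "i < n" "j < n" for i j
    using sin_diff[of "angle (e j) - angle v" "angle (e i) - angle v"] v that by simp
  moreover have "sin x > 0 \<or> x \<ge> pi" if "x > 0" for x using that sin_gt_zero by force
  ultimately have "angle (e j) - angle (e i) \<ge> pi" if "i < j" "j < n" for i j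
    using that angle_less[OF that] by (metis diff_gt_0_iff_gt less_irrefl order.strict_trans)
  from this[of 0 1] this[of 1 2] show False
    using n3 angle_bounds[of "e 0"] angle_bounds[of "e 2"] by simp
qed

text \<open>The cross products with the two edges that meet at \<open>vtx i\<close> are both minimal
  there. Their sum exposes the vertex, because two independent cross products cannot both vanish on
  a non-zero vector.\<close>

lemma vtx_exposed:
  assumes i: "i < n" 
  shows "vtx i extreme_point_of (convex hull (set verts))"
proof -
  define p where "p = (if i = 0 then n - 1 else i - 1)"
  have p: "p < n" "vtx p + e p = vtx i"
  proof -
    show "p < n" using i by (auto simp: p_def)
    have *: "vtx (Suc q) = vtx q + e q" for q by (simp add: vtx_def)
    have "vtx n = vtx 0" using closed by (simp add: vtx_def)
    then show "vtx p + e p = vtx i" using *[of p] i n3 by (auto simp: p_def)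
  qed
  have ge: "cross2 (e p) (vtx k - vtx i) \<ge> 0" "cross2 (e i) (vtx k - vtx i) \<ge> 0" if "k < n" for k
  proof -
    have "cross2 (e p) (vtx k - vtx i) = cross2 (e p) (vtx k - vtx p)"
      unfolding p(2)[symmetric] by (simp add: cross2_diff_right cross2_add_right)
    then show "cross2 (e p) (vtx k - vtx i) \<ge> 0" using vtx_left p that by simp
    show "cross2 (e i) (vtx k - vtx i) \<ge> 0" using vtx_left i that by simp
  qed
  \<comment> \<open>Parallel neighbouring edges would be opposite, and then the two inequalities in
    \<open>ge\<close> would put all vertices on one line.\<close>
  have np: "cross2 (e p) (e i) \<noteq> 0"
  proof
    assume 0: "cross2 (e p) (e i) = 0"
    obtain c where c: "e i = c *\<^sub>R e p" using cross2_eq_0D[OF 0 nonzero[OF p(1)]] by blast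
    have "p \<noteq> i" using n3 i by (auto simp: p_def)
    have cn: "c < 0"
    proof (rule ccontr)
      assume "\<not> c < 0"
      then have "c > 0" using c nonzero[OF i] by (cases "c = 0") auto
      then have "sin (angle (e i) - angle (e p)) = 0" "c > 0"
        using 0 nonzero i p by (auto simp: cross2_angle)
      have "angle (e i) = angle (e p)"
        unfolding angle_def c using \<open>c > 0\<close> Arg_times_of_real[of c "Complex (e p $ 1) (e p $ 2)"]
        by (simp add: complex_of_real_mult_Complex)
      then show False using angle_less[of i p] angle_less[of p i] \<open>p \<noteq> i\<close> i p(1)
        by (cases "i < p") auto
    qed
    have z: "cross2 (e p) (vtx k - vtx i) = 0" if "k < n" for k
    proof -
      have "c * cross2 (e p) (vtx k - vtx i) \<ge> 0" using ge(2)[OF that] unfolding c by simp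
      then have "cross2 (e p) (vtx k - vtx i) \<le> 0" using cn by (simp add: zero_le_mult_iff)
      then show ?thesis using ge(1)[OF that] by simp
    qed
    have "cross2 (e p) (e k) = 0" if k: "k < n" for k
    proof -
      have "vtx k + e k \<in> vtx ` {..<n}"
        using next_vertex_mem[of k verts] next_verts[OF k] k by (simp add: length_verts set_verts)
      then obtain l where l: "l < n" "vtx k + e k = vtx l" by auto
      have "e k = (vtx l - vtx i) - (vtx k - vtx i)" using l(2) by (simp add: algebra_simps)
      then have "cross2 (e p) (e k) = cross2 (e p) (vtx l - vtx i) - cross2 (e p) (vtx k - vtx i)"
        by (simp only: cross2_diff_right)
      then show ?thesis using z[OF k] z[OF l(1)] by simp
    qed
    then show False using not_all_parallel[OF nonzero[OF p(1)]] by auto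
  qed
  show ?thesis
  proof (rule extreme_point_of_hull_exposed[OF _ _ cross2_linear[of "e p + e i"]])
    show "finite (set verts)" "vtx i \<in> set verts" using i by (auto simp: set_verts)
    fix x assume "x \<in> set verts" "x \<noteq> vtx i"
    then obtain k where k: "k < n" "x = vtx k" "x - vtx i \<noteq> 0" by (auto simp: set_verts)
    have "\<not> (cross2 (e p) (x - vtx i) = 0 \<and> cross2 (e i) (x - vtx i) = 0)"
      using vec2_eq_0_of_two_cross[OF np] k(3) by blast
    then have "cross2 (e p) (x - vtx i) + cross2 (e i) (x - vtx i) > 0" using ge[OF k(1)] k(2) by auto
    then show "cross2 (e p + e i) (vtx i) < cross2 (e p + e i) x"
      by (simp add: cross2_add_left cross2_diff_right)
  qed
qed

lemma anticlockwise_verts: "anticlockwise_vertices (convex hull (set verts)) verts"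
  unfolding anticlockwise_vertices_def det_vector_2
proof (intro conjI allI impI ballI)
  show "distinct verts" by (rule distinct_verts)
  show "set verts = {z. z extreme_point_of convex hull set verts}"
    using extreme_point_of_convex_hull vtx_exposed by (fastforce simp: set_verts)
  fix i x assume i: "i < length verts" and x: "x \<in> convex hull set verts"
  then have i: "i < n" by (simp add: length_verts)
  have "convex {y. cross2 (e i) (vtx i) \<le> cross2 (e i) y}"
    using convex_linear_vimage[OF cross2_linear convex_real_interval(1)]
    by (auto simp: vimage_def atLeast_def)
  then have "convex hull set verts \<subseteq> {y. cross2 (e i) (vtx i) \<le> cross2 (e i) y}"
    using vtx_left[OF i] by (intro hull_minimal) (auto simp: set_verts cross2_diff_right)
  then show "0 \<le> cross2 (next_vertex verts i - verts ! i) (x - verts ! i)"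
    using x by (auto simp: next_verts[OF i] verts_nth[OF i] cross2_diff_right)
qed

end

text \<open>Together with \<open>polygon_edges\<close> this turns the minimisation of perimeters
  into one over fans. The enumeration picked by \<open>vertices\<close> may differ from
  \<open>verts\<close>, hence the appeal to \<open>edges_unique\<close>.\<close>

lemma fan_polygon:
  assumes E: "E \<in> lattice_fans n" and n: "n \<ge> 3"
  obtains P where "P \<in> lattice_ngons n" "edge_set P = E"
proof -
  have fin: "finite E" and card: "card E = n" and lat: "\<And>z. z \<in> E \<Longrightarrow> lattice_point z"
    and nz: "\<And>z. z \<in> E \<Longrightarrow> z \<noteq> 0" and pp: "\<And>x y. x \<in> E \<Longrightarrow> y \<in> E \<Longrightarrow> pos_parallel x y \<Longrightarrow> x = y"
    and S: "\<Sum>E = 0"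
    using E by (auto simp: lattice_fans_def)
  have inj: "inj_on angle E" by (intro inj_onI pp angle_eq_imp_pos_parallel nz)
  define as where "as = sorted_list_of_set (angle ` E)"
  have as: "set as = angle ` E" "distinct as" "sorted_wrt (<) as" "length as = n"
    using fin card by (auto simp: as_def card_image inj)
  define e where "e i = inv_into E angle (as ! i)" for i
  have mem: "as ! i \<in> angle ` E" if "i < n" for i using as that by (metis nth_mem)
  have e: "e i \<in> E" "angle (e i) = as ! i" if "i < n" for i
    unfolding e_def using mem[OF that] by (auto simp: inv_into_into f_inv_into_f)
  have "bij_betw (inv_into E angle) (angle ` E) E" using inj inj_on_imp_bij_betw bij_betw_inv_into by blast
  moreover have "bij_betw (\<lambda>i. as ! i) {..<n} (angle ` E)" using as by (metis bij_betw_nth)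
  ultimately have bij: "bij_betw e {..<n} E"
    unfolding e_def using bij_betw_trans[of "\<lambda>i. as ! i"] by (auto simp: o_def)
  interpret sorted_fan e n
  proof
    show "angle (e i) < angle (e j)" if "i < j" "j < n" for i j
      using that e(2) as(3,4) by (auto simp: sorted_wrt_iff_nth_less)
    show "(\<Sum>i<n. e i) = 0" using sum.reindex_bij_betw[OF bij, of "\<lambda>x. x"] S by simp
  qed (use n nz e in auto)
  define P where "P = convex hull (set verts)"
  have ac: "anticlockwise_vertices P verts" unfolding P_def by (rule anticlockwise_verts)
  then have V: "{z. z extreme_point_of P} = set verts" by (simp add: anticlockwise_vertices_def)
  have "P \<in> lattice_ngons n"
    unfolding lattice_ngons_def
  proof (intro CollectI conjI allI impI)
    show "polytope P" unfolding P_def by (rule polytope_convex_hull) simp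
    show "card {z. z extreme_point_of P} = n" unfolding V using distinct_card[OF distinct_verts] length_verts by simp
    show "lattice_point z" if "z extreme_point_of P" for z
    proof -
      obtain k where "k < n" "z = vtx k" using \<open>z extreme_point_of P\<close> V by (auto simp: set_verts)
      then show ?thesis unfolding vtx_def using e(1) lat by (auto intro!: lattice_point_sum)
    qed
  qed
  moreover have "edge_set P = E"
  proof -
    have ac': "anticlockwise_vertices P (vertices P)" unfolding vertices_def using ac by (rule someI)
    have len: "length (vertices P) = n"
      using ac' V distinct_verts length_verts by (metis anticlockwise_vertices_def distinct_card)
    have c: "convex P" unfolding P_def by simp
    have "edge_set P = edge (vertices P) ` {..<n}" by (simp add: edge_set_def edge_def len)
    also have "\<dots> = edge verts ` {..<n}"
      using edges_unique[OF c ac ac'] edges_unique[OF c ac' ac] n by (auto simp: len length_verts)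
    also have "\<dots> = E" using edge_verts bij by (simp add: bij_betw_def image_def)
    finally show ?thesis .
  qed
  ultimately show ?thesis using that by blast
qed

section \<open>Lattice sums and primitive vectors\<close>

text \<open>Half-open squares of side \<open>1 / t\<close>, so that for \<open>t > 0\<close> the
  cells of the lattice points tile the plane without overlap.\<close>

definition cell :: "real \<Rightarrow> real^2 \<Rightarrow> (real^2) set" where
  "cell t z = {x. z$1 \<le> t * x$1 \<and> t * x$1 < z$1 + 1 \<and> z$2 \<le> t * x$2 \<and> t * x$2 < z$2 + 1}"

definition floor_vec :: "real^2 \<Rightarrow> real^2" where
  "floor_vec x = (\<chi> i. of_int \<lfloor>x$i\<rfloor>)"

definition lattice_vec :: "int \<times> int \<Rightarrow> real^2" where
  "lattice_vec p = vector [of_int (fst p), of_int (snd p)]"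

lemma lattice_vec_nth [simp]: "lattice_vec p $ 1 = of_int (fst p)" "lattice_vec p $ 2 = of_int (snd p)"
  by (simp_all add: lattice_vec_def vector_2)

lemma lattice_vec_inject [simp]: "lattice_vec p = lattice_vec q \<longleftrightarrow> p = q"
  by (auto simp: vec2_eq_iff prod_eq_iff)

lemma lattice_point_iff: "lattice_point z \<longleftrightarrow> z \<in> range lattice_vec"
proof
  assume "lattice_point z"
  then have "z$1 \<in> \<int>" "z$2 \<in> \<int>" by (auto simp: lattice_point_def)
  then obtain i j where "z$1 = of_int i" "z$2 = of_int j" by (auto elim!: Ints_cases)
  then have "z = lattice_vec (i, j)" by (simp add: vec2_eq_iff)
  then show "z \<in> range lattice_vec" by blast
qed (auto simp: lattice_point_def forall_2)

lemma lattice_point_floor_vec: "lattice_point (floor_vec x)"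
  by (simp add: lattice_point_def floor_vec_def)

lemma mem_cell_iff: "lattice_point z \<Longrightarrow> x \<in> cell t z \<longleftrightarrow> floor_vec (t *\<^sub>R x) = z"
  by (auto simp: lattice_point_iff cell_def floor_vec_def vec2_eq_iff floor_eq_iff)

lemma norm_vec2_le: "norm (x::real^2) \<le> \<bar>x$1\<bar> + \<bar>x$2\<bar>"
  using norm_le_l1_cart[of x] by (simp add: sum_2)

lemma norm_floor_vec_diff: "norm (x - floor_vec x) \<le> 2"
proof -
  have *: "\<bar>(x - floor_vec x)$i\<bar> \<le> 1" for i
    unfolding floor_vec_def vector_minus_component vec_lambda_beta by linarith
  show ?thesis using norm_vec2_le[of "x - floor_vec x"] *[of 1] *[of 2] by linarith
qed

lemma sets_cell [measurable]: "cell t z \<in> sets borel"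
proof -
  have "cell t z = ({x. z$1 \<le> t * x$1} \<inter> {x. t * x$1 < z$1 + 1}) \<inter> ({x. z$2 \<le> t * x$2} \<inter> {x. t * x$2 < z$2 + 1})"
    by (auto simp: cell_def)
  also have "\<dots> \<in> sets borel"
    by (intro sets.Int borel_closed borel_open closed_Collect_le open_Collect_less continuous_intros)
  finally show ?thesis .
qed

lemma measure_cell:
  assumes t: "t > 0" shows "measure lborel (cell t z) = 1 / t\<^sup>2" "cell t z \<in> fmeasurable lborel"
proof -
  define a b where "a = (1/t) *\<^sub>R z" and "b = (1/t) *\<^sub>R (z + 1)"
  have sub: "box a b \<subseteq> cell t z" "cell t z \<subseteq> cbox a b"
    using t by (auto simp: cell_def a_def b_def mem_box_cart forall_2 field_simps)
  have le: "\<And>i. a $ i \<le> b $ i" using t by (simp add: a_def b_def field_simps)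
  then have ne: "cbox a b \<noteq> {}" by (simp add: interval_ne_empty_cart)
  have cb: "measure lborel (cbox a b) = 1 / t\<^sup>2"
    using content_cbox_cart[OF ne] t by (simp add: a_def b_def prod_2 field_simps power2_eq_square)
  have bb: "measure lborel (box a b) = 1 / t\<^sup>2"
    using cb measure_lborel_cbox_eq[of a b] measure_lborel_box_eq[of a b] by simp
  have fm: "box a b \<in> fmeasurable lborel" "cbox a b \<in> fmeasurable lborel" by simp_all
  show fc: "cell t z \<in> fmeasurable lborel" using fm(2) sub(2) by (rule fmeasurableI2) simp
  show "measure lborel (cell t z) = 1 / t\<^sup>2"
    using measure_mono_fmeasurable[OF sub(1) _ fc] measure_mono_fmeasurable[OF sub(2) _ fm(2)] cb bb
    by simp
qed

definition lattice_ball :: "real \<Rightarrow> (real^2) set" where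
  "lattice_ball r = {z. lattice_point z \<and> norm z \<le> r}"

lemma lattice_ball_subset:
  "lattice_ball r \<subseteq> lattice_vec ` ({-\<lfloor>r\<rfloor>..\<lfloor>r\<rfloor>} \<times> {-\<lfloor>r\<rfloor>..\<lfloor>r\<rfloor>})"
proof
  fix z assume "z \<in> lattice_ball r"
  then obtain p where p: "z = lattice_vec p" and n: "norm z \<le> r" by (auto simp: lattice_ball_def lattice_point_iff)
  have "\<bar>z$1\<bar> \<le> r" "\<bar>z$2\<bar> \<le> r" using component_le_norm_cart[of z] n by (auto intro: order_trans)
  then have "of_int \<bar>fst p\<bar> \<le> r" "of_int \<bar>snd p\<bar> \<le> r" by (auto simp: p)
  then have "\<bar>fst p\<bar> \<le> \<lfloor>r\<rfloor>" "\<bar>snd p\<bar> \<le> \<lfloor>r\<rfloor>" by (auto simp only: le_floor_iff)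
  then show "z \<in> lattice_vec ` ({-\<lfloor>r\<rfloor>..\<lfloor>r\<rfloor>} \<times> {-\<lfloor>r\<rfloor>..\<lfloor>r\<rfloor>})"
    unfolding p by (intro imageI) (auto simp: mem_Times_iff)
qed

lemma finite_lattice_ball [simp]: "finite (lattice_ball r)"
  using lattice_ball_subset by (rule finite_subset) simp

lemma card_lattice_ball_le:
  assumes "r \<ge> 1" shows "real (card (lattice_ball r)) \<le> 9 * r\<^sup>2"
proof -
  have "card (lattice_ball r) \<le> card ({-\<lfloor>r\<rfloor>..\<lfloor>r\<rfloor>} \<times> {-\<lfloor>r\<rfloor>..\<lfloor>r\<rfloor>})"
    using card_mono[OF _ lattice_ball_subset, of r] card_image_le[of "{-\<lfloor>r\<rfloor>..\<lfloor>r\<rfloor>} \<times> {-\<lfloor>r\<rfloor>..\<lfloor>r\<rfloor>}" lattice_vec]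
    by (meson finite_SigmaI finite_atLeastAtMost_int finite_imageI order_trans)
  also have "\<dots> = nat (2 * \<lfloor>r\<rfloor> + 1) ^ 2" by (simp add: card_cartesian_product power2_eq_square)
  finally have "real (card (lattice_ball r)) \<le> (real (nat (2 * \<lfloor>r\<rfloor> + 1)))\<^sup>2"
    by (metis of_nat_le_iff of_nat_power)
  also have "\<dots> \<le> (3 * r)\<^sup>2"
  proof (rule power_mono)
    have "\<lfloor>r\<rfloor> \<ge> 1" using assms by simp
    then have "real (nat (2 * \<lfloor>r\<rfloor> + 1)) = 2 * of_int \<lfloor>r\<rfloor> + 1" by simp
    then show "real (nat (2 * \<lfloor>r\<rfloor> + 1)) \<le> 3 * r" using assms by linarith
  qed simp
  finally show ?thesis by (simp add: power2_eq_square)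
qed

lemma norm_lattice_ge_1:
  assumes "lattice_point z" "z \<noteq> 0" shows "norm z \<ge> 1"
proof -
  obtain p where p: "z = lattice_vec p" using assms(1) by (auto simp: lattice_point_iff)
  have "fst p \<noteq> 0 \<or> snd p \<noteq> 0" using assms(2) by (auto simp: p vec2_eq_iff)
  then have "\<bar>z$1\<bar> \<ge> 1 \<or> \<bar>z$2\<bar> \<ge> 1" by (auto simp: p)
  then show ?thesis using component_le_norm_cart[of z 1] component_le_norm_cart[of z 2] by linarith
qed

text \<open>Lebesgue's criterion for Riemann integrability (bounded, of bounded support, continuous
  almost everywhere), which is what makes sums over the scaled lattice converge.\<close>

locale riemann_integrable_function =
  fixes F :: "real^2 \<Rightarrow> real" and K R :: real
  assumes meas [measurable]: "F \<in> borel_measurable borel"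
    and bound: "\<And>x. \<bar>F x\<bar> \<le> K"
    and supp: "\<And>x. norm x > R \<Longrightarrow> F x = 0"
    and cont: "AE x in lborel. isCont F x"
    and R: "R > 0"
begin

lemma K_nonneg: "K \<ge> 0" using bound[of 0] by linarith

text \<open>The integral of \<open>step t\<close> is the Riemann sum. The finite sum gives
  measurability, \<open>step_eq\<close> the pointwise values.\<close>

definition step :: "real \<Rightarrow> real^2 \<Rightarrow> real" where
  "step t x = (\<Sum>z\<in>lattice_ball (R * t). F ((1/t) *\<^sub>R z) * indicator (cell t z) x)"

lemma step_eq: 
  assumes t: "t > 0" shows "step t x = F ((1/t) *\<^sub>R floor_vec (t *\<^sub>R x))"
proof -
  let ?z = "floor_vec (t *\<^sub>R x)"
  have "step t x = (\<Sum>z\<in>lattice_ball (R * t). if z = ?z then F ((1/t) *\<^sub>R ?z) else 0)"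
    unfolding step_def by (rule sum.cong) (auto simp: lattice_ball_def mem_cell_iff indicator_def)
  also have "\<dots> = (if ?z \<in> lattice_ball (R * t) then F ((1/t) *\<^sub>R ?z) else 0)" by (simp add: sum.delta)
  also have "\<dots> = F ((1/t) *\<^sub>R ?z)"
  proof -
    have "F ((1/t) *\<^sub>R ?z) = 0" if "?z \<notin> lattice_ball (R * t)"
      using that t lattice_point_floor_vec by (intro supp) (auto simp: lattice_ball_def field_simps)
    then show ?thesis by simp
  qed
  finally show ?thesis .
qed

lemma integral_step:
  assumes t: "t > 0"
  shows "integral\<^sup>L lborel (step t) = (\<Sum>z\<in>lattice_ball (R * t). F ((1/t) *\<^sub>R z)) / t\<^sup>2"
proof -
  have i: "integrable lborel (\<lambda>x. F ((1/t) *\<^sub>R z) * indicator (cell t z) x)" for z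
    using measure_cell(2)[OF t, of z]
    by (intro integrable_mult_right integrable_real_indicator) (auto simp: fmeasurable_def)
  have "integral\<^sup>L lborel (step t) = (\<Sum>z\<in>lattice_ball (R * t). F ((1/t) *\<^sub>R z) * (1 / t\<^sup>2))"
    unfolding step_def Bochner_Integration.integral_sum[OF i] by (simp add: measure_cell(1)[OF t])
  then show ?thesis by (simp add: sum_divide_distrib)
qed

lemma norm_rounding_le: "t > 0 \<Longrightarrow> norm (x - (1/t) *\<^sub>R floor_vec (t *\<^sub>R x)) \<le> 2 / t"
proof -
  assume t: "t > 0"
  have "x - (1/t) *\<^sub>R floor_vec (t *\<^sub>R x) = (1/t) *\<^sub>R (t *\<^sub>R x - floor_vec (t *\<^sub>R x))"
    using t by (simp add: scaleR_diff_right)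
  then show ?thesis using norm_floor_vec_diff[of "t *\<^sub>R x"] t by (simp add: divide_right_mono)
qed

lemma rounding_tendsto: "((\<lambda>t. (1/t) *\<^sub>R floor_vec (t *\<^sub>R x)) \<longlongrightarrow> x) at_top"
proof (rule Lim_transform2[OF tendsto_const])
  have "((\<lambda>t::real. 2 / t) \<longlongrightarrow> 0) at_top"
    by (intro real_tendsto_divide_at_top[OF tendsto_const] filterlim_ident)
  moreover have "\<forall>\<^sub>F t in at_top. norm (x - (1/t) *\<^sub>R floor_vec (t *\<^sub>R x)) \<le> 2 / t"
    using eventually_gt_at_top[of 0] by eventually_elim (rule norm_rounding_le)
  ultimately show "((\<lambda>t. x - (1/t) *\<^sub>R floor_vec (t *\<^sub>R x)) \<longlongrightarrow> 0) at_top"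
    by (rule Lim_null_comparison[rotated])
qed

lemma lattice_sum_tendsto:
  "((\<lambda>t. (\<Sum>z\<in>lattice_ball (R * t). F ((1/t) *\<^sub>R z)) / t\<^sup>2) \<longlongrightarrow> integral\<^sup>L lborel F) at_top"
proof -
  \<comment> \<open>Rounding moves a point by at most \<open>2 / t\<close>, so for
    \<open>t \<ge> 1\<close> every \<open>step t\<close> vanishes outside the ball of radius
    \<open>R + 2\<close>.\<close>
  let ?w = "\<lambda>x. K * indicator (cball (0::real^2) (R + 2)) x"
  have "((\<lambda>t. integral\<^sup>L lborel (step t)) \<longlongrightarrow> integral\<^sup>L lborel F) at_top"
  proof (rule integral_dominated_convergence_at_top[where w = ?w])
    show "F \<in> borel_measurable lborel" by simp
    show "step t \<in> borel_measurable lborel" for t unfolding step_def by measurable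
    show "integrable lborel ?w"
      by (intro integrable_mult_right integrable_real_indicator emeasure_lborel_cball_finite) simp
    have "AE x in lborel. norm (step t x) \<le> ?w x" if t: "t \<ge> 1" for t
    proof (rule AE_I2)
      fix x :: "real^2"
      show "norm (step t x) \<le> ?w x"
      proof (cases "norm x \<le> R + 2")
        case True then show ?thesis using bound t by (simp add: step_eq)
      next
        case False
        have "norm x \<le> norm ((1/t) *\<^sub>R floor_vec (t *\<^sub>R x)) + norm (x - (1/t) *\<^sub>R floor_vec (t *\<^sub>R x))"
          by (rule norm_triangle_sub)
        also have "norm (x - (1/t) *\<^sub>R floor_vec (t *\<^sub>R x)) \<le> 2"
        proof -
          have "2 / t \<le> 2" using t by (simp add: divide_le_eq)
          then show ?thesis using norm_rounding_le[of t x] t by linarith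
        qed
        finally have "norm ((1/t) *\<^sub>R floor_vec (t *\<^sub>R x)) > R" using False by linarith
        then show ?thesis using t K_nonneg by (subst step_eq) (auto simp: supp indicator_def)
      qed
    qed
    then show "\<forall>\<^sub>F t in at_top. AE x in lborel. norm (step t x) \<le> ?w x"
      using eventually_ge_at_top[of 1] by (rule eventually_mono[rotated])
    show "AE x in lborel. ((\<lambda>t. step t x) \<longlongrightarrow> F x) at_top"
      using cont
    proof eventually_elim
      case (elim x)
      have "((\<lambda>t. F ((1/t) *\<^sub>R floor_vec (t *\<^sub>R x))) \<longlongrightarrow> F x) at_top"
        by (rule isCont_tendsto_compose[OF elim rounding_tendsto])
      moreover have "\<forall>\<^sub>F t in at_top. F ((1/t) *\<^sub>R floor_vec (t *\<^sub>R x)) = step t x"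
        using eventually_gt_at_top[of 0] by eventually_elim (simp add: step_eq)
      ultimately show ?case by (rule Lim_transform_eventually)
    qed
  qed
  moreover have "\<forall>\<^sub>F t in at_top. integral\<^sup>L lborel (step t) = (\<Sum>z\<in>lattice_ball (R * t). F ((1/t) *\<^sub>R z)) / t\<^sup>2"
    using eventually_gt_at_top[of 0] by eventually_elim (rule integral_step)
  ultimately show ?thesis by (rule Lim_transform_eventually)
qed

end

section \<open>Primitive vectors and the inversion of dilation sums\<close>

definition vgcd :: "real^2 \<Rightarrow> nat" where
  "vgcd z = nat (gcd \<lfloor>z$1\<rfloor> \<lfloor>z$2\<rfloor>)"

definition primitive :: "real^2 \<Rightarrow> bool" where
  "primitive z \<longleftrightarrow> lattice_point z \<and> vgcd z = 1"

definition prim_part :: "real^2 \<Rightarrow> real^2" where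
  "prim_part z = (1 / real (vgcd z)) *\<^sub>R z"

lemma vgcd_lattice_vec: "int (vgcd (lattice_vec p)) = gcd (fst p) (snd p)"
  by (simp add: vgcd_def)

lemma vgcd_pos: "lattice_point z \<Longrightarrow> z \<noteq> 0 \<Longrightarrow> vgcd z > 0"
  by (auto simp: lattice_point_iff vgcd_def vec2_eq_iff)

lemma primitive_nonzero: "primitive z \<Longrightarrow> z \<noteq> 0"
  by (auto simp: primitive_def vgcd_def)

lemma primitive_lattice: "primitive z \<Longrightarrow> lattice_point z"
  by (simp add: primitive_def)

lemma scaleR_lattice_vec: "of_int d *\<^sub>R lattice_vec p = lattice_vec (d * fst p, d * snd p)"
  by (simp add: vec2_eq_iff)

lemma lattice_point_scaleR: "lattice_point z \<Longrightarrow> lattice_point (real d *\<^sub>R z)"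
  using scaleR_lattice_vec[of "int d"] by (auto simp: lattice_point_iff)

lemma vgcd_scaleR:
  assumes "lattice_point z" shows "vgcd (real d *\<^sub>R z) = d * vgcd z"
proof -
  obtain p where p: "z = lattice_vec p" using assms by (auto simp: lattice_point_iff)
  have "int (vgcd (real d *\<^sub>R z)) = gcd (int d * fst p) (int d * snd p)"
    using scaleR_lattice_vec[of "int d" p] by (simp add: p vgcd_lattice_vec)
  also have "\<dots> = int d * gcd (fst p) (snd p)" by (simp add: gcd_mult_distrib_int[symmetric])
  also have "\<dots> = int (d * vgcd z)" by (simp add: p vgcd_lattice_vec)
  finally show ?thesis by (simp only: of_nat_eq_iff)
qed

lemma prim_part_eq: "lattice_point z \<Longrightarrow> z \<noteq> 0 \<Longrightarrow> z = real (vgcd z) *\<^sub>R prim_part z"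
  using vgcd_pos[of z] by (simp add: prim_part_def)

lemma primitive_prim_part:
  assumes z: "lattice_point z" "z \<noteq> 0" shows "primitive (prim_part z)"
proof -
  obtain p where p: "z = lattice_vec p" using z by (auto simp: lattice_point_iff)
  define d where "d = gcd (fst p) (snd p)"
  have d2: "int (vgcd z) = d" by (simp add: p vgcd_lattice_vec d_def)
  then have d: "d > 0" "int (vgcd z) = d" using vgcd_pos[OF z] by auto
  obtain a b where ab: "fst p = d * a" "snd p = d * b" by (metis d_def dvd_def gcd_dvd1 gcd_dvd2)
  have "z = of_int d *\<^sub>R lattice_vec (a, b)" unfolding p by (simp add: vec2_eq_iff ab)
  moreover have "real (vgcd z) = of_int d" using d(2) by (metis of_int_of_nat_eq)
  ultimately have w: "prim_part z = lattice_vec (a, b)" using d(1) by (simp add: prim_part_def)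
  have "vgcd z = vgcd z * vgcd (prim_part z)"
    using prim_part_eq[OF z] vgcd_scaleR[of "prim_part z" "vgcd z"] w by (auto simp: lattice_point_iff)
  then have "vgcd (prim_part z) = 1" using vgcd_pos[OF z] by simp
  then show ?thesis using w by (auto simp: primitive_def lattice_point_iff)
qed

lemma prim_part_scaleR:
  assumes "primitive w" "d > 0" shows "prim_part (real d *\<^sub>R w) = w" "vgcd (real d *\<^sub>R w) = d"
  using assms vgcd_scaleR[of w d] by (auto simp: primitive_def prim_part_def)

lemma prim_part_pos_parallel: "prim_part y = prim_part z \<Longrightarrow> lattice_point y \<Longrightarrow> y \<noteq> 0
   \<Longrightarrow> lattice_point z \<Longrightarrow> z \<noteq> 0 \<Longrightarrow> pos_parallel y z"
  unfolding pos_parallel_def prim_part_def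
  by (rule exI[of _ "real (vgcd z) / real (vgcd y)"])
    (metis (no_types, opaque_lifting) divide_pos_pos of_nat_0_less_iff prim_part_def prim_part_eq scaleR_scaleR times_divide_eq_right mult.right_neutral vgcd_pos)

text \<open>Cross-multiplying two proportional coprime pairs gives equality up to sign, and the
  positive factor \<open>c\<close> fixes the signs.\<close>

lemma primitive_pos_parallel_eq:
  assumes "primitive y" "primitive z" "pos_parallel y z" shows "y = z"
proof -
  obtain p q where pq: "y = lattice_vec p" "z = lattice_vec q"
    using assms by (auto simp: primitive_def lattice_point_iff)
  have cop: "coprime (fst p) (snd p)" "coprime (fst q) (snd q)"
    using assms(1,2) vgcd_lattice_vec[of p] vgcd_lattice_vec[of q] by (auto simp: primitive_def pq coprime_iff_gcd_eq_1)
  obtain c where c: "c > 0" "z = c *\<^sub>R y" using assms(3) by (auto simp: pos_parallel_def)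
  have c1: "real_of_int (fst q) = c * of_int (fst p)" and c2: "real_of_int (snd q) = c * of_int (snd p)"
    using c(2) unfolding pq vec2_eq_iff by auto
  have "real_of_int (fst p * snd q) = real_of_int (fst q * snd p)" by (simp add: c1 c2)
  then have eq: "fst p * snd q = fst q * snd p" by linarith
  then have "\<bar>fst p\<bar> * \<bar>snd q\<bar> = \<bar>fst q\<bar> * \<bar>snd p\<bar>" by (simp add: abs_mult[symmetric])
  then have a: "\<bar>fst p\<bar> = \<bar>fst q\<bar>" "\<bar>snd q\<bar> = \<bar>snd p\<bar>"
    using coprime_crossproduct_int[of "fst p" "snd p" "fst q" "snd q"] cop
    by (auto simp: coprime_commute mult.commute)
  have "sgn (real_of_int (fst q)) = sgn (real_of_int (fst p))" "sgn (real_of_int (snd q)) = sgn (real_of_int (snd p))"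
    using c(1) by (simp_all add: c1 c2 sgn_mult)
  then have "fst q = fst p" "snd q = snd p" using a by (auto simp: sgn_if split: if_splits)
  then show ?thesis by (simp add: pq vec2_eq_iff)
qed

definition prims :: "real \<Rightarrow> (real^2) set" where "prims r = {z. primitive z \<and> norm z \<le> r}"

lemma prims_subset: "prims r \<subseteq> lattice_ball r" and finite_prims [simp]: "finite (prims r)"
proof -
  show "prims r \<subseteq> lattice_ball r" by (auto simp: prims_def lattice_ball_def primitive_def)
  then show "finite (prims r)" by (rule finite_subset) simp
qed

text \<open>Each non-zero lattice vector is a unique positive multiple \<open>d\<close> of a
  primitive one. The cut-off \<open>N\<close> loses nothing, because a primitive vector has norm at
  least 1 and hence \<open>d \<le> norm z\<close>.\<close>

lemma sum_lattice_by_gcd: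
  assumes N: "r \<le> real N"
  shows "(\<Sum>z\<in>lattice_ball r - {0}. f z) = (\<Sum>d\<in>{1..N}. \<Sum>w\<in>prims (r / real d). f (real d *\<^sub>R w))"
proof -
  have "(\<Sum>d\<in>{1..N}. \<Sum>w\<in>prims (r / real d). f (real d *\<^sub>R w))
      = (\<Sum>(d, w)\<in>Sigma {1..N} (\<lambda>d. prims (r / real d)). f (real d *\<^sub>R w))"
    by (rule sum.Sigma) auto
  also have "\<dots> = (\<Sum>z\<in>lattice_ball r - {0}. f z)"
  proof (rule sum.reindex_bij_witness[where i = "\<lambda>z. (vgcd z, prim_part z)" and j = "\<lambda>(d, w). real d *\<^sub>R w"])
    fix z assume z: "z \<in> lattice_ball r - {0}"
    then have z': "lattice_point z" "z \<noteq> 0" "norm z \<le> r" by (auto simp: lattice_ball_def)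
    show "(case (vgcd z, prim_part z) of (d, w) \<Rightarrow> real d *\<^sub>R w) = z" using prim_part_eq[OF z'(1,2)] by simp
    have n: "norm z = real (vgcd z) * norm (prim_part z)" using prim_part_eq[OF z'(1,2)] by (metis abs_of_nat norm_scaleR)
    have pp: "primitive (prim_part z)" using primitive_prim_part z' by blast
    have "norm (prim_part z) \<ge> 1" using norm_lattice_ge_1 pp primitive_lattice primitive_nonzero by blast
    then have "real (vgcd z) \<le> norm z" unfolding n by (simp add: mult_le_cancel_left1)
    then have "vgcd z \<le> N" using z'(3) N by linarith
    moreover have "norm (prim_part z) \<le> r / real (vgcd z)"
      using z'(3) vgcd_pos[OF z'(1,2)] unfolding n by (simp add: field_simps)
    ultimately show "(vgcd z, prim_part z) \<in> Sigma {1..N} (\<lambda>d. prims (r / real d))"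
      using vgcd_pos[OF z'(1,2)] pp by (auto simp: prims_def)
  next
    fix x assume "x \<in> Sigma {1..N} (\<lambda>d. prims (r / real d))"
    then obtain d w where x: "x = (d, w)" "d > 0" "primitive w" "norm w \<le> r / real d" by (auto simp: prims_def)
    show "(vgcd (case x of (d, w) \<Rightarrow> real d *\<^sub>R w), prim_part (case x of (d, w) \<Rightarrow> real d *\<^sub>R w)) = x"
      using prim_part_scaleR[OF x(3,2)] x(1) by simp
    show "(case x of (d, w) \<Rightarrow> real d *\<^sub>R w) \<in> lattice_ball r - {0}"
      using x lattice_point_scaleR[of w d] primitive_nonzero[of w]
      by (auto simp: lattice_ball_def primitive_def field_simps)
    show "f (case x of (d, w) \<Rightarrow> real d *\<^sub>R w) = (case x of (d, w) \<Rightarrow> f (real d *\<^sub>R w))" using x by simp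
  qed
  finally show ?thesis ..
qed

text \<open>Telescoping, as \<open>1 / d\<^sup>2\<close> is at most
  \<open>1 / (d - 1) - 1 / d\<close>.\<close>

lemma sum_inverse_squares_tail:
  assumes "D \<ge> 1" "N \<ge> D"
  shows "(\<Sum>d\<in>{Suc D..N}. 1 / (real d)\<^sup>2) \<le> 1 / real D - 1 / real N"
  using assms(2)
proof (induction N rule: dec_induct)
  case (step N)
  have "N \<ge> 1" using step assms by simp
  then have "1 / real N - 1 / real (Suc N) = 1 / (real N * real (Suc N))" by (simp add: field_simps)
  moreover have "1 / (real (Suc N))\<^sup>2 \<le> 1 / (real N * real (Suc N))"
    unfolding power2_eq_square using \<open>N \<ge> 1\<close> by (intro divide_left_mono mult_right_mono) auto
  ultimately have "1 / (real (Suc N))\<^sup>2 \<le> 1 / real N - 1 / real (Suc N)" by simp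
  then show ?case using step by simp
qed simp

lemma sum_inverse_squares_from_2: "(\<Sum>d\<in>{2..N}. 1 / (real d)\<^sup>2) \<le> 3/4"
proof (cases "N \<ge> 2")
  case True
  then have "{2..N} = insert 2 {Suc 2..N}" by auto
  then have "(\<Sum>d\<in>{2..N}. 1 / (real d)\<^sup>2) = 1/4 + (\<Sum>d\<in>{Suc 2..N}. 1 / (real d)\<^sup>2)" by simp
  also have "\<dots> \<le> 1/4 + (1/2 - 1 / real N)" using sum_inverse_squares_tail[of 2 N] True by simp
  also have "\<dots> \<le> 3/4" by simp
  finally show ?thesis .
qed simp

lemma inverse_squares_tendsto:
  "(\<lambda>N. \<Sum>d\<in>{1..N}. 1 / (real d)\<^sup>2) \<longlonglongrightarrow> pi\<^sup>2 / 6"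
proof -
  have "(\<lambda>N. \<Sum>n<N. 1 / (real n + 1)\<^sup>2) \<longlonglongrightarrow> pi\<^sup>2 / 6"
    using inverse_squares_sums by (simp add: sums_def add.commute)
  moreover have "(\<Sum>n<N. 1 / (real n + 1)\<^sup>2) = (\<Sum>d\<in>{1..N}. 1 / (real d)\<^sup>2)" for N
    by (induction N) (auto simp: add.commute)
  ultimately show ?thesis by simp
qed

text \<open>Used to know that the density \<open>6 / pi\<^sup>2\<close> is at least 4/7, which
  leaves enough room above 1/2 for the pigeonhole argument.\<close>

lemma zeta2_le: "pi\<^sup>2 / 6 \<le> 7/4"
proof (rule LIMSEQ_le_const2[OF inverse_squares_tendsto], intro exI allI impI)
  fix N :: nat assume N: "N \<ge> 1"
  then have "{1..N} = insert 1 {2..N}" by auto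
  then show "(\<Sum>d\<in>{1..N}. 1 / (real d)\<^sup>2) \<le> 7/4" using sum_inverse_squares_from_2[of N] by simp
qed

text \<open>Since \<open>\<Sum>d\<ge>2. 1 / d\<^sup>2 < 1\<close>, the dilation sum over \<open>d\<close> can be inverted by a contraction
  argument, without the Moebius function.\<close>
lemma dilation_sum_null_imp_null:
  fixes m :: "real \<Rightarrow> real" and N :: "real \<Rightarrow> nat"
  assumes bd: "\<And>t. t > 0 \<Longrightarrow> \<bar>m t\<bar> \<le> K"
    and N: "\<forall>\<^sub>F t in at_top. N t \<ge> 1"
    and lim: "((\<lambda>t. \<Sum>d\<in>{1..N t}. m (t / real d) / (real d)\<^sup>2) \<longlongrightarrow> 0) at_top"
  shows "(m \<longlongrightarrow> 0) at_top"
proof -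
  \<comment> \<open>The factor is 3/4 + 1/40 + 1/40: the bound \<open>a\<close> on all terms from 2
    on, the extra tail beyond \<open>D\<close>, and the dilation sum itself.\<close>
  have step: "\<forall>\<^sub>F t in at_top. \<bar>m t\<bar> \<le> 4/5 * a"
    if ev: "\<forall>\<^sub>F t in at_top. \<bar>m t\<bar> \<le> a" and a: "a > 0" for a
  proof -
    obtain T where T: "\<And>t. t \<ge> T \<Longrightarrow> \<bar>m t\<bar> \<le> a" using ev by (auto simp: eventually_at_top_linorder)
    \<comment> \<open>For \<open>d > D\<close> the argument \<open>t / d\<close> may be too small
      for the eventual bound \<open>a\<close>; there only the global bound \<open>K\<close> applies,
      and the tail of the series makes it small.\<close>
    obtain D :: nat where D: "real D > 40 * \<bar>K\<bar> / a" "D \<ge> 1"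
      using reals_Archimedean2[of "max (40 * \<bar>K\<bar> / a) 1"] by (metis less_max_iff_disj max_less_iff_conj nat_less_real_le of_nat_1 of_nat_less_iff less_imp_le)
    have KD: "\<bar>K\<bar> / real D \<le> a / 40" using D a by (simp add: field_simps)
    have "\<forall>\<^sub>F t in at_top. \<bar>\<Sum>d\<in>{1..N t}. m (t / real d) / (real d)\<^sup>2\<bar> < a / 40"
      using tendstoD[OF lim, of "a/40"] a by (simp add: dist_real_def)
    with N show ?thesis using eventually_ge_at_top[of "real D * \<bar>T\<bar>"] eventually_gt_at_top[of 0]
    proof eventually_elim
      case (elim t)
      have tm: "\<bar>m (t / real d) / (real d)\<^sup>2\<bar> \<le> a * (1 / (real d)\<^sup>2) + (if d > D then \<bar>K\<bar> * (1 / (real d)\<^sup>2) else 0)"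
        if d: "d \<in> {2..N t}" for d
      proof (cases "d > D")
        case True
        have "\<bar>m (t / real d)\<bar> \<le> a + \<bar>K\<bar>" using bd[of "t / real d"] elim d a by fastforce
        then have "\<bar>m (t / real d)\<bar> / (real d)\<^sup>2 \<le> (a + \<bar>K\<bar>) / (real d)\<^sup>2" by (intro divide_right_mono) auto
        then show ?thesis using True by (simp add: abs_divide add_divide_distrib)
      next
        case False
        have "real d * \<bar>T\<bar> \<le> real D * \<bar>T\<bar>" using False by (intro mult_right_mono) auto
        then have "\<bar>T\<bar> \<le> t / real d" using elim d by (simp add: field_simps)
        then have "\<bar>m (t / real d)\<bar> \<le> a" by (intro T) auto
        then have "\<bar>m (t / real d)\<bar> / (real d)\<^sup>2 \<le> a / (real d)\<^sup>2" by (intro divide_right_mono) auto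
        then show ?thesis using False by (simp add: abs_divide)
      qed
      have tail: "(\<Sum>d\<in>{2..N t}. if d > D then \<bar>K\<bar> * (1 / (real d)\<^sup>2) else 0) \<le> a / 40"
      proof -
        have "(\<Sum>d\<in>{2..N t}. if d > D then \<bar>K\<bar> * (1 / (real d)\<^sup>2) else 0)
            = (\<Sum>d\<in>{d \<in> {2..N t}. d > D}. \<bar>K\<bar> * (1 / (real d)\<^sup>2))"
          by (rule sum.inter_filter[symmetric]) simp
        also have "{d \<in> {2..N t}. d > D} = {Suc D..N t}" using D(2) by auto
        also have "(\<Sum>d\<in>{Suc D..N t}. \<bar>K\<bar> * (1 / (real d)\<^sup>2)) = \<bar>K\<bar> * (\<Sum>d\<in>{Suc D..N t}. 1 / (real d)\<^sup>2)"
          by (rule sum_distrib_left[symmetric])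
        also have "\<dots> \<le> \<bar>K\<bar> * (1 / real D)"
        proof (rule mult_left_mono)
          show "(\<Sum>d\<in>{Suc D..N t}. 1 / (real d)\<^sup>2) \<le> 1 / real D"
          proof (cases "N t \<ge> D")
            case True then show ?thesis using sum_inverse_squares_tail[OF D(2) True]
              by (smt (verit) divide_nonneg_nonneg of_nat_0_le_iff)
          qed simp
        qed simp
        finally show ?thesis by (rule order_trans) (use KD in simp)
      qed
      have "{1..N t} = insert 1 {2..N t}" using elim by auto
      then have "(\<Sum>d\<in>{1..N t}. m (t / real d) / (real d)\<^sup>2) = m t + (\<Sum>d\<in>{2..N t}. m (t / real d) / (real d)\<^sup>2)" by simp
      moreover have "\<bar>\<Sum>d\<in>{2..N t}. m (t / real d) / (real d)\<^sup>2\<bar> \<le> a * (3/4) + a / 40"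
      proof -
        have "\<bar>\<Sum>d\<in>{2..N t}. m (t / real d) / (real d)\<^sup>2\<bar> \<le> (\<Sum>d\<in>{2..N t}. \<bar>m (t / real d) / (real d)\<^sup>2\<bar>)" by (rule sum_abs)
        also have "\<dots> \<le> (\<Sum>d\<in>{2..N t}. a * (1 / (real d)\<^sup>2) + (if d > D then \<bar>K\<bar> * (1 / (real d)\<^sup>2) else 0))"
          by (rule sum_mono) (rule tm)
        also have "\<dots> = a * (\<Sum>d\<in>{2..N t}. 1 / (real d)\<^sup>2) + (\<Sum>d\<in>{2..N t}. if d > D then \<bar>K\<bar> * (1 / (real d)\<^sup>2) else 0)"
          by (simp only: sum.distrib sum_distrib_left)
        also have "\<dots> \<le> a * (3/4) + a / 40" using sum_inverse_squares_from_2 tail a by (intro add_mono mult_left_mono) auto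
        finally show ?thesis .
      qed
      ultimately show ?case using elim by linarith
    qed
  qed
  define K' where "K' = \<bar>K\<bar> + 1"
  have iter: "\<forall>\<^sub>F t in at_top. \<bar>m t\<bar> \<le> (4/5)^k * K'" for k
  proof (induction k)
    case 0
    show ?case using eventually_gt_at_top[of 0]
    proof eventually_elim
      case (elim t) then show ?case using bd[OF elim] by (simp add: K'_def)
    qed
  next
    case (Suc k)
    show ?case using step[OF Suc] by (simp add: K'_def mult.assoc)
  qed
  show ?thesis
  proof (rule tendstoI)
    fix \<epsilon> :: real assume \<epsilon>: "\<epsilon> > 0"
    have K': "K' > 0" by (simp add: K'_def)
    obtain k where "(4/5::real)^k < \<epsilon> / K'" using real_arch_pow_inv[of "\<epsilon> / K'" "4/5"] \<epsilon> K' by auto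
    then have "(4/5)^k * K' < \<epsilon>" using K' by (simp add: field_simps)
    then show "\<forall>\<^sub>F t in at_top. dist (m t) 0 < \<epsilon>"
      using iter[of k] by (elim eventually_mono) (simp add: dist_real_def)
  qed
qed

context riemann_integrable_function
begin

lemma primitive_sum_tendsto:
  "((\<lambda>t. (\<Sum>z\<in>prims (R * t). F ((1/t) *\<^sub>R z)) / t\<^sup>2) \<longlongrightarrow> 6 / pi\<^sup>2 * integral\<^sup>L lborel F) at_top"
proof -
  define M where "M t = (\<Sum>z\<in>prims (R * t). F ((1/t) *\<^sub>R z)) / t\<^sup>2" for t
  define I c where "I = integral\<^sup>L lborel F" and "c = 6 / pi\<^sup>2 * I"
  define N where "N t = nat \<lceil>R * t\<rceil>" for t
  have Ntop: "filterlim N at_top at_top"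
    unfolding filterlim_at_top
  proof
    fix Z :: nat
    show "\<forall>\<^sub>F t in at_top. Z \<le> N t"
      using eventually_ge_at_top[of "real Z / R"]
    proof eventually_elim
      case (elim t)
      then have "real Z \<le> R * t" using R by (simp add: field_simps)
      then show ?case unfolding N_def by linarith
    qed
  qed
  \<comment> \<open>The bound must hold for all \<open>t > 0\<close>, as the dilation sum evaluates
    \<open>M\<close> at every \<open>t / d\<close>. For small \<open>t\<close> there is no primitive
    vector in range.\<close>
  have bd: "\<bar>M t - c\<bar> \<le> 9 * R\<^sup>2 * K + \<bar>c\<bar>" if t: "t > 0" for t
  proof -
    have "\<bar>M t\<bar> \<le> 9 * R\<^sup>2 * K"
    proof (cases "R * t \<ge> 1")
      case True
      have "\<bar>\<Sum>z\<in>prims (R * t). F ((1/t) *\<^sub>R z)\<bar> \<le> (\<Sum>z\<in>prims (R * t). K)"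
        by (rule order_trans[OF sum_abs]) (rule sum_mono, rule bound)
      also have "\<dots> \<le> real (card (lattice_ball (R * t))) * K"
        using card_mono[OF _ prims_subset, of "R * t"] K_nonneg by (simp add: mult_right_mono)
      also have "\<dots> \<le> 9 * (R * t)\<^sup>2 * K" using card_lattice_ball_le[OF True] K_nonneg by (intro mult_right_mono) auto
      finally show ?thesis using t by (simp add: M_def abs_divide field_simps power2_eq_square)
    next
      case False
      have "prims (R * t) = {}"
        using False norm_lattice_ge_1 primitive_lattice primitive_nonzero by (force simp: prims_def)
      then show ?thesis using K_nonneg by (simp add: M_def)
    qed
    then show ?thesis by linarith
  qed
  \<comment> \<open>Passing from \<open>t\<close> to \<open>t / d\<close> replaces \<open>w\<close>
    by \<open>d\<close> times \<open>w\<close>, so the sum over \<open>d\<close> runs through the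
    non-zero lattice vectors grouped by gcd.\<close>
  have id: "(\<Sum>d\<in>{1..N t}. M (t / real d) / (real d)\<^sup>2) = (\<Sum>z\<in>lattice_ball (R * t) - {0}. F ((1/t) *\<^sub>R z)) / t\<^sup>2"
    if t: "t > 0" for t
  proof -
    have "R * t \<le> real (N t)" unfolding N_def by (simp add: real_nat_ceiling_ge)
    from sum_lattice_by_gcd[OF this, of "\<lambda>z. F ((1/t) *\<^sub>R z)"]
    have "(\<Sum>z\<in>lattice_ball (R * t) - {0}. F ((1/t) *\<^sub>R z)) / t\<^sup>2
        = (\<Sum>d\<in>{1..N t}. (\<Sum>w\<in>prims (R * t / real d). F ((1/t) *\<^sub>R real d *\<^sub>R w)) / t\<^sup>2)"
      by (simp add: sum_divide_distrib)
    also have "\<dots> = (\<Sum>d\<in>{1..N t}. M (t / real d) / (real d)\<^sup>2)"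
      by (rule sum.cong) (auto simp: M_def field_simps power2_eq_square)
    finally show ?thesis ..
  qed
  have lim0: "((\<lambda>t. (\<Sum>z\<in>lattice_ball (R * t) - {0}. F ((1/t) *\<^sub>R z)) / t\<^sup>2) \<longlongrightarrow> I - 0) at_top"
  proof (rule Lim_transform_eventually)
    show "((\<lambda>t. (\<Sum>z\<in>lattice_ball (R * t). F ((1/t) *\<^sub>R z)) / t\<^sup>2 - F 0 / t\<^sup>2) \<longlongrightarrow> I - 0) at_top"
      unfolding I_def by (intro tendsto_diff lattice_sum_tendsto real_tendsto_divide_at_top[OF tendsto_const]
        filterlim_pow_at_top filterlim_ident) simp
    show "\<forall>\<^sub>F t in at_top. (\<Sum>z\<in>lattice_ball (R * t). F ((1/t) *\<^sub>R z)) / t\<^sup>2 - F 0 / t\<^sup>2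
        = (\<Sum>z\<in>lattice_ball (R * t) - {0}. F ((1/t) *\<^sub>R z)) / t\<^sup>2"
      using eventually_gt_at_top[of 0]
    proof eventually_elim
      case (elim t)
      have "0 \<in> lattice_ball (R * t)" using elim R by (simp add: lattice_ball_def lattice_point_def)
      from sum.remove[OF finite_lattice_ball this, of "\<lambda>z. F ((1/t) *\<^sub>R z)"]
      show ?case by (simp add: add_divide_distrib)
    qed
  qed
  \<comment> \<open>Subtracting \<open>c\<close> in every term brings the limit to 0, since the
    inverse squares sum to \<open>pi\<^sup>2 / 6\<close>.\<close>
  have "((\<lambda>t. \<Sum>d\<in>{1..N t}. (M (t / real d) - c) / (real d)\<^sup>2) \<longlongrightarrow> (I - 0) - c * (pi\<^sup>2 / 6)) at_top"
  proof (rule Lim_transform_eventually)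
    show "((\<lambda>t. (\<Sum>z\<in>lattice_ball (R * t) - {0}. F ((1/t) *\<^sub>R z)) / t\<^sup>2 - c * (\<Sum>d\<in>{1..N t}. 1 / (real d)\<^sup>2))
        \<longlongrightarrow> (I - 0) - c * (pi\<^sup>2 / 6)) at_top"
      by (intro tendsto_diff lim0 tendsto_mult tendsto_const filterlim_compose[OF inverse_squares_tendsto Ntop])
    show "\<forall>\<^sub>F t in at_top. (\<Sum>z\<in>lattice_ball (R * t) - {0}. F ((1/t) *\<^sub>R z)) / t\<^sup>2 - c * (\<Sum>d\<in>{1..N t}. 1 / (real d)\<^sup>2)
        = (\<Sum>d\<in>{1..N t}. (M (t / real d) - c) / (real d)\<^sup>2)"
      using eventually_gt_at_top[of 0]
      by eventually_elim (simp add: id[symmetric] diff_divide_distrib sum_subtractf sum_distrib_left)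
  qed
  moreover have z: "(I - 0) - c * (pi\<^sup>2 / 6) = 0" by (simp add: c_def)
  ultimately have "((\<lambda>t. \<Sum>d\<in>{1..N t}. (M (t / real d) - c) / (real d)\<^sup>2) \<longlongrightarrow> 0) at_top"
    by (simp only: z)
  moreover have "\<forall>\<^sub>F t in at_top. N t \<ge> 1" using Ntop by (simp add: filterlim_at_top)
  ultimately have "((\<lambda>t. M t - c) \<longlongrightarrow> 0) at_top" by (intro dilation_sum_null_imp_null[OF bd])
  then have "(M \<longlongrightarrow> c) at_top" by (simp add: LIM_zero_iff)
  then show ?thesis by (simp add: M_def[abs_def] c_def I_def)
qed

end

text \<open>The product with the indicator is continuous off the frontier of \<open>K\<close>, and
  the frontier of a convex set is null.\<close>

lemma riemann_integrable_convex:
  assumes K: "compact K" "convex K" and f: "continuous_on UNIV f"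
  obtains B R where "riemann_integrable_function (\<lambda>x. indicator K x * f x) B R" "K \<subseteq> cball 0 R"
    "integral\<^sup>L lborel (\<lambda>x. indicator K x * f x) = integral K f"
proof -
  obtain R where R: "R > 0" "K \<subseteq> cball 0 R"
    using compact_imp_bounded[OF K(1)] unfolding bounded_pos by (meson mem_cball_0 subsetI)
  have fK: "continuous_on K f" using f continuous_on_subset by blast
  obtain B where B: "B > 0" "\<And>x. x \<in> K \<Longrightarrow> \<bar>f x\<bar> \<le> B"
    using compact_imp_bounded[OF compact_continuous_image[OF fK K(1)]] by (auto simp: bounded_pos)
  have "frontier K \<in> null_sets lborel"
    using negligible_convex_frontier[OF K(2)] by (simp add: negligible_iff_null_sets null_sets_completion_iff)
  then have AE: "AE x in lborel. x \<notin> frontier K" by (rule AE_not_in)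
  have "riemann_integrable_function (\<lambda>x. indicator K x * f x) B R"
  proof
    show "(\<lambda>x. indicator K x * f x) \<in> borel_measurable borel"
      using f K(1) by (intro borel_measurable_times borel_measurable_indicator borel_measurable_continuous_onI)
        (auto simp: borel_closed compact_imp_closed)
    show "\<bar>indicator K x * f x\<bar> \<le> B" for x using B by (auto simp: indicator_def)
    show "norm x > R \<Longrightarrow> indicator K x * f x = 0" for x using R(2) by (auto simp: indicator_def)
    show "AE x in lborel. isCont (\<lambda>x. indicator K x * f x) x"
      using AE
    proof eventually_elim
      case (elim x)
      have "isCont f x" using f by (simp add: continuous_on_eq_continuous_at)
      then show ?case using elim isCont_indicator[of x K] by (intro continuous_mult) auto
    qed
  qed (rule R)
  moreover have "integral\<^sup>L lborel (\<lambda>x. indicator K x * f x) = integral K f"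
    using set_borel_integral_eq_integral(2)[of K f] borel_integrable_compact[OF K(1) fK]
    by (simp add: set_integrable_def set_lebesgue_integral_def)
  ultimately show ?thesis using R(2) that by blast
qed

section \<open>Lattice points and primitive vectors in dilates of a convex body\<close>

definition lattice_in :: "real \<Rightarrow> (real^2) set \<Rightarrow> (real^2) set" where
  "lattice_in t K = {z. lattice_point z \<and> (1/t) *\<^sub>R z \<in> K}"

definition prims_in :: "real \<Rightarrow> (real^2) set \<Rightarrow> (real^2) set" where
  "prims_in t K = {z. primitive z \<and> (1/t) *\<^sub>R z \<in> K}"

lemma prims_in_subset: "prims_in t K \<subseteq> lattice_in t K"
  by (auto simp: prims_in_def lattice_in_def primitive_def)

lemma finite_lattice_in:
  assumes "bounded K" "t > 0" shows "finite (lattice_in t K)"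
proof -
  obtain R where R: "\<And>x. x \<in> K \<Longrightarrow> norm x \<le> R" using assms(1) unfolding bounded_iff by blast
  have "lattice_in t K \<subseteq> lattice_ball (R * t)"
  proof
    fix z assume z: "z \<in> lattice_in t K"
    then have "norm ((1/t) *\<^sub>R z) \<le> R" by (intro R) (simp add: lattice_in_def)
    then have "norm z \<le> R * t" using assms(2) by (simp add: field_simps)
    then show "z \<in> lattice_ball (R * t)" using z by (simp add: lattice_in_def lattice_ball_def)
  qed
  then show ?thesis by (rule finite_subset) simp
qed

lemma finite_prims_in: "bounded K \<Longrightarrow> t > 0 \<Longrightarrow> finite (prims_in t K)"
  by (rule finite_subset[OF prims_in_subset finite_lattice_in])

lemma lattice_sum_convex:
  assumes K: "compact K" "convex K" and f: "continuous_on UNIV f"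
  shows "((\<lambda>t. (\<Sum>z\<in>lattice_in t K. f ((1/t) *\<^sub>R z)) / t\<^sup>2) \<longlongrightarrow> integral K f) at_top"
    and "((\<lambda>t. (\<Sum>z\<in>prims_in t K. f ((1/t) *\<^sub>R z)) / t\<^sup>2) \<longlongrightarrow> 6 / pi\<^sup>2 * integral K f) at_top"
proof -
  obtain B R where r: "riemann_integrable_function (\<lambda>x. indicator K x * f x) B R" and KR: "K \<subseteq> cball 0 R"
    and I: "integral\<^sup>L lborel (\<lambda>x. indicator K x * f x) = integral K f"
    using riemann_integrable_convex[OF K f] by blast
  interpret riemann_integrable_function "\<lambda>x. indicator K x * f x" B R by (rule r)
  have b: "norm z \<le> R * t" if "t > 0" "(1/t) *\<^sub>R z \<in> K" for t and z :: "real^2"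
  proof -
    have "norm ((1/t) *\<^sub>R z) \<le> R" using that KR by (meson mem_cball_0 subsetD)
    then show ?thesis using that(1) by (simp add: field_simps)
  qed
  show "((\<lambda>t. (\<Sum>z\<in>lattice_in t K. f ((1/t) *\<^sub>R z)) / t\<^sup>2) \<longlongrightarrow> integral K f) at_top"
  proof (rule Lim_transform_eventually[OF lattice_sum_tendsto[unfolded I]])
    show "\<forall>\<^sub>F t in at_top. (\<Sum>z\<in>lattice_ball (R * t). indicator K ((1/t) *\<^sub>R z) * f ((1/t) *\<^sub>R z)) / t\<^sup>2
        = (\<Sum>z\<in>lattice_in t K. f ((1/t) *\<^sub>R z)) / t\<^sup>2"
      using eventually_gt_at_top[of 0]
    proof eventually_elim
      case (elim t)
      have "(\<Sum>z\<in>lattice_ball (R * t). indicator K ((1/t) *\<^sub>R z) * f ((1/t) *\<^sub>R z)) = (\<Sum>z\<in>lattice_in t K. f ((1/t) *\<^sub>R z))"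
      proof (rule sum.mono_neutral_cong_right[OF finite_lattice_ball])
        show "lattice_in t K \<subseteq> lattice_ball (R * t)"
          using b[OF elim] by (auto simp: lattice_in_def lattice_ball_def)
      qed (auto simp: lattice_in_def lattice_ball_def)
      then show ?case by simp
    qed
  qed
  show "((\<lambda>t. (\<Sum>z\<in>prims_in t K. f ((1/t) *\<^sub>R z)) / t\<^sup>2) \<longlongrightarrow> 6 / pi\<^sup>2 * integral K f) at_top"
  proof (rule Lim_transform_eventually[OF primitive_sum_tendsto[unfolded I]])
    show "\<forall>\<^sub>F t in at_top. (\<Sum>z\<in>prims (R * t). indicator K ((1/t) *\<^sub>R z) * f ((1/t) *\<^sub>R z)) / t\<^sup>2
        = (\<Sum>z\<in>prims_in t K. f ((1/t) *\<^sub>R z)) / t\<^sup>2"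
      using eventually_gt_at_top[of 0]
    proof eventually_elim
      case (elim t)
      have "(\<Sum>z\<in>prims (R * t). indicator K ((1/t) *\<^sub>R z) * f ((1/t) *\<^sub>R z)) = (\<Sum>z\<in>prims_in t K. f ((1/t) *\<^sub>R z))"
      proof (rule sum.mono_neutral_cong_right[OF finite_prims])
        show "prims_in t K \<subseteq> prims (R * t)"
          using b[OF elim] by (auto simp: prims_in_def prims_def)
      qed (auto simp: prims_in_def prims_def)
      then show ?case by simp
    qed
  qed
qed

lemma card_lattice_in_tendsto:
  assumes K: "compact K" "convex K"
  shows "((\<lambda>t. real (card (lattice_in t K)) / t\<^sup>2) \<longlongrightarrow> measure lebesgue K) at_top"
    and "((\<lambda>t. real (card (prims_in t K)) / t\<^sup>2) \<longlongrightarrow> 6 / pi\<^sup>2 * measure lebesgue K) at_top"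
  using lattice_sum_convex[OF K, of "\<lambda>_. 1"] lmeasure_integral[OF lmeasurable_compact[OF K(1)]]
  by simp_all

section \<open>Gauges and the centred gauge\<close>

text \<open>An asymmetric norm, comparable to the Euclidean one. Both \<open>norm_D D\<close> and
  its later tilt by a linear form are of this kind.\<close>

locale gauge =
  fixes H :: "real^2 \<Rightarrow> real" and m M :: real
  assumes subadd: "H (x + y) \<le> H x + H y"
    and homog: "c \<ge> 0 \<Longrightarrow> H (c *\<^sub>R x) = c * H x"
    and lower: "m * norm x \<le> H x"
    and upper: "H x \<le> M * norm x"
    and m_pos: "m > 0"
begin

lemma zero [simp]: "H 0 = 0" using homog[of 0 0] by simp

lemma nonneg: "H x \<ge> 0" using lower[of x] m_pos by (meson mult_nonneg_nonneg norm_ge_zero less_imp_le order_trans)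

lemma m_le_M: "m \<le> M"
  using order_trans[OF lower upper, of "axis 1 1"] by simp

lemma M_pos: "M > 0" using m_le_M m_pos by linarith

lemma lipschitz: "\<bar>H x - H y\<bar> \<le> M * norm (x - y)"
proof -
  have "H x \<le> H (x - y) + H y" "H y \<le> H (y - x) + H x" using subadd[of "x - y" y] subadd[of "y - x" x] by simp_all
  moreover have "H (x - y) \<le> M * norm (x - y)" "H (y - x) \<le> M * norm (x - y)"
    using upper[of "x - y"] upper[of "y - x"] by (simp_all add: norm_minus_commute)
  ultimately show ?thesis by linarith
qed

lemma continuous: "continuous_on S H"
proof -
  have "M-lipschitz_on S H"
    using lipschitz M_pos by (intro lipschitz_onI) (auto simp: dist_real_def dist_norm)
  then show ?thesis by (rule lipschitz_on_continuous_on)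
qed

lemma convex_comb: "0 \<le> a \<Longrightarrow> 0 \<le> b \<Longrightarrow> H (a *\<^sub>R x + b *\<^sub>R y) \<le> a * H x + b * H y"
  using subadd[of "a *\<^sub>R x" "b *\<^sub>R y"] homog by simp

definition body :: "(real^2) set" where "body = {x. H x \<le> 1}"

lemma convex_sublevel: "convex {x. H x \<le> a}"
proof (rule convexI)
  fix x y u v assume *: "x \<in> {x. H x \<le> a}" "y \<in> {x. H x \<le> a}" "0 \<le> u" "0 \<le> v" "u + v = (1::real)"
  have "H (u *\<^sub>R x + v *\<^sub>R y) \<le> u * H x + v * H y" using * by (intro convex_comb)
  also have "\<dots> \<le> u * a + v * a" using * by (intro add_mono mult_left_mono) auto
  also have "\<dots> = a" using *(5) by (simp add: distrib_right[symmetric])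
  finally show "u *\<^sub>R x + v *\<^sub>R y \<in> {x. H x \<le> a}" by simp
qed

lemma sublevel_subset: "{x. H x \<le> a} \<subseteq> cball 0 (a / m)"
proof
  fix x assume "x \<in> {x. H x \<le> a}"
  then have "m * norm x \<le> a" using lower[of x] by simp
  then show "x \<in> cball 0 (a / m)" using m_pos by (simp add: field_simps)
qed

lemma compact_sublevel: "compact {x. H x \<le> a}"
proof -
  have "closed {x. H x \<le> a}" by (intro closed_Collect_le continuous continuous_on_const)
  moreover have "bounded {x. H x \<le> a}" using sublevel_subset bounded_cball bounded_subset by blast
  ultimately show ?thesis by (simp add: compact_eq_bounded_closed)
qed

lemma convex_body: "convex body" and compact_body: "compact body"
  unfolding body_def by (rule convex_sublevel, rule compact_sublevel)

lemma cball_subset_body: "cball 0 (1 / M) \<subseteq> body"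
proof
  fix x :: "real^2" assume "x \<in> cball 0 (1 / M)"
  then have "M * norm x \<le> 1" using M_pos by (simp add: field_simps)
  then show "x \<in> body" using upper[of x] by (simp add: body_def)
qed

lemma body_in_convex_bodies: "body \<in> convex_bodies"
proof -
  have "0 \<in> ball (0::real^2) (1/M)" using M_pos by simp
  then have "0 \<in> interior body" using cball_subset_body ball_subset_cball by (meson interiorI open_ball order_trans)
  then show ?thesis using convex_body compact_body by (auto simp: convex_bodies_def)
qed

lemma scale_mem_body: "t > 0 \<Longrightarrow> (1/t) *\<^sub>R z \<in> body \<longleftrightarrow> H z \<le> t"
  by (simp add: body_def homog field_simps)

end

lemma norm_D_gauge:
  assumes D: "convex D" "compact D" "0 \<in> interior D"
  obtains m M where "gauge (norm_D D) m M"
proof -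
  obtain r where r: "r > 0" "cball 0 r \<subseteq> D" using D(3) mem_interior_cball by blast
  obtain R where R: "R > 0" "\<And>x. x \<in> D \<Longrightarrow> norm x \<le> R" using compact_imp_bounded[OF D(2)] by (auto simp: bounded_pos)
  define S where "S x = {t. 0 \<le> t \<and> x \<in> (\<lambda>y. t *\<^sub>R y) ` D}" for x
  have nD: "norm_D D x = Inf (S x)" for x by (simp add: norm_D_def S_def)
  have ne: "norm x / r \<in> S x" for x
  proof (cases "x = 0")
    case True then show ?thesis using r by (auto simp: S_def intro!: image_eqI[of _ _ 0])
  next
    case False
    have "(r / norm x) *\<^sub>R x \<in> D" using r False by (intro subsetD[OF r(2)]) simp
    moreover have "x = (norm x / r) *\<^sub>R ((r / norm x) *\<^sub>R x)" using r False by simp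
    ultimately have "x \<in> (\<lambda>y. (norm x / r) *\<^sub>R y) ` D" by (rule rev_image_eqI)
    then show ?thesis using r by (simp add: S_def)
  qed
  have bdd: "bdd_below (S x)" for x by (auto simp: S_def)
  have low: "norm x / R \<le> t" if t: "t \<in> S x" for x t
  proof -
    obtain y where y: "y \<in> D" "x = t *\<^sub>R y" "t \<ge> 0" using t by (auto simp: S_def)
    then have "norm x \<le> t * R" using R(2)[OF y(1)] by (simp add: mult_left_mono)
    then show ?thesis using R(1) by (simp add: field_simps)
  qed
  have le: "norm_D D x \<le> t" if "t \<in> S x" for x t unfolding nD by (rule cInf_lower[OF that bdd])
  have ge: "a \<le> norm_D D x" if "\<And>t. t \<in> S x \<Longrightarrow> a \<le> t" for a x
    unfolding nD using ne that by (intro cInf_greatest) auto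
  have scale: "norm_D D (c *\<^sub>R x) \<le> c * norm_D D x" if c: "c > 0" for c x
  proof -
    have "norm_D D (c *\<^sub>R x) / c \<le> norm_D D x"
    proof (rule ge)
      fix t assume "t \<in> S x"
      then have "c * t \<in> S (c *\<^sub>R x)" using c by (auto simp: S_def)
      then show "norm_D D (c *\<^sub>R x) / c \<le> t" using le c by (simp add: field_simps)
    qed
    then show ?thesis using c by (simp add: field_simps)
  qed
  have zero: "norm_D D 0 = 0"
  proof (rule antisym)
    show "norm_D D 0 \<le> 0" using le[OF ne[of 0]] by simp
    show "0 \<le> norm_D D 0" by (rule ge) (simp add: S_def)
  qed
  have "gauge (norm_D D) (1 / R) (1 / r)"
  proof
    show "norm_D D (x + y) \<le> norm_D D x + norm_D D y" for x y
    proof -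
      have st: "norm_D D (x + y) \<le> s + t" if s: "s \<in> S x" and t: "t \<in> S y" for s t
      proof (cases "s + t = 0")
        case True
        then have "s = 0" "t = 0" using s t by (auto simp: S_def)
        then have "x = 0" "y = 0" using s t by (auto simp: S_def)
        then show ?thesis using zero True by simp
      next
        case False
        obtain a b where ab: "a \<in> D" "x = s *\<^sub>R a" "s \<ge> 0" "b \<in> D" "y = t *\<^sub>R b" "t \<ge> 0"
          using s t by (auto simp: S_def)
        have "(s / (s + t)) *\<^sub>R a + (t / (s + t)) *\<^sub>R b \<in> D"
          using ab False by (intro convexD[OF D(1)]) (auto simp: add_divide_distrib[symmetric])
        moreover have "x + y = (s + t) *\<^sub>R ((s / (s + t)) *\<^sub>R a + (t / (s + t)) *\<^sub>R b)"
          using ab False by (simp add: scaleR_add_right)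
        ultimately have "x + y \<in> (\<lambda>z. (s + t) *\<^sub>R z) ` D" by (rule rev_image_eqI)
        then have "s + t \<in> S (x + y)" using ab by (simp add: S_def)
        then show ?thesis by (rule le)
      qed
      have "norm_D D (x + y) - norm_D D x \<le> norm_D D y"
      proof (rule ge)
        fix t assume t: "t \<in> S y"
        have "norm_D D (x + y) - t \<le> norm_D D x" by (rule ge) (use st[OF _ t] in fastforce)
        then show "norm_D D (x + y) - norm_D D x \<le> t" by linarith
      qed
      then show ?thesis by linarith
    qed
    show "norm_D D (c *\<^sub>R x) = c * norm_D D x" if c: "c \<ge> 0" for c x
    proof (cases "c = 0")
      case True then show ?thesis using zero by simp
    next
      case False
      then have c: "c > 0" using c by simp
      have "norm_D D x \<le> (1 / c) * norm_D D (c *\<^sub>R x)" using scale[of "1/c" "c *\<^sub>R x"] c by simp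
      then have "c * norm_D D x \<le> norm_D D (c *\<^sub>R x)" using c by (simp add: field_simps)
      then show ?thesis using scale[OF c, of x] by linarith
    qed
    show "1 / R * norm x \<le> norm_D D x" for x using low by (intro ge) simp
    show "norm_D D x \<le> 1 / r * norm x" for x using le[OF ne[of x]] by simp
    show "1 / R > 0" using R by simp
  qed
  then show ?thesis by (rule that)
qed

section \<open>The multipliers: a dual problem truncated to a box\<close>

lemma cube_facts:
  fixes r :: real assumes r: "r \<ge> 0"
  defines "Q \<equiv> cbox (- (\<chi> i. r)) (\<chi> i. r) :: (real^2) set"
  shows "compact Q" "convex Q" "measure lebesgue Q = (2 * r)\<^sup>2" "cball 0 r \<subseteq> Q" "Q \<subseteq> cball 0 (2 * r)"
    "integral Q (\<lambda>x. w \<bullet> x) = 0"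
proof -
  show "compact Q" "convex Q" by (simp_all add: Q_def)
  have ne: "Q \<noteq> {}" unfolding Q_def interval_ne_empty_cart using r by simp
  show "measure lebesgue Q = (2 * r)\<^sup>2"
    using content_cbox_cart[OF ne[unfolded Q_def]] by (simp add: Q_def prod_2 power2_eq_square)
  have mem: "x \<in> Q \<longleftrightarrow> \<bar>x$1\<bar> \<le> r \<and> \<bar>x$2\<bar> \<le> r" for x
    by (auto simp: Q_def mem_box_cart forall_2)
  show "cball 0 r \<subseteq> Q" unfolding subset_iff mem mem_cball_0
    using component_le_norm_cart order_trans by blast
  show "Q \<subseteq> cball 0 (2 * r)" unfolding subset_iff mem mem_cball_0 using norm_vec2_le by (smt (verit))
  have "integral Q (\<lambda>x. w \<bullet> (- x)) = integral Q (\<lambda>x. w \<bullet> x)"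
    unfolding Q_def using integral_reflect[of "\<chi> i. r" "- (\<chi> i. r)" "\<lambda>x. w \<bullet> x"] by simp
  then show "integral Q (\<lambda>x. w \<bullet> x) = 0" by simp
qed

text \<open>The box \<open>B\<close> keeps all integrals finite. \<open>R \<ge> 1\<close> makes room
  in it for the unit square as a competitor and makes its area at least 4.\<close>

locale truncated_gauge = gauge g m M for g m M +
  fixes R :: real assumes R1: "R \<ge> 1"
begin

definition B :: "(real^2) set" where "B = cbox (- (\<chi> i. R)) (\<chi> i. R)"

definition N :: "(real^2) measure" where "N = restrict_space lborel B"

text \<open>The Lagrangian density; \<open>\<theta>\<close> consists of the multiplier of the area
  and that of the centroid.\<close>

definition p :: "real \<times> (real^2) \<Rightarrow> real^2 \<Rightarrow> real" where "p \<theta> x = fst \<theta> + snd \<theta> \<bullet> x - g x"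

lemma B_facts: "compact B" "convex B" "measure lebesgue B = (2 * R)\<^sup>2" "cball 0 R \<subseteq> B" "B \<subseteq> cball 0 (2 * R)"
  using cube_facts[of R] R1 unfolding B_def by auto

lemma sets_B [measurable]: "B \<in> sets borel" by (simp add: B_def)

lemma space_N: "space N = B" by (simp add: N_def space_restrict_space)

lemma finite_N: "finite_measure N"
  unfolding N_def
  by (rule finite_measureI)
    (use emeasure_lborel_cbox_finite in \<open>auto simp: emeasure_restrict_space space_restrict_space B_def less_top[symmetric]\<close>)

lemma measurable_N: "f \<in> borel_measurable borel \<Longrightarrow> f \<in> borel_measurable N"
  for f :: "real^2 \<Rightarrow> real"
  unfolding N_def by (rule measurable_restrict_space1) simp

lemma AE_N: "AE x in lborel. P x \<Longrightarrow> AE x in N. P x"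
  unfolding N_def by (subst AE_restrict_space_iff) auto

lemma integrable_N:
  fixes f :: "real^2 \<Rightarrow> real"
  assumes "f \<in> borel_measurable borel" "\<And>x. x \<in> B \<Longrightarrow> \<bar>f x\<bar> \<le> b"
  shows "integrable N f"
proof (rule finite_measure.integrable_const_bound[OF finite_N, of _ b])
  show "AE x in N. norm (f x) \<le> b" using assms(2) by (intro AE_I2) (simp add: space_N)
qed (rule measurable_N[OF assms(1)])

lemma integrable_N_cont:
  fixes f :: "real^2 \<Rightarrow> real" assumes "continuous_on UNIV f"
  shows "integrable N f"
proof -
  have "bounded (f ` B)"
    by (rule compact_imp_bounded[OF compact_continuous_image[OF continuous_on_subset[OF assms subset_UNIV] B_facts(1)]])
  then obtain b where "\<And>x. x \<in> B \<Longrightarrow> \<bar>f x\<bar> \<le> b" by (auto simp: bounded_iff)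
  then show ?thesis using assms by (intro integrable_N borel_measurable_continuous_onI)
qed

lemma integral_N_indicator:
  fixes f :: "real^2 \<Rightarrow> real"
  assumes K: "compact K" "convex K" "K \<subseteq> B" and f: "continuous_on UNIV f"
  shows "(\<integral>x. indicator K x * f x \<partial>N) = integral K f" "integrable N (\<lambda>x. indicator K x * f x)"
proof -
  obtain b R' where r: "riemann_integrable_function (\<lambda>x. indicator K x * f x) b R'"
    and I: "integral\<^sup>L lborel (\<lambda>x. indicator K x * f x) = integral K f"
    using riemann_integrable_convex[OF K(1,2) f] by blast
  interpret riemann_integrable_function "\<lambda>x. indicator K x * f x" b R' by (rule r)
  show "integrable N (\<lambda>x. indicator K x * f x)" by (rule integrable_N[OF meas]) (rule bound)
  have "(\<integral>x. indicator K x * f x \<partial>N) = (\<integral>x. indicator B x *\<^sub>R (indicator K x * f x) \<partial>lborel)"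
    unfolding N_def by (rule integral_restrict_space) simp
  also have "\<dots> = (\<integral>x. indicator K x * f x \<partial>lborel)"
    using K(3) by (intro Bochner_Integration.integral_cong) (auto simp: indicator_def)
  finally show "(\<integral>x. indicator K x * f x \<partial>N) = integral K f" using I by simp
qed

lemma cont_p: "continuous_on UNIV (p \<theta>)"
  unfolding p_def by (intro continuous_intros continuous)

definition VN :: real where "VN = measure N B"

lemma integral_N_le_const:
  fixes f :: "real^2 \<Rightarrow> real"
  assumes "integrable N f" "\<And>x. x \<in> B \<Longrightarrow> f x \<le> c" shows "(\<integral>x. f x \<partial>N) \<le> c * VN"
proof -
  have "(\<integral>x. f x \<partial>N) \<le> (\<integral>x. c \<partial>N)"
    using assms finite_N by (intro integral_mono) (auto simp: space_N finite_measure.integrable_const)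
  then show ?thesis by (simp add: VN_def space_N mult.commute)
qed

text \<open>For \<open>h = g\<close> this is the negative of the Lagrange dual function of
  minimising the integral of \<open>g\<close> over subsets of \<open>B\<close> with area 1 and
  centroid 0: the best set for given multipliers is where \<open>p \<theta>\<close> is positive. For
  \<open>h = 0\<close> it is the recession function, which yields coercivity.\<close>

definition \<Phi> :: "(real^2 \<Rightarrow> real) \<Rightarrow> real \<times> (real^2) \<Rightarrow> real" where
  "\<Phi> h \<theta> = (\<integral>x. max 0 (fst \<theta> + snd \<theta> \<bullet> x - h x) \<partial>N) - fst \<theta>"

lemma \<Phi>_continuous:
  assumes h: "continuous_on UNIV h" shows "continuous_on S (\<Phi> h)"
proof -
  let ?f = "\<lambda>\<theta> x. max 0 (fst \<theta> + snd \<theta> \<bullet> x - h x)"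
  have int: "integrable N (?f \<theta>)" for \<theta> :: "real \<times> (real^2)"
    by (intro integrable_N_cont continuous_intros h)
  let ?L = "(1 + 2 * R) * VN + 1"
  have VN: "VN \<ge> 0" by (simp add: VN_def)
  have *: "\<Phi> h \<theta> - \<Phi> h \<eta> \<le> ?L * norm (\<theta> - \<eta>)" for \<theta> \<eta>
  proof -
    have "(\<integral>x. ?f \<theta> x \<partial>N) - (\<integral>x. ?f \<eta> x \<partial>N) = (\<integral>x. ?f \<theta> x - ?f \<eta> x \<partial>N)"
      using int by (rule Bochner_Integration.integral_diff[symmetric]) (rule int)
    also have "\<dots> \<le> ((1 + 2 * R) * norm (\<theta> - \<eta>)) * VN"
    proof (rule integral_N_le_const)
      show "integrable N (\<lambda>x. ?f \<theta> x - ?f \<eta> x)" using int by auto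
      fix x assume "x \<in> B"
      then have x: "norm x \<le> 2 * R" using B_facts(5) by auto
      have "?f \<theta> x - ?f \<eta> x \<le> \<bar>fst (\<theta> - \<eta>)\<bar> + \<bar>snd (\<theta> - \<eta>) \<bullet> x\<bar>" by (simp add: inner_diff_left)
      also have "\<bar>fst (\<theta> - \<eta>)\<bar> \<le> norm (\<theta> - \<eta>)" by (metis norm_fst_le prod.collapse real_norm_def)
      also have "\<bar>snd (\<theta> - \<eta>) \<bullet> x\<bar> \<le> norm (\<theta> - \<eta>) * (2 * R)"
      proof (rule order_trans[OF Cauchy_Schwarz_ineq2 mult_mono])
        show "norm (snd (\<theta> - \<eta>)) \<le> norm (\<theta> - \<eta>)" by (metis norm_snd_le prod.collapse)
      qed (use x in auto)
      finally show "?f \<theta> x - ?f \<eta> x \<le> (1 + 2 * R) * norm (\<theta> - \<eta>)" by (simp add: algebra_simps)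
    qed
    finally have 1: "(\<integral>x. ?f \<theta> x \<partial>N) - (\<integral>x. ?f \<eta> x \<partial>N) \<le> ((1 + 2 * R) * norm (\<theta> - \<eta>)) * VN" .
    have "norm (fst (\<theta> - \<eta>)) \<le> norm (\<theta> - \<eta>)" by (metis norm_fst_le prod.collapse)
    then have "fst \<eta> - fst \<theta> \<le> norm (\<theta> - \<eta>)" by simp
    then show ?thesis using 1 by (simp add: \<Phi>_def algebra_simps)
  qed
  have "?L-lipschitz_on S (\<Phi> h)"
  proof (rule lipschitz_onI)
    show "0 \<le> ?L" using VN R1 by simp
    show "dist (\<Phi> h \<theta>) (\<Phi> h \<eta>) \<le> ?L * dist \<theta> \<eta>" for \<theta> \<eta>
      using *[of \<theta> \<eta>] *[of \<eta> \<theta>] by (simp add: dist_norm abs_le_iff norm_minus_commute)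
  qed
  then show ?thesis by (rule lipschitz_on_continuous_on)
qed

text \<open>By the sign of \<open>\<mu>\<close>: a negative one is immediate; for a positive one the
  box has area at least 4 and zero first moment; for \<open>\<mu> = 0\<close> a ball placed in the
  direction of \<open>u\<close> contributes a positive amount.\<close>

lemma \<Phi>0_pos:
  assumes "\<theta> \<noteq> 0" shows "\<Phi> (\<lambda>_. 0) \<theta> > 0"
proof -
  obtain \<mu> u where \<theta>: "\<theta> = (\<mu>, u)" by (cases \<theta>)
  let ?f = "\<lambda>x. max 0 (\<mu> + u \<bullet> x)"
  have int: "integrable N ?f" by (intro integrable_N_cont continuous_intros)
  have ge0: "(\<integral>x. ?f x \<partial>N) \<ge> 0" by (rule Bochner_Integration.integral_nonneg) simp
  have "(\<integral>x. ?f x \<partial>N) > \<mu>"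
  proof (cases "\<mu>" "0::real" rule: linorder_cases)
    case less then show ?thesis using ge0 by linarith
  next
    case greater
    have "(\<integral>x. ?f x \<partial>N) \<ge> (\<integral>x. indicator B x * (\<mu> + u \<bullet> x) \<partial>N)"
      by (rule integral_mono[OF integral_N_indicator(2) int]) (use B_facts in \<open>auto intro!: continuous_intros simp: space_N\<close>)
    also have "(\<integral>x. indicator B x * (\<mu> + u \<bullet> x) \<partial>N) = integral B (\<lambda>x. \<mu> + u \<bullet> x)"
      by (rule integral_N_indicator(1)) (use B_facts in \<open>auto intro!: continuous_intros\<close>)
    also have "\<dots> = integral B (\<lambda>x. \<mu>) + integral B (\<lambda>x. u \<bullet> x)"
      by (rule Henstock_Kurzweil_Integration.integral_add)
        (auto simp: B_def intro!: integrable_continuous continuous_intros)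
    also have "\<dots> = \<mu> * (2 * R)\<^sup>2"
      using cube_facts(6)[of R u] R1 lmeasure_integral[OF lmeasurable_compact[OF B_facts(1)]] B_facts(3)
      by (simp add: B_def mult.commute)
    finally have "\<mu> * (2 * R)\<^sup>2 \<le> (\<integral>x. ?f x \<partial>N)" .
    moreover have "(2 * R)\<^sup>2 \<ge> 2\<^sup>2" using R1 by (intro power_mono) auto
    then have "\<mu> * (2 * R)\<^sup>2 > \<mu>" using greater by simp
    ultimately show ?thesis by linarith
  next
    case equal
    then have u: "u \<noteq> 0" using assms \<theta> by (auto simp: zero_prod_def)
    define c where "c = (R / (2 * norm u)) *\<^sub>R u"
    have nc: "norm c = R / 2" "u \<bullet> c = norm u * R / 2" using u R1
      by (auto simp: c_def power2_norm_eq_inner[symmetric] power2_eq_square)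
    have K: "compact (cball c (R/4))" "convex (cball c (R/4))" by auto
    have sub: "cball c (R/4) \<subseteq> B"
    proof
      fix x assume "x \<in> cball c (R/4)"
      then have "norm (x - c) \<le> R/4" by (simp add: dist_norm norm_minus_commute)
      then have "norm x \<le> R" using nc(1) norm_triangle_sub[of x c] R1 by linarith
      then show "x \<in> B" using B_facts(4) by auto
    qed
    have "(\<integral>x. indicator (cball c (R/4)) x * (norm u * R / 4) \<partial>N) \<le> (\<integral>x. ?f x \<partial>N)"
    proof (rule integral_mono[OF integral_N_indicator(2)[OF K sub] int])
      fix x assume "x \<in> space N"
      show "indicator (cball c (R/4)) x * (norm u * R / 4) \<le> ?f x"
      proof (cases "x \<in> cball c (R/4)")
        case True
        then have "norm (c - x) \<le> R/4" by (simp add: dist_norm)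
        then have "u \<bullet> (c - x) \<le> norm u * (R/4)"
          by (intro order_trans[OF norm_cauchy_schwarz] mult_left_mono) auto
        then have "norm u * R / 4 \<le> u \<bullet> x" using nc(2) by (simp add: inner_diff_right mult.commute)
        then show ?thesis using True equal by (simp add: le_max_iff_disj)
      qed simp
    qed simp
    also have "(\<integral>x. indicator (cball c (R/4)) x * (norm u * R / 4) \<partial>N) = integral (cball c (R/4)) (\<lambda>_. norm u * R / 4)"
      by (rule integral_N_indicator(1)[OF K sub]) simp
    also have "\<dots> = measure lebesgue (cball c (R/4)) * (norm u * R / 4)"
      using lmeasure_integral[OF lmeasurable_compact[OF K(1)]] integral_mult_left[of "cball c (R/4)" "\<lambda>_. 1" "norm u * R / 4"] by simp
    finally have "measure lebesgue (cball c (R/4)) * (norm u * R / 4) \<le> (\<integral>x. ?f x \<partial>N)" .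
    moreover have "measure lebesgue (cball c (R/4)) * (norm u * R / 4) > 0"
      using content_cball_pos[of "R/4" c] R1 u by (simp add: measure_completion)
    ultimately show ?thesis using equal by linarith
  qed
  then show ?thesis by (simp add: \<Phi>_def \<theta>)
qed

lemma \<Phi>0_scale: "c \<ge> 0 \<Longrightarrow> \<Phi> (\<lambda>_. 0) (c *\<^sub>R \<theta>) = c * \<Phi> (\<lambda>_. 0) \<theta>"
proof -
  assume c: "c \<ge> 0"
  have "max 0 (c * a) = c * max 0 a" for a :: real using c by (simp add: max_mult_distrib_left)
  then have "(\<lambda>x. max 0 (c * fst \<theta> + c * (snd \<theta> \<bullet> x))) = (\<lambda>x. c * max 0 (fst \<theta> + snd \<theta> \<bullet> x))"
    by (simp add: distrib_left[symmetric])
  then show ?thesis by (simp add: \<Phi>_def right_diff_distrib)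
qed

text \<open>\<open>\<Phi> g\<close> is at least the recession function minus the constant
  \<open>G\<close>, and the recession function grows linearly, being homogeneous and positive on the
  unit sphere. So a minimum over a large ball is global.\<close>

lemma exists_minimum: "\<exists>\<theta>. \<forall>\<eta>. \<Phi> g \<theta> \<le> \<Phi> g \<eta>"
proof -
  let ?S = "sphere (0 :: real \<times> (real^2)) 1"
  have "?S \<noteq> {}" by (metis empty_iff mem_sphere_0 vector_choose_size zero_le_one)
  then obtain \<theta>1 where t1: "\<theta>1 \<in> ?S" "\<And>\<eta>. \<eta> \<in> ?S \<Longrightarrow> \<Phi> (\<lambda>_. 0) \<theta>1 \<le> \<Phi> (\<lambda>_. 0) \<eta>"
    using continuous_attains_inf[OF compact_sphere, of 0 1 "\<Phi> (\<lambda>_. 0)"] \<Phi>_continuous[of "\<lambda>_. 0"] by auto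
  define k where "k = \<Phi> (\<lambda>_. 0) \<theta>1"
  have k: "k > 0" unfolding k_def using t1(1) by (intro \<Phi>0_pos) auto
  have low0: "k * norm \<eta> \<le> \<Phi> (\<lambda>_. 0) \<eta>" for \<eta>
  proof (cases "\<eta> = 0")
    case True then show ?thesis by (simp add: \<Phi>_def)
  next
    case False
    have "k \<le> \<Phi> (\<lambda>_. 0) ((1 / norm \<eta>) *\<^sub>R \<eta>)" unfolding k_def using False by (intro t1(2)) simp
    also have "\<dots> = (1 / norm \<eta>) * \<Phi> (\<lambda>_. 0) \<eta>" by (rule \<Phi>0_scale) simp
    finally show ?thesis using False by (simp add: field_simps)
  qed
  define G where "G = (\<integral>x. g x \<partial>N)"
  have ig: "integrable N g" by (rule integrable_N_cont[OF continuous])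
  have G: "G \<ge> 0" unfolding G_def by (rule Bochner_Integration.integral_nonneg) (rule nonneg)
  have low: "k * norm \<eta> - G \<le> \<Phi> g \<eta>" for \<eta>
  proof -
    have i: "integrable N (\<lambda>x. max 0 (fst \<eta> + snd \<eta> \<bullet> x - h x))" if "continuous_on UNIV h" for h
      by (intro integrable_N_cont continuous_intros that)
    have "(\<integral>x. max 0 (fst \<eta> + snd \<eta> \<bullet> x - 0) \<partial>N) - G = (\<integral>x. max 0 (fst \<eta> + snd \<eta> \<bullet> x - 0) - g x \<partial>N)"
      unfolding G_def by (rule Bochner_Integration.integral_diff[symmetric]) (intro i continuous_intros, rule ig)
    also have "\<dots> \<le> (\<integral>x. max 0 (fst \<eta> + snd \<eta> \<bullet> x - g x) \<partial>N)"
    proof (rule integral_mono[OF Bochner_Integration.integrable_diff[OF i ig] i[OF continuous]])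
      show "max 0 (fst \<eta> + snd \<eta> \<bullet> x - 0) - g x \<le> max 0 (fst \<eta> + snd \<eta> \<bullet> x - g x)" for x
        using nonneg[of x] by linarith
    qed (rule continuous_on_const)
    finally show ?thesis using low0[of \<eta>] by (simp add: \<Phi>_def)
  qed
  define \<rho> where "\<rho> = G / k + 1"
  have \<rho>: "\<rho> > 0" using G k by (simp add: \<rho>_def add_nonneg_pos)
  have "cball 0 \<rho> \<noteq> ({} :: (real \<times> (real^2)) set)" using \<rho> by simp
  then obtain \<theta> where \<theta>: "\<theta> \<in> cball 0 \<rho>" "\<And>\<eta>. \<eta> \<in> cball 0 \<rho> \<Longrightarrow> \<Phi> g \<theta> \<le> \<Phi> g \<eta>"
    using continuous_attains_inf[OF compact_cball, of 0 \<rho> "\<Phi> g"] \<Phi>_continuous[OF continuous] by auto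
  have "max 0 (fst (0 :: real \<times> (real^2)) + snd (0 :: real \<times> (real^2)) \<bullet> x - g x) = 0" for x
    using nonneg[of x] by simp
  then have "\<Phi> g 0 = 0" by (simp only: \<Phi>_def) simp
  then have t0: "\<Phi> g \<theta> \<le> 0" using \<theta>(2)[of 0] \<rho> by simp
  have "\<Phi> g \<theta> \<le> \<Phi> g \<eta>" for \<eta>
  proof (cases "norm \<eta> \<le> \<rho>")
    case True then show ?thesis using \<theta>(2) by simp
  next
    case False
    then have "k * norm \<eta> \<ge> k * \<rho>" using k by simp
    also have "k * \<rho> = G + k" using k by (simp add: \<rho>_def field_simps)
    finally show ?thesis using low[of \<eta>] k t0 by linarith
  qed
  then show ?thesis by blast
qed

end

context truncated_gauge
begin

lemma p_ray: "s \<ge> 0 \<Longrightarrow> p \<theta> (s *\<^sub>R x) = (1 - s) * fst \<theta> + s * p \<theta> x"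
  by (simp add: p_def homog algebra_simps)

text \<open>The integral in \<open>\<Phi>\<close> is never negative, so one test multiplier of
  negative value suffices.\<close>

lemma minimum_pos:
  assumes min: "\<And>\<eta>. \<Phi> g \<theta> \<le> \<Phi> g \<eta>" shows "fst \<theta> > 0"
proof -
  define Q :: "(real^2) set" where "Q = cbox (- (\<chi> i. 1/4)) (\<chi> i. 1/4)"
  have Q: "compact Q" "convex Q" "measure lebesgue Q = 1/4" "cball 0 (1/4) \<subseteq> Q" "Q \<subseteq> cball 0 (1/2)"
    using cube_facts[of "1/4"] by (simp_all add: Q_def power2_eq_square)
  have "cball 0 (1/2) \<subseteq> cball (0::real^2) R" using R1 by (intro subset_cball) auto
  then have QB: "Q \<subseteq> B" using Q(5) B_facts(4) by (meson order_trans)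
  \<comment> \<open>Outside \<open>Q\<close> the norm exceeds 1/4 and hence
    \<open>g x > \<nu>\<close>. The positive part lives on a square of area 1/4, and the test value
    is at most \<open>\<nu> / 4 - \<nu>\<close>.\<close>
  define \<nu> where "\<nu> = m / 4"
  have \<nu>: "\<nu> > 0" using m_pos by (simp add: \<nu>_def)
  have "(\<integral>x. max 0 (fst (\<nu>, 0::real^2) + snd (\<nu>, 0::real^2) \<bullet> x - g x) \<partial>N) \<le> (\<integral>x. indicator Q x * \<nu> \<partial>N)"
  proof (rule integral_mono[OF integrable_N_cont integral_N_indicator(2)[OF Q(1,2) QB]])
    show "continuous_on UNIV (\<lambda>x. max 0 (fst (\<nu>, 0::real^2) + snd (\<nu>, 0::real^2) \<bullet> x - g x))"
      by (intro continuous_intros continuous)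
    show "max 0 (fst (\<nu>, 0::real^2) + snd (\<nu>, 0::real^2) \<bullet> x - g x) \<le> indicator Q x * \<nu>" for x
    proof (cases "x \<in> Q")
      case True then show ?thesis using nonneg[of x] \<nu> by simp
    next
      case False
      then have "norm x > 1/4" using Q(4) by (meson mem_cball_0 not_le subsetD)
      then have "m * norm x > m * (1/4)" using m_pos by (intro mult_strict_left_mono)
      then have "g x > \<nu>" using lower[of x] by (simp add: \<nu>_def)
      then show ?thesis using False by simp
    qed
  qed simp
  also have "\<dots> = integral Q (\<lambda>_. \<nu>)" by (rule integral_N_indicator(1)[OF Q(1,2) QB]) simp
  also have "\<dots> = \<nu> / 4"
    using lmeasure_integral[OF lmeasurable_compact[OF Q(1)]] Q(3) integral_mult_left[of Q "\<lambda>_. 1" \<nu>] by simp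
  finally have "\<Phi> g (\<nu>, 0) \<le> \<nu> / 4 - \<nu>" by (simp add: \<Phi>_def)
  then have "\<Phi> g \<theta> < 0" using min[of "(\<nu>, 0)"] \<nu> by linarith
  moreover have "(\<integral>x. max 0 (fst \<theta> + snd \<theta> \<bullet> x - g x) \<partial>N) \<ge> 0"
    by (rule Bochner_Integration.integral_nonneg) simp
  ultimately show ?thesis unfolding \<Phi>_def by linarith
qed

definition S :: "real \<times> (real^2) \<Rightarrow> (real^2) set" where "S \<theta> = {x. 0 \<le> p \<theta> x}"

lemma closed_S: "closed (S \<theta>)"
  unfolding S_def by (intro closed_Collect_le cont_p continuous_on_const)

lemma convex_S: "convex (S \<theta>)"
proof (rule convexI)
  fix x y u v assume *: "x \<in> S \<theta>" "y \<in> S \<theta>" "0 \<le> u" "0 \<le> v" "u + v = (1::real)"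
  have "g (u *\<^sub>R x + v *\<^sub>R y) \<le> u * g x + v * g y" using * by (intro convex_comb)
  moreover have "fst \<theta> = u * fst \<theta> + v * fst \<theta>" using *(5) by (metis distrib_right mult_1)
  ultimately have "u * p \<theta> x + v * p \<theta> y \<le> p \<theta> (u *\<^sub>R x + v *\<^sub>R y)"
    by (simp add: p_def inner_add_right algebra_simps)
  moreover have "0 \<le> u * p \<theta> x + v * p \<theta> y" using * by (simp add: S_def)
  ultimately show "u *\<^sub>R x + v *\<^sub>R y \<in> S \<theta>" by (simp add: S_def)
qed

lemma compact_SB: "compact (S \<theta> \<inter> B)" and convex_SB: "convex (S \<theta> \<inter> B)"
  by (rule closed_Int_compact[OF closed_S B_facts(1)], rule convex_Int[OF convex_S B_facts(2)])

text \<open>The zeros lie in the frontier of the convex set \<open>S \<theta>\<close>: from an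
  interior zero one could move a little outwards along the ray from 0, where \<open>p\<close> is
  negative by \<open>p_ray\<close>.\<close>

lemma AE_p_nonzero:
  assumes pos: "fst \<theta> > 0" shows "AE x in N. p \<theta> x \<noteq> 0"
proof -
  have "frontier (S \<theta>) \<in> null_sets lborel"
    using negligible_convex_frontier[OF convex_S] by (simp add: negligible_iff_null_sets null_sets_completion_iff)
  then have "AE x in lborel. x \<notin> frontier (S \<theta>)" by (rule AE_not_in)
  then have "AE x in lborel. p \<theta> x \<noteq> 0"
  proof eventually_elim
    case (elim x)
    show ?case
    proof
      assume p0: "p \<theta> x = 0"
      then have "x \<in> S \<theta>" by (simp add: S_def)
      then have "x \<in> interior (S \<theta>)" using elim closure_subset by (auto simp: frontier_def)
      then obtain e where e: "e > 0" "ball x e \<subseteq> S \<theta>" by (auto simp: mem_interior)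
      have "p \<theta> 0 = fst \<theta>" by (simp add: p_def)
      then have x0: "norm x > 0" using p0 pos by auto
      define \<delta> where "\<delta> = e / (2 * norm x)"
      have \<delta>: "\<delta> > 0" using e x0 by (simp add: \<delta>_def)
      have "dist x ((1 + \<delta>) *\<^sub>R x) = \<delta> * norm x" using \<delta> by (simp add: dist_norm algebra_simps)
      also have "\<dots> < e" using e x0 by (simp add: \<delta>_def)
      finally have "(1 + \<delta>) *\<^sub>R x \<in> S \<theta>" using e(2) by auto
      then have "0 \<le> (1 - (1 + \<delta>)) * fst \<theta>" using p_ray[of "1 + \<delta>" \<theta> x] \<delta> p0 by (simp add: S_def)
      then show False using \<delta> pos by (simp add: mult_le_0_iff)
    qed
  qed
  then show ?thesis by (rule AE_N)
qed

text \<open>One-sided derivative at the minimum in the direction \<open>(\<nu>, w)\<close>. The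
  difference quotient of the positive part is at most \<open>f n\<close>, whose indicator converges
  almost everywhere because \<open>p \<theta>\<close> vanishes only on a null set.\<close>

lemma stationary_ineq:
  assumes min: "\<And>\<eta>. \<Phi> g \<theta> \<le> \<Phi> g \<eta>"
  shows "\<nu> \<le> (\<integral>x. indicator (S \<theta>) x * (\<nu> + w \<bullet> x) \<partial>N)"
proof -
  define q where "q x = \<nu> + w \<bullet> x" for x
  have cq: "continuous_on UNIV q" unfolding q_def by (intro continuous_intros)
  define \<epsilon> where "\<epsilon> n = 1 / real (Suc n)" for n
  define f where "f n x = indicator {y. p \<theta> y + \<epsilon> n * q y > 0} x * q x" for n x
  have \<epsilon>: "\<epsilon> n > 0" for n by (simp add: \<epsilon>_def)
  have meas: "p \<theta> \<in> borel_measurable borel" "q \<in> borel_measurable borel"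
    by (rule borel_measurable_continuous_onI[OF cont_p], rule borel_measurable_continuous_onI[OF cq])
  have "bounded (q ` B)"
    by (rule compact_imp_bounded[OF compact_continuous_image[OF continuous_on_subset[OF cq subset_UNIV] B_facts(1)]])
  then obtain b where b: "\<And>x. x \<in> B \<Longrightarrow> \<bar>q x\<bar> \<le> b" by (auto simp: bounded_iff)
  have "(0::real^2) \<in> cball 0 R" using R1 by simp
  then have "0 \<in> B" using B_facts(4) by blast
  then have b0: "b \<ge> 0" using b[of 0] by linarith
  have fm: "f n \<in> borel_measurable borel" for n
    unfolding f_def using meas by measurable
  have fb: "\<bar>f n x\<bar> \<le> b" if "x \<in> B" for n x using b[OF that] b0 by (auto simp: f_def indicator_def)
  have ge: "\<nu> \<le> (\<integral>x. f n x \<partial>N)" for n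
  proof -
    define \<eta> where "\<eta> = (fst \<theta> + \<epsilon> n * \<nu>, snd \<theta> + \<epsilon> n *\<^sub>R w)"
    have p\<eta>: "fst \<eta> + snd \<eta> \<bullet> x - g x = p \<theta> x + \<epsilon> n * q x" for x
      by (simp add: \<eta>_def p_def q_def inner_add_left algebra_simps)
    have i1: "integrable N (\<lambda>x. max 0 (p \<theta> x + \<epsilon> n * q x))" "integrable N (\<lambda>x. max 0 (p \<theta> x))"
      by (intro integrable_N_cont continuous_intros cont_p cq)+
    have i2: "integrable N (\<lambda>x. \<epsilon> n * f n x)"
      using integrable_N[OF fm fb] by simp
    have "\<Phi> g \<theta> \<le> \<Phi> g \<eta>" by (rule min)
    then have "\<epsilon> n * \<nu> \<le> (\<integral>x. max 0 (p \<theta> x + \<epsilon> n * q x) \<partial>N) - (\<integral>x. max 0 (p \<theta> x) \<partial>N)"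
      unfolding \<Phi>_def p\<eta> by (simp add: \<eta>_def p_def)
    also have "\<dots> = (\<integral>x. max 0 (p \<theta> x + \<epsilon> n * q x) - max 0 (p \<theta> x) \<partial>N)"
      by (rule Bochner_Integration.integral_diff[OF i1, symmetric])
    also have "\<dots> \<le> (\<integral>x. \<epsilon> n * f n x \<partial>N)"
    proof (rule integral_mono[OF Bochner_Integration.integrable_diff[OF i1] i2])
      show "max 0 (p \<theta> x + \<epsilon> n * q x) - max 0 (p \<theta> x) \<le> \<epsilon> n * f n x" for x
        by (cases "p \<theta> x + \<epsilon> n * q x > 0") (simp_all add: f_def)
    qed
    also have "\<dots> = \<epsilon> n * (\<integral>x. f n x \<partial>N)" by simp
    finally show ?thesis using \<epsilon>[of n] by simp
  qed
  have pos: "fst \<theta> > 0" by (rule minimum_pos[OF min])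
  have "(\<lambda>n. \<integral>x. f n x \<partial>N) \<longlonglongrightarrow> (\<integral>x. indicator (S \<theta>) x * q x \<partial>N)"
  proof (rule integral_dominated_convergence[where w = "\<lambda>_. b"])
    show "(\<lambda>x. indicator (S \<theta>) x * q x) \<in> borel_measurable N"
      by (intro measurable_N borel_measurable_times borel_measurable_indicator meas borel_closed closed_S)
    show "f n \<in> borel_measurable N" for n by (rule measurable_N[OF fm])
    show "integrable N (\<lambda>_. b)" by (rule integrable_N_cont) simp
    show "AE x in N. norm (f n x) \<le> b" for n using fb by (intro AE_I2) (simp add: space_N)
    show "AE x in N. (\<lambda>n. f n x) \<longlonglongrightarrow> indicator (S \<theta>) x * q x"
      using AE_p_nonzero[OF pos]
    proof eventually_elim
      case (elim x)
      have "\<epsilon> \<longlonglongrightarrow> 0" using LIMSEQ_inverse_real_of_nat by (simp add: \<epsilon>_def[abs_def] inverse_eq_divide)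
      then have "(\<lambda>n. p \<theta> x + \<epsilon> n * q x) \<longlonglongrightarrow> p \<theta> x + 0 * q x" by (intro tendsto_intros)
      then have lim: "(\<lambda>n. p \<theta> x + \<epsilon> n * q x) \<longlonglongrightarrow> p \<theta> x" by simp
      have "\<forall>\<^sub>F n in sequentially. f n x = indicator (S \<theta>) x * q x"
      proof (cases "p \<theta> x > 0")
        case True
        from order_tendstoD(1)[OF lim True] show ?thesis by eventually_elim (use True in \<open>simp add: f_def S_def\<close>)
      next
        case False
        then have "p \<theta> x < 0" using elim by simp
        from order_tendstoD(2)[OF lim this] show ?thesis by eventually_elim (use False elim in \<open>simp add: f_def S_def\<close>)
      qed
      then show ?case by (rule tendsto_eventually)
    qed
  qed
  then show ?thesis using ge unfolding q_def by (intro LIMSEQ_le_const) auto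
qed

text \<open>Opposite directions turn the inequality into an equation. For \<open>w = 0\<close> it
  says area 1, for \<open>\<nu> = 0\<close> centroid 0.\<close>

lemma stationary:
  assumes min: "\<And>\<eta>. \<Phi> g \<theta> \<le> \<Phi> g \<eta>"
  shows "integral (S \<theta> \<inter> B) (\<lambda>x. \<nu> + w \<bullet> x) = \<nu>"
proof -
  have eq: "(\<integral>x. indicator (S \<theta>) x * (\<nu> + w \<bullet> x) \<partial>N) = integral (S \<theta> \<inter> B) (\<lambda>x. \<nu> + w \<bullet> x)" for \<nu> w
  proof -
    have "(\<integral>x. indicator (S \<theta>) x * (\<nu> + w \<bullet> x) \<partial>N) = (\<integral>x. indicator (S \<theta> \<inter> B) x * (\<nu> + w \<bullet> x) \<partial>N)"
      by (rule Bochner_Integration.integral_cong) (auto simp: space_N indicator_def)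
    also have "\<dots> = integral (S \<theta> \<inter> B) (\<lambda>x. \<nu> + w \<bullet> x)"
      by (rule integral_N_indicator(1)[OF compact_SB convex_SB]) (auto intro!: continuous_intros)
    finally show ?thesis .
  qed
  have "- \<nu> \<le> integral (S \<theta> \<inter> B) (\<lambda>x. - \<nu> + (- w) \<bullet> x)"
    using stationary_ineq[OF min, of "- \<nu>" "- w"] unfolding eq .
  also have "(\<lambda>x. - \<nu> + (- w) \<bullet> x) = (\<lambda>x. - (\<nu> + w \<bullet> x))" by auto
  also have "integral (S \<theta> \<inter> B) \<dots> = - integral (S \<theta> \<inter> B) (\<lambda>x. \<nu> + w \<bullet> x)"
    by (rule Henstock_Kurzweil_Integration.integral_neg)
  finally show ?thesis using stationary_ineq[OF min, of \<nu> w] unfolding eq by linarith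
qed

text \<open>\<open>S \<theta> \<inter> B\<close> maximises the integral of \<open>p \<theta>\<close>
  over subsets of \<open>B\<close>, and on sets of area 1 and centroid 0 this integral is
  \<open>fst \<theta>\<close> minus that of \<open>g\<close>. The resulting bound does not depend on
  \<open>R\<close>.\<close>

lemma optimal_integral_le:
  assumes min: "\<And>\<eta>. \<Phi> g \<theta> \<le> \<Phi> g \<eta>"
  defines "Q \<equiv> cbox (- (\<chi> i. 1/2)) (\<chi> i. 1/2) :: (real^2) set"
  shows "integral (S \<theta> \<inter> B) g \<le> integral Q g"
proof -
  have Q: "compact Q" "convex Q" "measure lebesgue Q = 1" "Q \<subseteq> cball 0 1" "\<And>w. integral Q (\<lambda>x. w \<bullet> x) = 0"
    using cube_facts[of "1/2"] by (simp_all add: Q_def)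
  have "cball 0 1 \<subseteq> cball (0::real^2) R" using R1 by (intro subset_cball) auto
  then have QB: "Q \<subseteq> B" using Q(4) B_facts(4) by (meson order_trans)
  have int: "integral K (p \<theta>) = integral K (\<lambda>x. fst \<theta> + snd \<theta> \<bullet> x) - integral K g" if "compact K" "convex K" for K
  proof -
    have "integrable lborel (\<lambda>x. indicator K x *\<^sub>R f x)" if "continuous_on UNIV f" for f :: "real^2 \<Rightarrow> real"
      using borel_integrable_compact[OF \<open>compact K\<close>] that continuous_on_subset by blast
    then have *: "f integrable_on K" if "continuous_on UNIV f" for f :: "real^2 \<Rightarrow> real"
      using set_borel_integral_eq_integral(1)[of K f] that by (simp add: set_integrable_def)
    show ?thesis unfolding p_def
      by (rule Henstock_Kurzweil_Integration.integral_diff) (intro * continuous_intros continuous)+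
  qed
  have "integral Q (p \<theta>) = (\<integral>x. indicator Q x * p \<theta> x \<partial>N)"
    by (rule integral_N_indicator(1)[OF Q(1,2) QB cont_p, symmetric])
  also have "\<dots> \<le> (\<integral>x. indicator (S \<theta> \<inter> B) x * p \<theta> x \<partial>N)"
    by (rule integral_mono[OF integral_N_indicator(2)[OF Q(1,2) QB cont_p] integral_N_indicator(2)[OF compact_SB convex_SB _ cont_p]])
      (auto simp: indicator_def S_def space_N)
  also have "\<dots> = integral (S \<theta> \<inter> B) (p \<theta>)"
    by (rule integral_N_indicator(1)[OF compact_SB convex_SB _ cont_p]) simp
  also have "\<dots> = fst \<theta> - integral (S \<theta> \<inter> B) g"
    unfolding int[OF compact_SB convex_SB] using stationary[OF min] by simp
  finally have "integral Q (p \<theta>) \<le> fst \<theta> - integral (S \<theta> \<inter> B) g" .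
  moreover have "integral Q (\<lambda>x. fst \<theta> + snd \<theta> \<bullet> x) = fst \<theta>"
  proof -
    have "integral Q (\<lambda>x. fst \<theta> + snd \<theta> \<bullet> x) = integral Q (\<lambda>x. fst \<theta>) + integral Q (\<lambda>x. snd \<theta> \<bullet> x)"
      by (rule Henstock_Kurzweil_Integration.integral_add)
        (auto simp: Q_def intro!: integrable_continuous continuous_intros)
    also have "\<dots> = fst \<theta>"
      using Q(5) lmeasure_integral[OF lmeasurable_compact[OF Q(1)]] Q(3) integral_mult_left[of Q "\<lambda>_. 1" "fst \<theta>"] by simp
    finally show ?thesis .
  qed
  ultimately show ?thesis unfolding int[OF Q(1,2)] by linarith
qed

end

section \<open>A size bound for the optimal set and removal of the truncation\<close>

lemma integrable_on_compact:
  fixes f :: "real^2 \<Rightarrow> real"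
  assumes "compact K" "continuous_on UNIV f" shows "f integrable_on K"
  using set_borel_integral_eq_integral(1)[of K f] borel_integrable_compact[OF assms(1) continuous_on_subset[OF assms(2)]]
  by (simp add: set_integrable_def)

lemma measure_mult_le_integral_norm:
  fixes T V :: "(real^2) set"
  assumes "compact T" "compact V" "V \<subseteq> T" "\<And>x. x \<in> V \<Longrightarrow> s \<le> norm x"
  shows "s * measure lebesgue V \<le> integral T norm"
proof -
  have i: "(norm :: real^2 \<Rightarrow> real) integrable_on K" if "compact K" for K
    using that by (rule integrable_on_compact) (intro continuous_intros)
  have "integral V (\<lambda>_. s * 1) \<le> integral V norm"
    by (rule integral_le[OF integrable_on_compact[OF assms(2) continuous_on_const] i[OF assms(2)]])
      (simp add: assms(4))
  moreover have "integral V norm \<le> integral T norm"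
    using assms i by (intro integral_subset_le) auto
  moreover have "integral V (\<lambda>_. s * 1) = s * measure lebesgue V"
    using lmeasure_integral[OF lmeasurable_compact[OF assms(2)]] integral_mult_right[of V s "\<lambda>_. 1"] by simp
  ultimately show ?thesis by linarith
qed

text \<open>Either half of \<open>T\<close> is far from \<open>0\<close>, or the other half, contracted towards the far point
  \<open>a\<close>, is.\<close>
lemma norm_le_integral_norm:
  fixes T :: "(real^2) set"
  assumes T: "compact T" "convex T" "measure lebesgue T = 1" and a: "a \<in> T"
  shows "norm a \<le> 32 * integral T norm"
proof -
  define U where "U = T \<inter> cball 0 (norm a / 2)"
  define W where "W = T - ball 0 (norm a / 2)"
  have c: "compact U" "compact W" using T(1) by (auto simp: U_def W_def compact_Int_closed compact_diff)
  have "measure lebesgue T \<le> measure lebesgue (U \<union> W)"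
    using c by (intro measure_mono_fmeasurable lmeasurable_compact) (auto simp: U_def W_def intro: T(1) compact_imp_closed lmeasurable_compact fmeasurableD)
  also have "\<dots> \<le> measure lebesgue U + measure lebesgue W"
    using c by (intro measure_Un_le) (auto intro: fmeasurableD lmeasurable_compact)
  finally have "measure lebesgue U \<ge> 1/2 \<or> measure lebesgue W \<ge> 1/2" using T(3) by linarith
  then show ?thesis
  proof
    assume U: "measure lebesgue U \<ge> 1/2"
    define V where "V = (\<lambda>x. (1/2) *\<^sub>R x + (1/2) *\<^sub>R a) ` U"
    have "V = (\<lambda>x. (1/2) *\<^sub>R x + (1/2) *\<^sub>R a) ` U" by (simp add: V_def)
    then have mV: "measure lebesgue V = (1/4) * measure lebesgue U"
      using measure_lebesgue_affine[of "1/2" "(1/2) *\<^sub>R a" U] by (simp add: add.commute power2_eq_square)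
    have cV: "compact V" unfolding V_def by (intro compact_continuous_image continuous_intros c)
    have "(norm a / 4) * measure lebesgue V \<le> integral T norm"
    proof (rule measure_mult_le_integral_norm[OF T(1) cV])
      show "V \<subseteq> T" unfolding V_def using T(2) a by (auto simp: U_def intro!: convexD)
      fix y assume "y \<in> V"
      then obtain x where x: "x \<in> U" "y = (1/2) *\<^sub>R x + (1/2) *\<^sub>R a" by (auto simp: V_def)
      have "norm ((1/2) *\<^sub>R a) \<le> norm y + norm ((1/2) *\<^sub>R x)"
        using norm_triangle_ineq4[of y "(1/2) *\<^sub>R x"] by (simp add: x(2))
      then show "norm a / 4 \<le> norm y" using x(1) by (simp add: U_def)
    qed
    \<comment> \<open>Origin of the constant 32: a factor 1/4 from the distance to 0, 1/4 from the
      contraction and 1/2 from the measure of \<open>U\<close>.\<close>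
    moreover have "(norm a / 4) * (1/8) \<le> (norm a / 4) * measure lebesgue V"
      using U mV by (intro mult_left_mono) auto
    ultimately show ?thesis by simp
  next
    assume W: "measure lebesgue W \<ge> 1/2"
    have "(norm a / 2) * measure lebesgue W \<le> integral T norm"
      by (rule measure_mult_le_integral_norm[OF T(1) c(2)]) (auto simp: W_def)
    moreover have "(norm a / 2) * (1/2) \<le> (norm a / 2) * measure lebesgue W"
      using W by (intro mult_left_mono) auto
    ultimately show ?thesis using norm_ge_zero[of a] by linarith
  qed
qed

text \<open>The box is chosen slightly larger than the a priori bound \<open>\<rho>\<close> on the
  optimal set. As \<open>S \<theta>\<close> is star-shaped about 0, it could leave the ball of
  radius \<open>\<rho>\<close> only through the shell between \<open>\<rho>\<close> and
  \<open>\<rho> + 1\<close>, which is inside the box and excluded by the bound. So the truncation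
  changes nothing.\<close>

theorem exists_centred_gauge:
  assumes "gauge g m M"
  obtains \<mu> u m' M' where "\<mu> > 0" "gauge (\<lambda>x. (g x - u \<bullet> x) / \<mu>) m' M'"
    "measure lebesgue {x. (g x - u \<bullet> x) / \<mu> \<le> 1} = 1"
    "\<And>w. integral {x. (g x - u \<bullet> x) / \<mu> \<le> 1} (\<lambda>x. w \<bullet> x) = 0"
proof -
  interpret g: gauge g m M by (rule assms)
  define G where "G = integral (cbox (- (\<chi> i. 1/2)) (\<chi> i. 1/2)) g"
  have G: "G \<ge> 0" unfolding G_def by (rule integral_nonneg[OF integrable_on_compact]) (auto simp: g.nonneg g.continuous)
  define \<rho> where "\<rho> = 32 * G / m"
  have \<rho>: "\<rho> \<ge> 0" using G g.m_pos by (simp add: \<rho>_def)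
  interpret truncated_gauge g m M "\<rho> + 1" by unfold_locales (use \<rho> in simp)
  obtain \<theta> where min: "\<And>\<eta>. \<Phi> g \<theta> \<le> \<Phi> g \<eta>" using exists_minimum by blast
  obtain \<mu> u where \<theta>: "\<theta> = (\<mu>, u)" by (cases \<theta>)
  have \<mu>: "\<mu> > 0" using minimum_pos[OF min] by (simp add: \<theta>)
  define T where "T = S \<theta> \<inter> B"
  have T: "compact T" "convex T" unfolding T_def by (rule compact_SB, rule convex_SB)
  have int1: "integral T (\<lambda>x. \<nu> + w \<bullet> x) = \<nu>" for \<nu> w unfolding T_def by (rule stationary[OF min])
  have mT: "measure lebesgue T = 1" using int1[of 1 0] lmeasure_integral[OF lmeasurable_compact[OF T(1)]] by simp
  have Tb: "norm a \<le> \<rho>" if "a \<in> T" for a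
  proof -
    have "m * integral T norm = integral T (\<lambda>x. m * norm x)" by simp
    also have "\<dots> \<le> integral T g"
      by (rule integral_le[OF integrable_on_compact integrable_on_compact]) (auto intro!: continuous_intros T(1) g.continuous g.lower)
    also have "\<dots> \<le> G" unfolding T_def G_def by (rule optimal_integral_le[OF min])
    finally have "integral T norm \<le> G / m" using g.m_pos by (simp add: field_simps)
    then show ?thesis using norm_le_integral_norm[OF T mT that] by (simp add: \<rho>_def)
  qed
  have Sb: "norm x \<le> \<rho>" if x: "x \<in> S \<theta>" for x
  proof (rule ccontr)
    assume n: "\<not> norm x \<le> \<rho>"
    define s where "s = min 1 ((\<rho> + 1) / norm x)"
    have x0: "norm x > 0" using n \<rho> by linarith
    have s: "0 \<le> s" "s \<le> 1" using \<rho> by (auto simp: s_def)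
    have ns: "norm (s *\<^sub>R x) = min (norm x) (\<rho> + 1)"
      using s x0 \<rho> by (auto simp: s_def min_def field_simps)
    have "0 \<le> p \<theta> (s *\<^sub>R x)" using p_ray[OF s(1), of \<theta> x] x s \<mu> by (simp add: S_def \<theta>)
    moreover have "s *\<^sub>R x \<in> cball 0 (\<rho> + 1)" using ns by simp
    then have "s *\<^sub>R x \<in> B" using B_facts(4) by blast
    ultimately have "s *\<^sub>R x \<in> T" by (simp add: T_def S_def)
    from Tb[OF this] show False using ns n by linarith
  qed
  have "S \<theta> \<subseteq> B" using Sb B_facts(4) by (force simp: subset_iff)
  then have TS: "T = S \<theta>" by (auto simp: T_def)
  have Seq: "{x. (g x - u \<bullet> x) / \<mu> \<le> 1} = T"
    unfolding TS S_def p_def \<theta> using \<mu> by (auto simp: field_simps)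
  have "gauge (\<lambda>x. (g x - u \<bullet> x) / \<mu>) (1 / (\<rho> + 1)) ((M + norm u) / \<mu>)"
  proof
    show "(g (x + y) - u \<bullet> (x + y)) / \<mu> \<le> (g x - u \<bullet> x) / \<mu> + (g y - u \<bullet> y) / \<mu>" for x y
      using g.subadd[of x y] \<mu> unfolding add_divide_distrib[symmetric] by (intro divide_right_mono) (auto simp: inner_add_right)
    show hom: "(g (c *\<^sub>R x) - u \<bullet> (c *\<^sub>R x)) / \<mu> = c * ((g x - u \<bullet> x) / \<mu>)" if "c \<ge> 0" for c x
      using that by (simp add: g.homog right_diff_distrib diff_divide_distrib)
    \<comment> \<open>A violating \<open>x\<close>, scaled to norm \<open>\<rho> + 1\<close>, would
      still have value at most 1 and so lie in \<open>T\<close>, against the bound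
      \<open>Tb\<close>.\<close>
    show "1 / (\<rho> + 1) * norm x \<le> (g x - u \<bullet> x) / \<mu>" for x
    proof (rule ccontr)
      assume n: "\<not> ?thesis"
      then have x0: "norm x > 0" using g.zero by fastforce
      define c where "c = (\<rho> + 1) / norm x"
      have c: "c > 0" using x0 \<rho> by (simp add: c_def)
      have "(g (c *\<^sub>R x) - u \<bullet> (c *\<^sub>R x)) / \<mu> = c * ((g x - u \<bullet> x) / \<mu>)" using c by (intro hom) simp
      also have "\<dots> \<le> c * (1 / (\<rho> + 1) * norm x)" using n c by (intro mult_left_mono) auto
      also have "\<dots> = 1" using x0 \<rho> by (simp add: c_def)
      finally have "c *\<^sub>R x \<in> T" using Seq by blast
      from Tb[OF this] show False using c x0 \<rho> by (simp add: c_def)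
    qed
    show "(g x - u \<bullet> x) / \<mu> \<le> (M + norm u) / \<mu> * norm x" for x
    proof -
      have "- (u \<bullet> x) \<le> norm u * norm x" using Cauchy_Schwarz_ineq2[of u x] by linarith
      then have "g x - u \<bullet> x \<le> (M + norm u) * norm x" using g.upper[of x] by (simp add: distrib_right)
      then show ?thesis using \<mu> by (simp add: divide_right_mono)
    qed
    show "1 / (\<rho> + 1) > 0" using \<rho> by simp
  qed
  then show ?thesis using that[of \<mu> u] \<mu> mT int1[of 0] unfolding Seq by simp
qed

section \<open>Fans of almost minimal total gauge\<close>

lemma pos_parallel_sym: "pos_parallel x y \<Longrightarrow> pos_parallel y x"
proof -
  assume "pos_parallel x y"
  then obtain c where "c > 0" "y = c *\<^sub>R x" by (auto simp: pos_parallel_def)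
  then show ?thesis unfolding pos_parallel_def by (intro exI[of _ "1/c"]) simp
qed

lemma finite_card_le_1: "(\<And>x y. x \<in> A \<Longrightarrow> y \<in> A \<Longrightarrow> x = y) \<Longrightarrow> finite A \<Longrightarrow> card A \<le> 1"
  using card_le_Suc0_iff_eq[of A] by simp

text \<open>Two vectors \<open>a\<close> and \<open>b = - s - a\<close> close the sum. The
  candidates for \<open>a\<close> form a horizontal row, and a ray from 0 meets such a row off the
  axis at most once. So the directions of \<open>E\<close> exclude at most \<open>2 * k\<close> of
  the \<open>2 * k + 2\<close> candidates, and equal directions of \<open>a\<close> and
  \<open>b\<close> exclude at most one more.\<close>

lemma close_fan:
  assumes fin: "finite E" and prim: "\<And>z. z \<in> E \<Longrightarrow> primitive z"
  defines "s \<equiv> \<Sum>E" and "k \<equiv> card E"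
  obtains a b where "insert a (insert b E) \<in> lattice_fans (k + 2)" "a \<notin> insert b E" "b \<notin> E"
    "norm a \<le> 2 * real k + 2" "norm b \<le> norm s + 2 * real k + 2"
proof -
  have ls: "lattice_point s" unfolding s_def
    using lattice_point_sum[of E "\<lambda>x. x"] prim primitive_lattice by simp
  \<comment> \<open>The height of the row is chosen such that \<open>b\<close> has a non-zero second
    coordinate as well.\<close>
  define g :: int where "g = (if s$2 = - 1 then - 1 else 1)"
  have g: "g \<noteq> 0" "real_of_int g \<noteq> - s$2" "\<bar>real_of_int g\<bar> = 1" by (auto simp: g_def)
  define a where "a i = lattice_vec (int i, g)" for i :: nat
  define b where "b i = - s - a i" for i
  have an: "a i $ 1 = real i" "a i $ 2 = of_int g" for i by (simp_all add: a_def)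
  have bn: "b i $ 1 = - s$1 - real i" "b i $ 2 = - s$2 - of_int g" for i by (simp_all add: b_def an)
  have b2: "- s$2 - of_int g \<noteq> 0" using g(2) by linarith
  define I where "I = {..2 * k + 1}"
  define Ae where "Ae e = {i\<in>I. pos_parallel e (a i)}" for e
  define Be where "Be e = {i\<in>I. pos_parallel e (b i)}" for e
  define C where "C = {i\<in>I. pos_parallel (a i) (b i)}"
  have finI: "finite I" by (simp add: I_def)
  have cA: "card (Ae e) \<le> 1" for e
  proof (rule finite_card_le_1)
    fix i j assume "i \<in> Ae e" "j \<in> Ae e"
    then obtain c d where cd: "a i = c *\<^sub>R e" "a j = d *\<^sub>R e" by (auto simp: Ae_def pos_parallel_def)
    then have "c * e$2 = of_int g" "d * e$2 = of_int g" "c * e$1 = real i" "d * e$1 = real j"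
      using an[of i] an[of j] by auto
    moreover from this g(1) have "e$2 \<noteq> 0" by auto
    ultimately have "c = d" by (metis mult_right_cancel)
    then show "i = j" using cd an(1)[of i] an(1)[of j] by simp
  qed (use finI in \<open>simp add: Ae_def\<close>)
  have cB: "card (Be e) \<le> 1" for e
  proof (rule finite_card_le_1)
    fix i j assume "i \<in> Be e" "j \<in> Be e"
    then obtain c d where cd: "b i = c *\<^sub>R e" "b j = d *\<^sub>R e" by (auto simp: Be_def pos_parallel_def)
    then have "c * e$2 = - s$2 - of_int g" "d * e$2 = - s$2 - of_int g"
      using bn[of i] bn[of j] by auto
    moreover from this b2 have "e$2 \<noteq> 0" by auto
    ultimately have "c = d" by (metis mult_right_cancel)
    then show "i = j" using cd bn(1)[of i] bn(1)[of j] by simp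
  qed (use finI in \<open>simp add: Be_def\<close>)
  have cC: "card C \<le> 1"
  proof (rule finite_card_le_1)
    fix i j assume "i \<in> C" "j \<in> C"
    then obtain c d where cd: "c > 0" "b i = c *\<^sub>R a i" "d > 0" "b j = d *\<^sub>R a j" by (auto simp: C_def pos_parallel_def)
    then have "- s$2 - of_int g = c * of_int g" "- s$2 - of_int g = d * of_int g"
      "- s$1 - real i = c * real i" "- s$1 - real j = d * real j"
      using bn[of i] bn[of j] an[of i] an[of j] by auto
    then have "c = d" "(1 + c) * real i = (1 + d) * real j" using g(1) by (auto simp: algebra_simps)
    then show "i = j" using cd(1) by simp
  qed (use finI in \<open>simp add: C_def\<close>)
  have "card (C \<union> ((\<Union>e\<in>E. Ae e) \<union> (\<Union>e\<in>E. Be e))) \<le> card C + (card (\<Union>e\<in>E. Ae e) + card (\<Union>e\<in>E. Be e))"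
    by (meson add_left_mono card_Un_le order_trans)
  also have "card (\<Union>e\<in>E. Ae e) \<le> k"
    using card_UN_le[OF fin, of Ae] sum_bounded_above[of E "\<lambda>e. card (Ae e)" 1] cA by (simp add: k_def)
  also have "card (\<Union>e\<in>E. Be e) \<le> k"
    using card_UN_le[OF fin, of Be] sum_bounded_above[of E "\<lambda>e. card (Be e)" 1] cB by (simp add: k_def)
  finally have "card (C \<union> ((\<Union>e\<in>E. Ae e) \<union> (\<Union>e\<in>E. Be e))) \<le> 2 * k + 1" using cC by simp
  also have "\<dots> < card I" by (simp add: I_def)
  finally have "\<not> I \<subseteq> C \<union> ((\<Union>e\<in>E. Ae e) \<union> (\<Union>e\<in>E. Be e))"
    using card_mono[of "C \<union> ((\<Union>e\<in>E. Ae e) \<union> (\<Union>e\<in>E. Be e))" I] finI fin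
    by (auto simp: C_def Ae_def Be_def)
  then obtain i where i: "i \<in> I" "\<not> pos_parallel (a i) (b i)"
    "\<And>e. e \<in> E \<Longrightarrow> \<not> pos_parallel e (a i)" "\<And>e. e \<in> E \<Longrightarrow> \<not> pos_parallel e (b i)"
    by (auto simp: C_def Ae_def Be_def)
  have refl: "pos_parallel x x" for x unfolding pos_parallel_def by (rule exI[of _ 1]) simp
  have nin: "a i \<notin> insert (b i) E" "b i \<notin> E" using i(2,3,4) refl by (metis insertE, metis)
  have la: "lattice_point (a i)" unfolding a_def lattice_point_iff by blast
  have lb: "lattice_point (b i)" unfolding b_def using lattice_point_diff[OF lattice_point_diff[of 0 s] la] ls
    by (simp add: lattice_point_def)
  have nz: "a i \<noteq> 0" "b i \<noteq> 0" using an(2)[of i] bn(2)[of i] g(1) b2 by (metis of_int_eq_0_iff zero_index)+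
  have "\<Sum>(insert (a i) (insert (b i) E)) = a i + (b i + s)" using nin fin by (simp add: s_def)
  then have sum0: "\<Sum>(insert (a i) (insert (b i) E)) = 0" by (simp add: b_def)
  have "insert (a i) (insert (b i) E) \<in> lattice_fans (k + 2)"
    unfolding lattice_fans_def
  proof (intro CollectI conjI ballI impI)
    show "card (insert (a i) (insert (b i) E)) = k + 2" using nin fin by (simp add: k_def)
    show "lattice_point z" "z \<noteq> 0" if "z \<in> insert (a i) (insert (b i) E)" for z
      using that la lb nz prim[of z] primitive_lattice[of z] primitive_nonzero[of z] by auto
    show "x = y" if "x \<in> insert (a i) (insert (b i) E)" "y \<in> insert (a i) (insert (b i) E)" "pos_parallel x y" for x y
      using that i(2,3,4) primitive_pos_parallel_eq prim pos_parallel_sym by (metis insertE)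
  qed (use fin sum0 in auto)
  moreover have na: "norm (a i) \<le> 2 * real k + 2"
    using norm_vec2_le[of "a i"] i(1) g(3) by (simp add: an I_def)
  moreover have "norm (b i) \<le> norm s + 2 * real k + 2"
    using norm_triangle_ineq4[of "- s" "a i"] na by (simp add: b_def)
  ultimately show ?thesis using that nin by blast
qed

section \<open>Asymptotics of the primitive vectors in dilates and the upper bound\<close>

locale centred_gauge = gauge +
  assumes area_body: "measure lebesgue body = 1"
    and centred: "integral body (\<lambda>x. w \<bullet> x) = 0"
begin

definition \<kappa> :: real where "\<kappa> = 6 / pi\<^sup>2"
definition J :: real where "J = integral body H"
definition Q :: "real \<Rightarrow> (real^2) set" where "Q t = {z. primitive z \<and> H z \<le> t}"
definition T :: "nat \<Rightarrow> real" where "T n = sqrt (real n / \<kappa>)"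

lemma \<kappa>_pos: "\<kappa> > 0" by (simp add: \<kappa>_def)

lemma \<kappa>_ge: "\<kappa> \<ge> 4/7"
proof -
  have "4 * pi\<^sup>2 \<le> 7 * 6" using zeta2_le by simp
  then show ?thesis unfolding \<kappa>_def by (subst le_divide_eq) simp
qed

lemma T_pos: "n > 0 \<Longrightarrow> T n > 0" using \<kappa>_pos by (simp add: T_def)

lemma T_square: "real n = \<kappa> * (T n)\<^sup>2" using \<kappa>_pos by (simp add: T_def)

lemma T_at_top: "filterlim T at_top sequentially"
proof -
  have "filterlim (\<lambda>n. (1/\<kappa>) * real n) at_top sequentially"
    by (rule filterlim_tendsto_pos_mult_at_top[OF tendsto_const _ filterlim_real_sequentially]) (simp add: \<kappa>_pos)
  then have "filterlim (\<lambda>n. sqrt ((1/\<kappa>) * real n)) at_top sequentially"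
    by (rule filterlim_compose[OF sqrt_at_top])
  then show ?thesis by (simp add: T_def[abs_def])
qed

lemma Q_eq: "t > 0 \<Longrightarrow> Q t = prims_in t body"
  by (simp add: Q_def prims_in_def scale_mem_body)

lemma finite_Q [simp]: "finite (Q t)"
proof -
  have "norm z \<le> t / m" if "H z \<le> t" for z using sublevel_subset[of t] that by auto
  then have "Q t \<subseteq> prims (t / m)" by (auto simp: Q_def prims_def)
  then show ?thesis by (rule finite_subset) simp
qed

lemma card_Q_tendsto: "((\<lambda>t. real (card (Q t)) / t\<^sup>2) \<longlongrightarrow> \<kappa>) at_top"
  using card_lattice_in_tendsto(2)[OF compact_body convex_body] area_body
  by (rule_tac Lim_transform_eventually[where f = "\<lambda>t. real (card (prims_in t body)) / t\<^sup>2"])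
    (auto simp: \<kappa>_def Q_eq intro: eventually_mono[OF eventually_gt_at_top[of 0]])

lemma sum_Q_tendsto: "((\<lambda>t. (\<Sum>z\<in>Q t. H z) / t^3) \<longlongrightarrow> \<kappa> * J) at_top"
proof (rule Lim_transform_eventually)
  show "((\<lambda>t. (\<Sum>z\<in>prims_in t body. H ((1/t) *\<^sub>R z)) / t\<^sup>2) \<longlongrightarrow> \<kappa> * J) at_top"
    using lattice_sum_convex(2)[OF compact_body convex_body continuous] by (simp add: \<kappa>_def J_def)
  show "\<forall>\<^sub>F t in at_top. (\<Sum>z\<in>prims_in t body. H ((1/t) *\<^sub>R z)) / t\<^sup>2 = (\<Sum>z\<in>Q t. H z) / t^3"
    using eventually_gt_at_top[of 0]
    by eventually_elim (simp add: Q_eq homog sum_divide_distrib[symmetric] power2_eq_square power3_eq_cube)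
qed

text \<open>Here the centroid enters: the limit is a multiple of the first moment of
  \<open>body\<close>, so closing up the sum costs o(t^3) only.\<close>

lemma vec_sum_Q_tendsto: "((\<lambda>t. norm (\<Sum>(Q t)) / t^3) \<longlongrightarrow> 0) at_top"
proof -
  have c: "((\<lambda>t. (w \<bullet> (\<Sum>(Q t))) / t^3) \<longlongrightarrow> 0) at_top" for w
  proof (rule Lim_transform_eventually)
    show "((\<lambda>t. (\<Sum>z\<in>prims_in t body. w \<bullet> ((1/t) *\<^sub>R z)) / t\<^sup>2) \<longlongrightarrow> 0) at_top"
      using lattice_sum_convex(2)[OF compact_body convex_body, of "\<lambda>x. w \<bullet> x"] centred[of w]
      by (simp add: continuous_intros)
    show "\<forall>\<^sub>F t in at_top. (\<Sum>z\<in>prims_in t body. w \<bullet> ((1/t) *\<^sub>R z)) / t\<^sup>2 = (w \<bullet> (\<Sum>(Q t))) / t^3"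
      using eventually_gt_at_top[of 0]
      by eventually_elim (simp add: Q_eq inner_sum_right sum_divide_distrib[symmetric] power2_eq_square power3_eq_cube)
  qed
  have e: "axis i 1 \<bullet> v = v $ i" for v :: "real^2" and i by (simp add: inner_axis' )
  have "((\<lambda>t. \<bar>\<Sum>(Q t) $ 1 / t^3\<bar> + \<bar>\<Sum>(Q t) $ 2 / t^3\<bar>) \<longlongrightarrow> \<bar>0\<bar> + \<bar>0\<bar>) at_top"
    using c[of "axis 1 1"] c[of "axis 2 1"] unfolding e by (intro tendsto_intros)
  then have "((\<lambda>t. \<bar>\<Sum>(Q t) $ 1 / t^3\<bar> + \<bar>\<Sum>(Q t) $ 2 / t^3\<bar>) \<longlongrightarrow> 0) at_top" by simp
  moreover have "\<forall>\<^sub>F t in at_top. norm (norm (\<Sum>(Q t)) / t^3) \<le> \<bar>\<Sum>(Q t) $ 1 / t^3\<bar> + \<bar>\<Sum>(Q t) $ 2 / t^3\<bar>"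
    using eventually_gt_at_top[of 0]
  proof eventually_elim
    case (elim t)
    then show ?case using norm_vec2_le[of "\<Sum>(Q t)"]
      by (simp add: abs_divide add_divide_distrib[symmetric] divide_right_mono)
  qed
  ultimately show ?thesis by (rule Lim_null_comparison[rotated])
qed

lemmas along_T = filterlim_compose[OF _ T_at_top]

lemma T_power_ratio: "(\<lambda>n. real n / T n^3) \<longlonglongrightarrow> 0"
proof (rule Lim_transform_eventually)
  show "(\<lambda>n. \<kappa> / T n) \<longlonglongrightarrow> 0" by (intro real_tendsto_divide_at_top[OF tendsto_const T_at_top])
  show "\<forall>\<^sub>F n in sequentially. \<kappa> / T n = real n / T n^3"
    using eventually_gt_at_top[of 0]
  proof eventually_elim
    case (elim n)
    then show ?case using T_pos[of n] by (subst T_square) (simp add: power2_eq_square power3_eq_cube)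
  qed
qed

text \<open>The 2 stands for the two closing vectors supplied by \<open>close_fan\<close>.\<close>

definition defect :: "nat \<Rightarrow> real" where
  "defect n = \<bar>real n - 2 - real (card (Q (T n)))\<bar>"

lemma defect_tendsto: "(\<lambda>n. defect n / (T n)\<^sup>2) \<longlonglongrightarrow> 0"
proof (rule Lim_transform_eventually)
  have "(\<lambda>n. 2 / (T n)\<^sup>2) \<longlonglongrightarrow> 0"
    by (intro real_tendsto_divide_at_top[OF tendsto_const] filterlim_pow_at_top T_at_top) simp
  then have "(\<lambda>n. \<bar>\<kappa> - 2 / (T n)\<^sup>2 - real (card (Q (T n))) / (T n)\<^sup>2\<bar>) \<longlonglongrightarrow> \<bar>\<kappa> - 0 - \<kappa>\<bar>"
    using along_T[OF card_Q_tendsto] by (intro tendsto_intros)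
  then show "(\<lambda>n. \<bar>\<kappa> - 2 / (T n)\<^sup>2 - real (card (Q (T n))) / (T n)\<^sup>2\<bar>) \<longlonglongrightarrow> 0" by simp
  show "\<forall>\<^sub>F n in sequentially. \<bar>\<kappa> - 2 / (T n)\<^sup>2 - real (card (Q (T n))) / (T n)\<^sup>2\<bar> = defect n / (T n)\<^sup>2"
    using eventually_gt_at_top[of 0]
  proof eventually_elim
    case (elim n)
    have "\<kappa> = real n / (T n)\<^sup>2" using T_pos[OF elim] by (simp add: T_square)
    then have "\<kappa> - 2 / (T n)\<^sup>2 - real (card (Q (T n))) / (T n)\<^sup>2 = (real n - 2 - real (card (Q (T n)))) / (T n)\<^sup>2"
      by (simp add: diff_divide_distrib)
    then show ?case by (simp add: defect_def abs_divide)
  qed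
qed

text \<open>Cost bound for the fan built from \<open>Q (T n)\<close>: the set itself,
  \<open>defect n\<close> vectors of gauge at most \<open>2 * T n\<close> that are added or removed,
  and the two closing vectors, estimated by their norms.\<close>

definition U :: "nat \<Rightarrow> real" where
  "U n = (\<Sum>z\<in>Q (T n). H z) + 2 * T n * defect n + M * (norm (\<Sum>(Q (T n))) + 2 * T n / m * defect n + 4 * real n + 4)"

lemma U_tendsto: "(\<lambda>n. U n / T n^3) \<longlonglongrightarrow> \<kappa> * J"
proof (rule Lim_transform_eventually)
  have "(\<lambda>n. 4 / T n^3) \<longlonglongrightarrow> 0"
    by (intro real_tendsto_divide_at_top[OF tendsto_const] filterlim_pow_at_top T_at_top) simp
  then have "(\<lambda>n. (\<Sum>z\<in>Q (T n). H z) / T n^3 + 2 * (defect n / (T n)\<^sup>2) + M * (norm (\<Sum>(Q (T n))) / T n^3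
      + 2 / m * (defect n / (T n)\<^sup>2) + 4 * (real n / T n^3) + 4 / T n^3)) \<longlonglongrightarrow>
      \<kappa> * J + 2 * 0 + M * (0 + 2 / m * 0 + 4 * 0 + 0)"
    by (intro tendsto_intros along_T[OF sum_Q_tendsto] along_T[OF vec_sum_Q_tendsto] defect_tendsto T_power_ratio)
  then show "(\<lambda>n. (\<Sum>z\<in>Q (T n). H z) / T n^3 + 2 * (defect n / (T n)\<^sup>2) + M * (norm (\<Sum>(Q (T n))) / T n^3
      + 2 / m * (defect n / (T n)\<^sup>2) + 4 * (real n / T n^3) + 4 / T n^3)) \<longlonglongrightarrow> \<kappa> * J" by simp
  show "\<forall>\<^sub>F n in sequentially. (\<Sum>z\<in>Q (T n). H z) / T n^3 + 2 * (defect n / (T n)\<^sup>2) + M * (norm (\<Sum>(Q (T n))) / T n^3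
      + 2 / m * (defect n / (T n)\<^sup>2) + 4 * (real n / T n^3) + 4 / T n^3) = U n / T n^3"
    using eventually_gt_at_top[of 0]
  proof eventually_elim
    case (elim n)
    have "defect n / (T n)\<^sup>2 = T n * defect n / T n^3" using T_pos[OF elim] by (simp add: power2_eq_square power3_eq_cube)
    then show ?case unfolding U_def by (simp add: add_divide_distrib distrib_left)
  qed
qed

lemma exists_cheap_fan:
  "\<forall>\<^sub>F n in sequentially. \<exists>F\<in>lattice_fans n. (\<Sum>z\<in>F. H z) \<le> U n"
proof -
  \<comment> \<open>Asymptotically \<open>Q (2 * T n)\<close> has \<open>4 * n\<close> elements, far
    more than needed to fill up \<open>Q (T n)\<close>; a quarter of the density already gives
    \<open>n\<close>.\<close>
  have "((\<lambda>t. real (card (Q (2 * t))) / (2 * t)\<^sup>2) \<longlongrightarrow> \<kappa>) at_top"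
    by (rule filterlim_compose[OF card_Q_tendsto])
      (intro filterlim_tendsto_pos_mult_at_top[OF tendsto_const] filterlim_ident, simp)
  then have "\<forall>\<^sub>F n in sequentially. \<kappa> / 4 < real (card (Q (2 * T n))) / (2 * T n)\<^sup>2"
    using \<kappa>_pos by (intro order_tendstoD(1)[OF along_T]) auto
  then show ?thesis using eventually_ge_at_top[of 3]
  proof eventually_elim
    case (elim n)
    let ?t = "T n"
    have t: "?t > 0" using T_pos elim by simp
    have big: "n - 2 \<le> card (Q (2 * ?t))"
    proof -
      have "\<kappa> * ?t\<^sup>2 < real (card (Q (2 * ?t)))" using elim(1) t by (simp add: field_simps power2_eq_square)
      then show ?thesis using T_square[of n] by linarith
    qed
    have sub: "Q ?t \<subseteq> Q (2 * ?t)" using t by (auto simp: Q_def)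
    have "\<exists>E. E \<subseteq> Q (2 * ?t) \<and> card E = n - 2 \<and> (E \<subseteq> Q ?t \<or> Q ?t \<subseteq> E)"
    proof (cases "n - 2 \<le> card (Q ?t)")
      case True
      then obtain E where "E \<subseteq> Q ?t" "card E = n - 2" using obtain_subset_with_card_n by metis
      then show ?thesis using sub by blast
    next
      case False
      have "n - 2 - card (Q ?t) \<le> card (Q (2 * ?t) - Q ?t)"
        using big False by (simp add: card_Diff_subset sub)
      then obtain E where E: "E \<subseteq> Q (2 * ?t) - Q ?t" "card E = n - 2 - card (Q ?t)"
        using obtain_subset_with_card_n by metis
      have "card (Q ?t \<union> E) = card (Q ?t) + card E"
        using E by (intro card_Un_disjoint finite_Q) (auto intro: finite_subset[OF _ finite_Q])
      then have "card (Q ?t \<union> E) = n - 2" using E False by simp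
      then show ?thesis using E sub by (intro exI[of _ "Q ?t \<union> E"]) blast
    qed
    then obtain E where E: "E \<subseteq> Q (2 * ?t)" "card E = n - 2" "E \<subseteq> Q ?t \<or> Q ?t \<subseteq> E" by blast
    have fin: "finite E" using E(1) finite_Q finite_subset by blast
    define \<Delta> where "\<Delta> = (if E \<subseteq> Q ?t then Q ?t - E else E - Q ?t)"
    have \<Delta>sub: "\<Delta> \<subseteq> Q (2 * ?t)" using E sub by (auto simp: \<Delta>_def)
    have card\<Delta>: "real (card \<Delta>) = defect n"
    proof (cases "E \<subseteq> Q ?t")
      case True
      then have "card E \<le> card (Q ?t)" by (intro card_mono) auto
      then show ?thesis using True elim(2) E(2) fin by (simp add: \<Delta>_def card_Diff_subset defect_def)
    next
      case False
      then have s: "Q ?t \<subseteq> E" using E(3) by simp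
      then have "card (Q ?t) \<le> card E" by (intro card_mono fin)
      then show ?thesis using False s elim(2) E(2) fin by (simp add: \<Delta>_def card_Diff_subset defect_def)
    qed
    have sum\<Delta>: "sum f E = sum f (Q ?t) + (if E \<subseteq> Q ?t then - sum f \<Delta> else sum f \<Delta>)" for f :: "real^2 \<Rightarrow> 'b::ab_group_add"
    proof (cases "E \<subseteq> Q ?t")
      case True then show ?thesis by (simp add: \<Delta>_def sum_diff)
    next
      case False
      then have "Q ?t \<subseteq> E" using E(3) by simp
      then show ?thesis using False fin by (simp add: \<Delta>_def sum_diff)
    qed
    have H\<Delta>: "(\<Sum>z\<in>\<Delta>. H z) \<le> 2 * ?t * defect n"
      using sum_bounded_above[of \<Delta> H "2 * ?t"] \<Delta>sub card\<Delta> by (auto simp: Q_def mult.commute)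
    have H\<Delta>0: "(\<Sum>z\<in>\<Delta>. H z) \<ge> 0" by (intro sum_nonneg nonneg)
    have "norm (\<Sum>\<Delta>) \<le> (\<Sum>z\<in>\<Delta>. norm z)" by (rule norm_sum)
    also have "\<dots> \<le> (\<Sum>z\<in>\<Delta>. 2 * ?t / m)"
      using \<Delta>sub sublevel_subset[of "2 * ?t"] by (intro sum_mono) (force simp: Q_def)
    finally have n\<Delta>: "norm (\<Sum>\<Delta>) \<le> 2 * ?t / m * defect n" by (simp add: card\<Delta> mult.commute)
    have HE: "(\<Sum>z\<in>E. H z) \<le> (\<Sum>z\<in>Q ?t. H z) + 2 * ?t * defect n"
      using sum\<Delta>[of H] H\<Delta> H\<Delta>0 by (auto split: if_splits)
    have nE: "norm (\<Sum>E) \<le> norm (\<Sum>(Q ?t)) + 2 * ?t / m * defect n"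
    proof -
      have "norm (\<Sum>E) \<le> norm (\<Sum>(Q ?t)) + norm (\<Sum>\<Delta>)"
        unfolding sum\<Delta>[of "\<lambda>x. x"] using norm_triangle_ineq norm_triangle_ineq4 by auto
      then show ?thesis using n\<Delta> by linarith
    qed
    have pE: "primitive z" if "z \<in> E" for z using E(1) that by (auto simp: Q_def)
    obtain a b where ab: "insert a (insert b E) \<in> lattice_fans (card E + 2)" "a \<notin> insert b E" "b \<notin> E"
      "norm a \<le> 2 * real (card E) + 2" "norm b \<le> norm (\<Sum>E) + 2 * real (card E) + 2"
      using close_fan[OF fin pE] by blast
    have cn: "card E + 2 = n" "real (card E) \<le> real n" using E(2) elim(2) by auto
    have "(\<Sum>z\<in>insert a (insert b E). H z) = H a + H b + (\<Sum>z\<in>E. H z)" using ab fin by simp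
    also have "H a + H b \<le> M * (norm a + norm b)" using upper[of a] upper[of b] by (simp add: distrib_left)
    also have "M * (norm a + norm b) \<le> M * (norm (\<Sum>(Q ?t)) + 2 * ?t / m * defect n + 4 * real n + 4)"
      using M_pos ab(4,5) nE cn(2) by (intro mult_left_mono) auto
    finally have "(\<Sum>z\<in>insert a (insert b E). H z) \<le> U n" using HE by (simp add: U_def)
    then show ?case using ab(1) cn(1) by auto
  qed
qed

text \<open>With the charge \<open>t\<close> per element, \<open>Q t\<close> is optimal among sets
  of primitive vectors, since it collects exactly those with \<open>H z - t \<le> 0\<close>. The
  excess is the loss of a fan against it.\<close>

definition excess :: "real \<Rightarrow> (real^2) set \<Rightarrow> real" where
  "excess t E = (\<Sum>z\<in>E. H z - t) - (\<Sum>z\<in>Q t. H z - t)"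

lemma inj_prim_part:
  assumes "E \<in> lattice_fans n" shows "inj_on prim_part E"
  using assms prim_part_pos_parallel by (fastforce simp: lattice_fans_def intro!: inj_onI)

lemma H_prim_part: "lattice_point z \<Longrightarrow> z \<noteq> 0 \<Longrightarrow> H z = real (vgcd z) * H (prim_part z)"
  by (metis homog of_nat_0_le_iff prim_part_eq)

lemma H_prim_part_le:
  assumes "lattice_point z" "z \<noteq> 0" shows "H (prim_part z) \<le> H z"
proof -
  have "1 * H (prim_part z) \<le> real (vgcd z) * H (prim_part z)"
    using vgcd_pos[OF assms] nonneg by (intro mult_right_mono) auto
  then show ?thesis using H_prim_part[OF assms] by simp
qed

lemma H_prim_part_nonprim:
  assumes "lattice_point z" "z \<noteq> 0" "prim_part z \<noteq> z" shows "2 * H (prim_part z) \<le> H z"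
proof -
  have "vgcd z \<noteq> 1" using assms(3) by (auto simp: prim_part_def)
  then have "real (vgcd z) \<ge> 2" using vgcd_pos[OF assms(1,2)] by linarith
  then have "2 * H (prim_part z) \<le> real (vgcd z) * H (prim_part z)" using nonneg by (intro mult_right_mono) auto
  then show ?thesis using H_prim_part[OF assms(1,2)] by simp
qed

text \<open>A fan loses in three ways: by edges that are proper multiples, by primitive directions
  outside \<open>Q t\<close>, and by members of \<open>Q t\<close> in whose direction there is no
  edge.\<close>

lemma excess_eq:
  assumes E: "E \<in> lattice_fans n"
  defines "E' \<equiv> prim_part ` E"
  shows "excess t E = (\<Sum>z\<in>E. H z - H (prim_part z)) + (\<Sum>q\<in>E' - Q t. H q - t) + (\<Sum>q\<in>Q t - E'. t - H q)"
proof -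
  have fin: "finite E" "finite E'" using E by (auto simp: lattice_fans_def E'_def)
  have 1: "(\<Sum>z\<in>E. H (prim_part z) - t) = (\<Sum>q\<in>E'. H q - t)"
    unfolding E'_def by (simp add: sum.reindex inj_prim_part[OF E])
  have 2: "(\<Sum>q\<in>E'. H q - t) = (\<Sum>q\<in>E' - Q t. H q - t) + (\<Sum>q\<in>E' \<inter> Q t. H q - t)"
    using sum.Int_Diff[OF fin(2), of "\<lambda>q. H q - t" "Q t"] by simp
  have 3: "(\<Sum>q\<in>Q t. H q - t) = (\<Sum>q\<in>Q t - E'. H q - t) + (\<Sum>q\<in>E' \<inter> Q t. H q - t)"
    using sum.Int_Diff[OF finite_Q, of "\<lambda>q. H q - t" t E'] by (simp add: Int_commute)
  have "(\<Sum>z\<in>E. H z - t) = (\<Sum>z\<in>E. H z - H (prim_part z)) + (\<Sum>z\<in>E. H (prim_part z) - t)"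
    by (simp add: sum.distrib[symmetric])
  moreover have "(\<Sum>q\<in>Q t - E'. t - H q) = - (\<Sum>q\<in>Q t - E'. H q - t)" by (simp add: sum_negf[symmetric])
  ultimately show ?thesis unfolding excess_def 1 2 3 by simp
qed

text \<open>Each loss is nonnegative, hence bounded by the total. The last estimate restricts a
  single edge only to o(t^3) when the excess is o(t^3), but this makes the number of swaps needed
  against it o(t^2), which is affordable.\<close>

lemma
  assumes E: "E \<in> lattice_fans n"
  defines "E' \<equiv> prim_part ` E"
  shows excess_nonneg: "0 \<le> excess t E"
    and excess_ge_nonprim: "(\<Sum>z\<in>E. H z - H (prim_part z)) \<le> excess t E"
    and excess_ge_outer: "(\<Sum>q\<in>E' - Q t. H q - t) \<le> excess t E"
    and excess_ge_inner: "(\<Sum>q\<in>Q t - E'. t - H q) \<le> excess t E"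
    and excess_ge_single: "z \<in> E \<Longrightarrow> H z - t \<le> excess t E"
proof -
  have lat: "lattice_point z" "z \<noteq> 0" if "z \<in> E" for z using E that by (auto simp: lattice_fans_def)
  have fin: "finite E" using E by (auto simp: lattice_fans_def)
  have prim: "primitive q" if "q \<in> E'" for q using that primitive_prim_part lat by (auto simp: E'_def)
  have a: "0 \<le> (\<Sum>z\<in>E. H z - H (prim_part z))" using H_prim_part_le lat by (intro sum_nonneg) auto
  have b: "0 \<le> (\<Sum>q\<in>E' - Q t. H q - t)" using prim by (intro sum_nonneg) (auto simp: Q_def)
  have c: "0 \<le> (\<Sum>q\<in>Q t - E'. t - H q)" by (intro sum_nonneg) (auto simp: Q_def)
  note eq = excess_eq[OF E, of t, folded E'_def]
  show "0 \<le> excess t E" "(\<Sum>z\<in>E. H z - H (prim_part z)) \<le> excess t E"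
    "(\<Sum>q\<in>E' - Q t. H q - t) \<le> excess t E" "(\<Sum>q\<in>Q t - E'. t - H q) \<le> excess t E"
    using a b c eq by linarith+
  show "H z - t \<le> excess t E" if z: "z \<in> E"
  proof -
    have 1: "H z - H (prim_part z) \<le> (\<Sum>z\<in>E. H z - H (prim_part z))"
      using z fin H_prim_part_le lat by (intro member_le_sum) auto
    show ?thesis
    proof (cases "prim_part z \<in> Q t")
      case True then show ?thesis using 1 b c eq by (auto simp: Q_def)
    next
      case False
      then have "H (prim_part z) - t \<le> (\<Sum>q\<in>E' - Q t. H q - t)"
        using z fin prim by (intro member_le_sum) (auto simp: E'_def Q_def)
      then show ?thesis using 1 c eq by linarith
    qed
  qed
qed

end

section \<open>Exchanges between primitive vectors\<close>

lemma primitive_prim_part_eq: "primitive z \<Longrightarrow> prim_part z = z"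
  by (simp add: primitive_def prim_part_def)

lemma pos_parallel_trans: "pos_parallel x y \<Longrightarrow> pos_parallel y z \<Longrightarrow> pos_parallel x z"
  unfolding pos_parallel_def by (metis mult_pos_pos scaleR_scaleR)

lemma pos_parallel_imp_prim_part_eq:
  assumes "lattice_point x" "x \<noteq> 0" "lattice_point y" "y \<noteq> 0" "pos_parallel x y"
  shows "prim_part x = prim_part y"
proof -
  have *: "pos_parallel (prim_part z) z" if "lattice_point z" "z \<noteq> 0" for z
    unfolding pos_parallel_def using prim_part_eq[OF that] vgcd_pos[OF that]
    by (intro exI[of _ "real (vgcd z)"]) auto
  have "pos_parallel (prim_part x) (prim_part y)"
    using pos_parallel_trans[OF pos_parallel_trans[OF *[OF assms(1,2)] assms(5)] pos_parallel_sym[OF *[OF assms(3,4)]]] .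
  then show ?thesis using primitive_pos_parallel_eq primitive_prim_part assms(1-4) by blast
qed

text \<open>Differences of the rounded points \<open>(i / k) r\<close> telescope to
  \<open>r\<close>, and each coordinate of a difference is off by at most 1.\<close>

lemma lattice_split:
  assumes r: "lattice_point r" and k: "k \<ge> 1"
  obtains rs where "length rs = k" "sum_list rs = r"
    "\<And>x. x \<in> set rs \<Longrightarrow> lattice_point x \<and> norm (x - (1 / real k) *\<^sub>R r) \<le> 2"
proof -
  define f :: "nat \<Rightarrow> real^2" where "f i = floor_vec ((real i / real k) *\<^sub>R r)" for i
  define rs where "rs = map (\<lambda>i. f (Suc i) - f i) [0..<k]"
  have "sum_list rs = (\<Sum>i<k. f (Suc i) - f i)"
    unfolding rs_def by (simp add: interv_sum_list_conv_sum_set_nat atLeast0LessThan)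
  also have "\<dots> = f k - f 0" by (rule sum_lessThan_telescope)
  also have "\<dots> = r"
  proof -
    have "floor_vec r = r" using r by (auto simp: floor_vec_def lattice_point_def vec_eq_iff elim!: Ints_cases)
    then show ?thesis using k by (simp add: f_def) (simp add: floor_vec_def vec_eq_iff)
  qed
  finally have "sum_list rs = r" .
  moreover have "lattice_point x \<and> norm (x - (1 / real k) *\<^sub>R r) \<le> 2" if xs: "x \<in> set rs" for x
  proof -
    obtain i where x: "x = f (Suc i) - f i" using xs by (auto simp: rs_def)
    have c: "\<bar>(x - (1 / real k) *\<^sub>R r) $ j\<bar> \<le> 1" for j
    proof -
      have "(x - (1 / real k) *\<^sub>R r) $ j = of_int \<lfloor>real i / real k * r $ j + r $ j / real k\<rfloor>
          - of_int \<lfloor>real i / real k * r $ j\<rfloor> - r $ j / real k"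
        by (simp add: x f_def floor_vec_def add_divide_distrib distrib_right algebra_simps)
      then show ?thesis by linarith
    qed
    have "norm (x - (1 / real k) *\<^sub>R r) \<le> 2"
      using norm_vec2_le[of "x - (1 / real k) *\<^sub>R r"] c[of 1] c[of 2] by linarith
    then show ?thesis using x lattice_point_diff lattice_point_floor_vec by (simp add: f_def)
  qed
  ultimately show ?thesis using that[of rs] by (simp add: rs_def)
qed

section \<open>Swaps across the boundary of the dilated body\<close>

context centred_gauge
begin

text \<open>Intermediate value theorem on the curve of level \<open>1 - \<epsilon>/2\<close>,
  parametrised radially by the unit circle. In the direction of \<open>w\<close> the value
  \<open>H (x + w)\<close> is at least the target, in the direction of \<open>- w\<close> at
  most.\<close>

lemma chord:
  assumes \<epsilon>: "0 < \<epsilon>" "\<epsilon> \<le> 1/2" and w: "H w \<ge> \<epsilon>" "H (- w) \<le> 1/2"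
  obtains x where "H x = 1 - \<epsilon>/2" "H (x + w) = 1 + \<epsilon>/2"
proof -
  have w0: "w \<noteq> 0" using w(1) \<epsilon> by auto
  have Hpos: "H v > 0" if "v \<noteq> 0" for v
    using lower[of v] m_pos that by (smt (verit) mult_pos_pos zero_less_norm_iff)
  define g where "g v = (1 - \<epsilon>/2) / H v" for v
  define c where "c v = H (g v *\<^sub>R v + w)" for v
  have gpos: "g v \<ge> 0" for v using nonneg \<epsilon> by (simp add: g_def)
  have onH: "H (g v *\<^sub>R v) = 1 - \<epsilon>/2" if "v \<noteq> 0" for v
    using homog[OF gpos] Hpos[OF that] by (simp add: g_def)
  have "continuous_on (sphere 0 1) (\<lambda>v. g v *\<^sub>R v + w)"
    unfolding g_def
  proof (intro continuous_intros continuous ballI)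
    show "H v \<noteq> 0" if "v \<in> sphere 0 1" for v using Hpos[of v] that by fastforce
  qed
  then have cont: "continuous_on (sphere 0 1) c"
    unfolding c_def by (rule continuous_on_compose2[OF continuous[of UNIV]]) auto
  have conn: "connected (c ` sphere 0 1)"
    by (intro connected_continuous_image[OF cont] connected_sphere) simp
  have inv: "c (s *\<^sub>R v) = c v" if "s > 0" for s v
    using that homog[of s v] by (simp add: c_def g_def)
  define v0 where "v0 = (1 / norm w) *\<^sub>R w"
  have v0: "v0 \<in> sphere 0 1" "- v0 \<in> sphere 0 1" using w0 by (auto simp: v0_def)
  have "c v0 = c w" unfolding v0_def using w0 by (intro inv) simp
  also have "\<dots> = H ((g w + 1) *\<^sub>R w)" by (simp add: c_def scaleR_add_left)
  also have "\<dots> = 1 - \<epsilon>/2 + H w" using homog[of "g w + 1" w] gpos[of w] onH[OF w0] homog[OF gpos, of w w]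
    by (simp add: distrib_right)
  finally have 1: "c v0 \<ge> 1 + \<epsilon>/2" using w(1) by linarith
  have "c (- v0) = c (- w)" using inv[of "1 / norm w" "- w"] w0 by (simp add: v0_def)
  also have "\<dots> = H ((g (- w) - 1) *\<^sub>R (- w))" by (simp add: c_def scaleR_diff_left)
  also have "\<dots> = (g (- w) - 1) * H (- w)"
  proof (rule homog)
    have "H (- w) \<le> 1 - \<epsilon>/2" using w(2) \<epsilon>(2) by linarith
    then show "0 \<le> g (- w) - 1" using Hpos[of "- w"] w0 by (simp add: g_def)
  qed
  also have "\<dots> = 1 - \<epsilon>/2 - H (- w)"
  proof -
    have "g (- w) * H (- w) = 1 - \<epsilon>/2" using Hpos[of "- w"] w0 by (simp add: g_def)
    then show ?thesis by (simp add: left_diff_distrib)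
  qed
  finally have 2: "c (- v0) \<le> 1 + \<epsilon>/2" using nonneg[of "- w"] \<epsilon> by linarith
  have "1 + \<epsilon>/2 \<in> c ` sphere 0 1"
    using connectedD_interval[OF conn imageI[OF v0(2)] imageI[OF v0(1)] 2 1] .
  then obtain v where v: "v \<in> sphere 0 1" "c v = 1 + \<epsilon>/2" by auto
  then have "v \<noteq> 0" by auto
  then show ?thesis using that[of "g v *\<^sub>R v"] onH v(2) by (simp add: c_def)
qed

text \<open>Replacing \<open>a\<close> by \<open>b\<close> costs at most
  \<open>2 * \<epsilon> * t\<close>. The gap of \<open>\<epsilon>/4\<close> keeps both vectors off
  the boundary level, where stability does not decide whether a vector is an edge.\<close>

definition swap_pair :: "real \<Rightarrow> real \<Rightarrow> real^2 \<Rightarrow> real^2 \<Rightarrow> bool" where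
  "swap_pair \<epsilon> t a b \<longleftrightarrow> primitive a \<and> primitive b \<and> (1 - \<epsilon>) * t \<le> H a \<and> H a \<le> (1 - \<epsilon>/4) * t \<and>
     (1 + \<epsilon>/4) * t \<le> H b \<and> H b \<le> (1 + \<epsilon>) * t"

text \<open>The displacement \<open>r\<close> is prescribed, and the swap avoids any forbidden set
  of size up to \<open>\<eta> * t\<^sup>2\<close>. This makes many successive swaps
  possible.\<close>

definition swappable :: "real \<Rightarrow> (real^2) set \<Rightarrow> real \<Rightarrow> real \<Rightarrow> bool" where
  "swappable \<epsilon> W \<eta> t \<longleftrightarrow> (\<forall>r F. lattice_point r \<longrightarrow> (1/t) *\<^sub>R r \<in> W \<longrightarrow> finite F \<longrightarrow> real (card F) \<le> \<eta> * t\<^sup>2 \<longrightarrow>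
     (\<exists>a. a \<notin> F \<and> a + r \<notin> F \<and> swap_pair \<epsilon> t a (a + r)))"

text \<open>Pigeonhole: the primitive vectors have density \<open>6 / pi\<^sup>2 > 1/2\<close>, so two balls displaced by
  (nearly) \<open>r\<close> contain many pairs \<open>a\<close>, \<open>a + r\<close> that are both primitive.\<close>
lemma locally_swappable:
  assumes \<epsilon>: "0 < \<epsilon>" "\<epsilon> \<le> 1/2" and w: "H w \<ge> \<epsilon>" "H (- w) \<le> 1/2"
  shows "\<exists>\<delta>>0. \<exists>\<eta>>0. \<forall>\<^sub>F t in at_top. swappable \<epsilon> (ball w \<delta>) \<eta> t"
proof -
  obtain x where x: "H x = 1 - \<epsilon>/2" "H (x + w) = 1 + \<epsilon>/2" using chord[OF assms] by blast
  \<comment> \<open>\<open>H\<close> varies by at most \<open>\<epsilon>/4\<close> within distance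
    \<open>\<rho>\<close>, which keeps the levels given by \<open>chord\<close> within those of
    \<open>swap_pair\<close>.\<close>
  define \<rho> where "\<rho> = \<epsilon> / (4 * M)"
  have \<rho>: "\<rho> > 0" "M * \<rho> = \<epsilon>/4" using \<epsilon> M_pos by (auto simp: \<rho>_def)
  \<comment> \<open>The smaller radius of \<open>K1\<close> absorbs the deviation of
    \<open>r / t\<close> from \<open>w\<close>, which is at most \<open>\<rho>/10\<close>.\<close>
  define K1 K2 where "K1 = cball x (9/10 * \<rho>)" and "K2 = cball (x + w) \<rho>"
  have K: "compact K1" "convex K1" "compact K2" "convex K2" "bounded K1" "bounded K2"
    by (auto simp: K1_def K2_def)
  define A where "A = measure lebesgue K2"
  have A: "A > 0" using content_cball_pos[OF \<rho>(1), of "x + w"] by (simp add: A_def K2_def measure_completion)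
  have A1: "measure lebesgue K1 = 81/100 * A"
  proof -
    have "K1 = (\<lambda>y. (9/10) *\<^sub>R y + (x - (9/10) *\<^sub>R (x + w))) ` K2"
    proof (intro subset_antisym subsetI)
      fix y assume y: "y \<in> K1"
      define z where "z = (10/9) *\<^sub>R (y - x) + (x + w)"
      have "dist (x + w) z = 10/9 * norm (y - x)" by (simp add: z_def dist_norm)
      then have "z \<in> K2" using y by (simp add: K1_def K2_def dist_norm norm_minus_commute)
      moreover have "y = (9/10) *\<^sub>R z + (x - (9/10) *\<^sub>R (x + w))" by (simp add: z_def scaleR_add_right scaleR_diff_right)
      ultimately show "y \<in> (\<lambda>y. (9/10) *\<^sub>R y + (x - (9/10) *\<^sub>R (x + w))) ` K2" by blast
    next
      fix y assume "y \<in> (\<lambda>y. (9/10) *\<^sub>R y + (x - (9/10) *\<^sub>R (x + w))) ` K2"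
      then obtain z where z: "z \<in> K2" "y = (9/10) *\<^sub>R z + (x - (9/10) *\<^sub>R (x + w))" by blast
      have "x - y = (9/10) *\<^sub>R ((x + w) - z)" by (simp add: z(2) algebra_simps)
      then have "dist x y = 9/10 * dist (x + w) z" by (simp add: dist_norm)
      then show "y \<in> K1" using z(1) by (simp add: K1_def K2_def)
    qed
    then show ?thesis
      using measure_lebesgue_affine[of "9/10" "x - (9/10) *\<^sub>R (x + w)" K2]
      by (simp add: A_def add.commute power2_eq_square)
  qed
  have near: "norm (u - v) \<le> \<rho> \<Longrightarrow> \<bar>H u - H v\<bar> \<le> \<epsilon>/4" for u v
    using lipschitz[of u v] mult_left_mono[of "norm (u - v)" \<rho> M] M_pos \<rho>(2) by linarith
  have lims: "((\<lambda>t. real (card (prims_in t K1)) / t\<^sup>2) \<longlongrightarrow> \<kappa> * (81/100 * A)) at_top"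
    "((\<lambda>t. real (card (prims_in t K2)) / t\<^sup>2) \<longlongrightarrow> \<kappa> * A) at_top"
    "((\<lambda>t. real (card (lattice_in t K2)) / t\<^sup>2) \<longlongrightarrow> A) at_top"
    using card_lattice_in_tendsto(2)[OF K(1,2)] card_lattice_in_tendsto[OF K(3,4)] A1
    by (simp_all add: \<kappa>_def A_def)
  have "((\<lambda>t. real (card (prims_in t K1)) / t\<^sup>2 + real (card (prims_in t K2)) / t\<^sup>2 - real (card (lattice_in t K2)) / t\<^sup>2)
      \<longlongrightarrow> \<kappa> * (81/100 * A) + \<kappa> * A - A) at_top"
    by (intro tendsto_intros lims)
  moreover have "A / 50 < \<kappa> * (81/100 * A) + \<kappa> * A - A"
  proof -
    have "4/7 * (181/100 * A) \<le> \<kappa> * (181/100 * A)" using \<kappa>_ge A by (intro mult_right_mono) auto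
    then show ?thesis using A by (simp add: algebra_simps)
  qed
  ultimately have ev: "\<forall>\<^sub>F t in at_top. A / 50 < real (card (prims_in t K1)) / t\<^sup>2 + real (card (prims_in t K2)) / t\<^sup>2 - real (card (lattice_in t K2)) / t\<^sup>2"
    by (rule order_tendstoD(1))
  have "\<forall>\<^sub>F t in at_top. swappable \<epsilon> (ball w (\<rho>/10)) (A / 100) t"
    using ev eventually_gt_at_top[of 0]
  proof eventually_elim
    case (elim t)
    show ?case unfolding swappable_def
    proof (intro allI impI)
      fix r :: "real^2" and F :: "(real^2) set" assume r: "lattice_point r" "(1/t) *\<^sub>R r \<in> ball w (\<rho>/10)" and F: "finite F" "real (card F) \<le> A / 100 * t\<^sup>2"
      define P1 P2 \<Lambda> where "P1 = prims_in t K1" and "P2 = prims_in t K2" and "\<Lambda> = lattice_in t K2"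
      have fin: "finite P1" "finite P2" "finite \<Lambda>"
        using K(5,6) elim finite_prims_in finite_lattice_in by (auto simp: P1_def P2_def \<Lambda>_def)
      define V where "V = (\<lambda>a. a + r) ` P1"
      have V: "finite V" "card V = card P1" using fin(1) by (auto simp: V_def card_image)
      have VL: "V \<subseteq> \<Lambda>"
      proof
        fix b assume "b \<in> V"
        then obtain a where a: "a \<in> P1" "b = a + r" by (auto simp: V_def)
        then have a': "lattice_point a" "norm ((1/t) *\<^sub>R a - x) \<le> 9/10 * \<rho>"
          by (auto simp: P1_def prims_in_def K1_def dist_norm norm_minus_commute primitive_def)
        have "(1/t) *\<^sub>R b - (x + w) = ((1/t) *\<^sub>R a - x) + ((1/t) *\<^sub>R r - w)" by (simp add: a(2) algebra_simps)
        then have "norm ((1/t) *\<^sub>R b - (x + w)) \<le> norm ((1/t) *\<^sub>R a - x) + norm ((1/t) *\<^sub>R r - w)"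
          by (metis norm_triangle_ineq)
        also have "norm ((1/t) *\<^sub>R r - w) \<le> \<rho>/10" using r(2) by (simp add: dist_norm norm_minus_commute)
        finally have "norm ((1/t) *\<^sub>R b - (x + w)) \<le> \<rho>" using a'(2) by linarith
        then show "b \<in> \<Lambda>" using a'(1) r(1) a(2)
          by (auto simp: \<Lambda>_def lattice_in_def K2_def dist_norm norm_minus_commute lattice_point_add)
      qed
      have PL: "P2 \<subseteq> \<Lambda>" unfolding P2_def \<Lambda>_def by (rule prims_in_subset)
      have "card V + card P2 = card (V \<union> P2) + card (V \<inter> P2)" by (rule card_Un_Int[OF V(1) fin(2)])
      also have "card (V \<union> P2) \<le> card \<Lambda>" using VL PL fin(3) by (intro card_mono) auto
      finally have c1: "real (card P1) + real (card P2) - real (card \<Lambda>) \<le> real (card (V \<inter> P2))" using V(2) by simp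
      have "A / 50 < (real (card P1) + real (card P2) - real (card \<Lambda>)) / t\<^sup>2"
        using elim(1) by (simp add: P1_def P2_def \<Lambda>_def add_divide_distrib diff_divide_distrib)
      then have c2: "A / 50 * t\<^sup>2 < real (card (V \<inter> P2))" using elim(2) c1 by (simp add: field_simps)
      \<comment> \<open>A forbidden vector rules out two values of \<open>b\<close>, once as
        \<open>b\<close> and once as \<open>a\<close>; hence the passage from \<open>A / 50\<close>
        to \<open>A / 100\<close>.\<close>
      have "\<not> V \<inter> P2 \<subseteq> F \<union> (\<lambda>a. a + r) ` F"
      proof
        assume "V \<inter> P2 \<subseteq> F \<union> (\<lambda>a. a + r) ` F"
        then have "card (V \<inter> P2) \<le> card (F \<union> (\<lambda>a. a + r) ` F)" using F(1) by (intro card_mono) auto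
        also have "\<dots> \<le> card F + card ((\<lambda>a. a + r) ` F)" by (rule card_Un_le)
        also have "\<dots> \<le> card F + card F" using card_image_le[OF F(1)] by simp
        finally have "real (card (V \<inter> P2)) \<le> 2 * real (card F)" by linarith
        then show False using c2 F(2) by (simp add: field_simps)
      qed
      then obtain b where b: "b \<in> V" "b \<in> P2" "b \<notin> F" "b \<notin> (\<lambda>a. a + r) ` F" by blast
      then obtain a where a: "a \<in> P1" "b = a + r" by (auto simp: V_def)
      have "a \<notin> F" using b(4) a(2) by blast
      have na: "norm ((1/t) *\<^sub>R a - x) \<le> \<rho>" using a(1) \<rho>(1) by (simp add: P1_def prims_in_def K1_def dist_norm norm_minus_commute)
      have nb: "norm ((1/t) *\<^sub>R b - (x + w)) \<le> \<rho>" using b(2) by (simp add: P2_def prims_in_def K2_def dist_norm norm_minus_commute)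
      have Ha: "H a = t * H ((1/t) *\<^sub>R a)" "H b = t * H ((1/t) *\<^sub>R b)" using elim(2) by (simp_all add: homog)
      have "1 - \<epsilon> \<le> H ((1/t) *\<^sub>R a)" "H ((1/t) *\<^sub>R a) \<le> 1 - \<epsilon>/4" using near[OF na] x(1) by linarith+
      moreover have "1 + \<epsilon>/4 \<le> H ((1/t) *\<^sub>R b)" "H ((1/t) *\<^sub>R b) \<le> 1 + \<epsilon>" using near[OF nb] x(2) \<epsilon>(1) by linarith+
      ultimately have "swap_pair \<epsilon> t a b"
        unfolding swap_pair_def Ha using elim(2) a(1) b(2)
        by (auto simp: P1_def P2_def prims_in_def mult.commute intro!: mult_left_mono)
      then show "\<exists>a. a \<notin> F \<and> a + r \<notin> F \<and> swap_pair \<epsilon> t a (a + r)" using \<open>a \<notin> F\<close> b(3) a(2) by blast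
    qed
  qed
  then show ?thesis using \<rho>(1) A by (intro exI[of _ "\<rho>/10"] conjI exI[of _ "A/100"]) auto
qed

text \<open>A finite subcover of the compact set \<open>W\<close>, with the smallest of the finitely
  many constants.\<close>

lemma uniformly_swappable:
  assumes \<epsilon>: "0 < \<epsilon>" "\<epsilon> \<le> 1/2" and W: "compact W" "\<And>w. w \<in> W \<Longrightarrow> H w \<ge> \<epsilon> \<and> H (- w) \<le> 1/2"
  shows "\<exists>\<eta>>0. \<forall>\<^sub>F t in at_top. swappable \<epsilon> W \<eta> t"
proof -
  have "\<forall>w\<in>W. \<exists>\<delta>>0. \<exists>\<eta>>0. \<forall>\<^sub>F t in at_top. swappable \<epsilon> (ball w \<delta>) \<eta> t"
    using locally_swappable[OF \<epsilon>] W(2) by blast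
  then obtain \<delta> \<eta> where de: "\<And>w. w \<in> W \<Longrightarrow> \<delta> w > 0 \<and> \<eta> w > 0 \<and> (\<forall>\<^sub>F t in at_top. swappable \<epsilon> (ball w (\<delta> w)) (\<eta> w) t)"
    by metis
  obtain D where D: "D \<subseteq> W" "finite D" "W \<subseteq> (\<Union>w\<in>D. ball w (\<delta> w))"
    using compactE_image[OF W(1), of W "\<lambda>w. ball w (\<delta> w)"] de by (metis (no_types, lifting) UN_I centre_in_ball open_ball subsetI)
  define h where "h = Min (insert 1 (\<eta> ` D))"
  have h: "h > 0" "\<And>w. w \<in> D \<Longrightarrow> h \<le> \<eta> w" using D(1,2) de by (auto simp: h_def)
  have "\<forall>\<^sub>F t in at_top. \<forall>w\<in>D. swappable \<epsilon> (ball w (\<delta> w)) (\<eta> w) t"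
    using D(1,2) de by (intro eventually_ball_finite) auto
  then have "\<forall>\<^sub>F t in at_top. swappable \<epsilon> W h t"
  proof eventually_elim
    case (elim t)
    show ?case unfolding swappable_def
    proof (intro allI impI)
      fix r :: "real^2" and F :: "(real^2) set" assume *: "lattice_point r" "(1/t) *\<^sub>R r \<in> W" "finite F" "real (card F) \<le> h * t\<^sup>2"
      then obtain w where w: "w \<in> D" "(1/t) *\<^sub>R r \<in> ball w (\<delta> w)" using D(3) by blast
      have "h * t\<^sup>2 \<le> \<eta> w * t\<^sup>2" using h(2)[OF w(1)] by (intro mult_right_mono) auto
      then have "real (card F) \<le> \<eta> w * t\<^sup>2" using *(4) by linarith
      then show "\<exists>a. a \<notin> F \<and> a + r \<notin> F \<and> swap_pair \<epsilon> t a (a + r)"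
        using elim w *(1,3) unfolding swappable_def by blast
    qed
  qed
  then show ?thesis using h(1) by blast
qed

text \<open>Each swap uses up two vectors, which join the forbidden set for the next one; the size
  hypothesis reserves room for them.\<close>

lemma swap_list:
  assumes sw: "swappable \<epsilon> W \<eta> t" and F: "finite F"
  shows "(\<forall>r\<in>set rs. lattice_point r \<and> (1/t) *\<^sub>R r \<in> W) \<Longrightarrow> real (card F) + 2 * real (length rs) \<le> \<eta> * t\<^sup>2 \<Longrightarrow>
    \<exists>A B. finite A \<and> finite B \<and> card A = length rs \<and> card B = length rs \<and> A \<inter> F = {} \<and> B \<inter> F = {} \<and>
      \<Sum>B = \<Sum>A + sum_list rs \<and> (\<forall>a\<in>A. \<exists>b. swap_pair \<epsilon> t a b) \<and> (\<forall>b\<in>B. \<exists>a. swap_pair \<epsilon> t a b)"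
proof (induction rs)
  case Nil then show ?case by (intro exI[of _ "{}"]) simp
next
  case (Cons r rs)
  then obtain A B where AB: "finite A" "finite B" "card A = length rs" "card B = length rs" "A \<inter> F = {}" "B \<inter> F = {}"
      "\<Sum>B = \<Sum>A + sum_list rs" "\<forall>a\<in>A. \<exists>b. swap_pair \<epsilon> t a b" "\<forall>b\<in>B. \<exists>a. swap_pair \<epsilon> t a b"
    by (auto simp: algebra_simps)
  have "card (F \<union> (A \<union> B)) \<le> card F + (card A + card B)"
    by (meson add_left_mono card_Un_le order_trans)
  then have "real (card (F \<union> (A \<union> B))) \<le> \<eta> * t\<^sup>2" using Cons.prems(2) AB(3,4) by simp
  then obtain a where a: "a \<notin> F \<union> (A \<union> B)" "a + r \<notin> F \<union> (A \<union> B)" "swap_pair \<epsilon> t a (a + r)"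
    using sw F AB(1,2) Cons.prems(1) unfolding swappable_def by (metis finite_UnI list.set_intros(1))
  show ?case
    by (rule exI[of _ "insert a A"], rule exI[of _ "insert (a + r) B"]) (use AB a in auto)
qed

end

section \<open>Minimal fans\<close>

lemma norm_lattice_vec_axis: "norm (lattice_vec (i, 0)) = \<bar>real_of_int i\<bar>"
proof -
  have "(norm (lattice_vec (i, 0)))\<^sup>2 = (real_of_int i)\<^sup>2"
    unfolding power2_norm_eq_inner inner_vec2 by (simp add: power2_eq_square)
  then show ?thesis by (metis abs_norm_cancel power2_eq_iff abs_minus_cancel)
qed

locale minimal_fans = centred_gauge +
  fixes E :: "nat \<Rightarrow> (real^2) set"
  assumes fan: "n \<ge> 3 \<Longrightarrow> E n \<in> lattice_fans n"
    and minimal: "n \<ge> 3 \<Longrightarrow> F \<in> lattice_fans n \<Longrightarrow> (\<Sum>z\<in>E n. H z) \<le> (\<Sum>z\<in>F. H z)"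
begin

definition X :: "nat \<Rightarrow> real" where "X n = excess (T n) (E n)"

lemma X_eq:
  assumes "n \<ge> 3"
  shows "X n = (\<Sum>z\<in>E n. H z) - \<kappa> * T n^3 - (\<Sum>z\<in>Q (T n). H z) + T n * real (card (Q (T n)))"
proof -
  have "card (E n) = n" using fan[OF assms] by (simp add: lattice_fans_def)
  then have "(\<Sum>z\<in>E n. H z - T n) = (\<Sum>z\<in>E n. H z) - real n * T n" by (simp add: sum_subtractf)
  moreover have "real n * T n = \<kappa> * T n^3" by (subst T_square) (simp add: power2_eq_square power3_eq_cube)
  ultimately show ?thesis by (simp add: X_def excess_def sum_subtractf)
qed

text \<open>Bounded below by 0 and above through the cheap fan; in the upper bound the main terms
  cancel.\<close>

lemma X_tendsto: "(\<lambda>n. X n / T n^3) \<longlonglongrightarrow> 0"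
proof (rule tendsto_sandwich[OF _ _ tendsto_const])
  show "\<forall>\<^sub>F n in sequentially. 0 \<le> X n / T n^3"
    using eventually_ge_at_top[of 3]
  proof eventually_elim
    case (elim n)
    then show ?case using excess_nonneg[OF fan[OF elim]] T_pos[of n] by (simp add: X_def)
  qed
  let ?u = "\<lambda>n. U n / T n^3 - \<kappa> - (\<Sum>z\<in>Q (T n). H z) / T n^3 + real (card (Q (T n))) / (T n)\<^sup>2"
  have "?u \<longlonglongrightarrow> \<kappa> * J - \<kappa> - \<kappa> * J + \<kappa>"
    by (intro tendsto_intros U_tendsto along_T[OF sum_Q_tendsto] along_T[OF card_Q_tendsto])
  then show "?u \<longlonglongrightarrow> 0" by simp
  show "\<forall>\<^sub>F n in sequentially. X n / T n^3 \<le> ?u n"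
    using exists_cheap_fan eventually_ge_at_top[of 3]
  proof eventually_elim
    case (elim n)
    then have "(\<Sum>z\<in>E n. H z) \<le> U n" using minimal[OF elim(2)] by (meson order_trans)
    then have "X n \<le> U n - \<kappa> * T n^3 - (\<Sum>z\<in>Q (T n). H z) + T n * real (card (Q (T n)))"
      using X_eq[OF elim(2)] by simp
    then have "X n / T n^3 \<le> (U n - \<kappa> * T n^3 - (\<Sum>z\<in>Q (T n). H z) + T n * real (card (Q (T n)))) / T n^3"
      using T_pos[of n] elim(2) by (intro divide_right_mono) auto
    also have "\<dots> = ?u n" using T_pos[of n] elim(2)
      by (simp add: add_divide_distrib diff_divide_distrib power2_eq_square power3_eq_cube)
    finally show ?case .
  qed
qed

lemma X_le: "\<eta> > 0 \<Longrightarrow> \<forall>\<^sub>F n in sequentially. X n \<le> \<eta> * T n^3"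
proof -
  assume "\<eta> > 0"
  then have "\<forall>\<^sub>F n in sequentially. X n / T n^3 < \<eta>" by (rule order_tendstoD(2)[OF X_tendsto])
  then show ?thesis using eventually_gt_at_top[of 0]
  proof eventually_elim
    case (elim n)
    then show ?case using T_pos[of n] by (simp add: field_simps)
  qed
qed

lemma total_tendsto: "(\<lambda>n. (\<Sum>z\<in>E n. H z) / T n^3) \<longlonglongrightarrow> \<kappa> * J"
proof (rule Lim_transform_eventually)
  have "(\<lambda>n. X n / T n^3 + \<kappa> + (\<Sum>z\<in>Q (T n). H z) / T n^3 - real (card (Q (T n))) / (T n)\<^sup>2) \<longlonglongrightarrow> 0 + \<kappa> + \<kappa> * J - \<kappa>"
    by (intro tendsto_intros X_tendsto along_T[OF sum_Q_tendsto] along_T[OF card_Q_tendsto])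
  then show "(\<lambda>n. X n / T n^3 + \<kappa> + (\<Sum>z\<in>Q (T n). H z) / T n^3 - real (card (Q (T n))) / (T n)\<^sup>2) \<longlonglongrightarrow> \<kappa> * J" by simp
  show "\<forall>\<^sub>F n in sequentially. X n / T n^3 + \<kappa> + (\<Sum>z\<in>Q (T n). H z) / T n^3 - real (card (Q (T n))) / (T n)\<^sup>2
      = (\<Sum>z\<in>E n. H z) / T n^3"
    using eventually_ge_at_top[of 3]
  proof eventually_elim
    case (elim n)
    then show ?case using T_pos[of n] unfolding X_eq[OF elim]
      by (simp add: add_divide_distrib diff_divide_distrib power2_eq_square power3_eq_cube)
  qed
qed

text \<open>Both ends are cut off: near the boundary the absence of a vector costs almost nothing,
  and near 0 so does its replacement by a proper multiple.\<close>

definition inner_missing :: "real \<Rightarrow> nat \<Rightarrow> (real^2) set" where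
  "inner_missing \<delta> n = {q. primitive q \<and> \<delta> * T n \<le> H q \<and> H q \<le> (1 - \<delta>) * T n \<and> q \<notin> E n}"

text \<open>Directions rather than edges: a primitive vector may be inserted only if no edge has its
  direction.\<close>

definition outer :: "real \<Rightarrow> nat \<Rightarrow> (real^2) set" where
  "outer \<delta> n = {q \<in> prim_part ` E n. (1 + \<delta>) * T n \<le> H q}"

lemma finite_inner_missing [simp]: "finite (inner_missing \<delta> n)"
  by (rule finite_subset[OF _ finite_Q[of "(1 - \<delta>) * T n"]]) (auto simp: inner_missing_def Q_def)

lemma finite_E: "n \<ge> 3 \<Longrightarrow> finite (E n)"
  using fan by (auto simp: lattice_fans_def)

lemma lattice_E: "n \<ge> 3 \<Longrightarrow> z \<in> E n \<Longrightarrow> lattice_point z" "n \<ge> 3 \<Longrightarrow> z \<in> E n \<Longrightarrow> z \<noteq> 0"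
  using fan by (auto simp: lattice_fans_def)

lemma card_mult_le_sum:
  fixes f :: "'b \<Rightarrow> real"
  assumes "finite S" "A \<subseteq> S" "\<And>x. x \<in> S \<Longrightarrow> 0 \<le> f x" "\<And>x. x \<in> A \<Longrightarrow> c \<le> f x"
  shows "c * real (card A) \<le> sum f S"
proof -
  have "c * real (card A) \<le> sum f A" using sum_bounded_below[of A c f] assms(4) by (simp add: mult.commute)
  also have "\<dots> \<le> sum f S" using assms by (intro sum_mono2) auto
  finally show ?thesis .
qed

text \<open>A missing vector either has no edge in its direction (\<open>A\<close>) or is
  represented by a proper multiple (\<open>Z\<close>). Each alternative costs at least
  \<open>\<delta> * T n\<close> of excess.\<close>

lemma inner_missing_small:
  assumes \<delta>: "0 < \<delta>" and \<eta>: "\<eta> > 0"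
  shows "\<forall>\<^sub>F n in sequentially. real (card (inner_missing \<delta> n)) \<le> \<eta> * (T n)\<^sup>2"
proof -
  have "0 < \<eta> * \<delta> / 2" using \<delta> \<eta> by simp
  from X_le[OF this] eventually_ge_at_top[of 3] show ?thesis
  proof eventually_elim
  case (elim n)
  let ?t = "T n"
  have t: "?t > 0" using T_pos elim by simp
  define A where "A = {q \<in> Q ?t - prim_part ` E n. H q \<le> (1 - \<delta>) * ?t}"
  define Z where "Z = {z \<in> E n. prim_part z \<noteq> z \<and> \<delta> * ?t \<le> H (prim_part z)}"
  have finZ: "finite Z" using finite_E elim by (simp add: Z_def)
  have "inner_missing \<delta> n \<subseteq> A \<union> prim_part ` Z"
  proof
    fix q assume q: "q \<in> inner_missing \<delta> n"
    have "(1 - \<delta>) * ?t \<le> ?t" using \<delta> t by (simp add: mult_le_cancel_right1)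
    then have "q \<in> Q ?t" using q by (auto simp: inner_missing_def Q_def)
    then show "q \<in> A \<union> prim_part ` Z" using q by (auto simp: inner_missing_def A_def Z_def)
  qed
  moreover have "finite (A \<union> prim_part ` Z)" using finZ by (simp add: A_def)
  ultimately have "card (inner_missing \<delta> n) \<le> card (A \<union> prim_part ` Z)" by (rule card_mono[rotated])
  also have "\<dots> \<le> card A + card Z" using card_Un_le[of A "prim_part ` Z"] card_image_le[OF finZ, of prim_part] by linarith
  finally have c: "real (card (inner_missing \<delta> n)) \<le> real (card A) + real (card Z)" by linarith
  have "(\<delta> * ?t) * real (card A) \<le> (\<Sum>q\<in>Q ?t - prim_part ` E n. ?t - H q)"
    by (rule card_mult_le_sum[OF finite_Diff[OF finite_Q]]) (auto simp: A_def Q_def algebra_simps)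
  also have "\<dots> \<le> X n" unfolding X_def by (rule excess_ge_inner[OF fan[OF elim(2)]])
  finally have 1: "(\<delta> * ?t) * real (card A) \<le> X n" .
  have "(\<delta> * ?t) * real (card Z) \<le> (\<Sum>z\<in>E n. H z - H (prim_part z))"
  proof (rule card_mult_le_sum)
    show "0 \<le> H z - H (prim_part z)" if "z \<in> E n" for z
      using H_prim_part_le lattice_E[OF elim(2) that] by simp
    show "\<delta> * ?t \<le> H z - H (prim_part z)" if "z \<in> Z" for z
      using H_prim_part_nonprim[of z] lattice_E[OF elim(2), of z] that by (auto simp: Z_def)
  qed (use finite_E[OF elim(2)] in \<open>auto simp: Z_def\<close>)
  also have "\<dots> \<le> X n" unfolding X_def by (rule excess_ge_nonprim[OF fan[OF elim(2)]])
  finally have 2: "(\<delta> * ?t) * real (card Z) \<le> X n" .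
  have "(\<delta> * ?t) * (real (card A) + real (card Z)) \<le> \<eta> * \<delta> * ?t^3"
    using 1 2 elim(1) by (simp add: distrib_left)
  also have "\<dots> = (\<delta> * ?t) * (\<eta> * ?t\<^sup>2)" by (simp add: power2_eq_square power3_eq_cube)
  finally have "real (card A) + real (card Z) \<le> \<eta> * ?t\<^sup>2" using t \<delta> by simp
  then show ?case using c by linarith
  qed
qed

lemma outer_small:
  assumes \<delta>: "0 < \<delta>" and \<eta>: "\<eta> > 0"
  shows "\<forall>\<^sub>F n in sequentially. real (card (outer \<delta> n)) \<le> \<eta> * (T n)\<^sup>2"
proof -
  have "0 < \<eta> * \<delta>" using \<delta> \<eta> by simp
  from X_le[OF this] eventually_ge_at_top[of 3] show ?thesis
  proof eventually_elim
  case (elim n)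
  let ?t = "T n"
  have t: "?t > 0" using T_pos elim by simp
  have gt: "?t < H q" if "q \<in> outer \<delta> n" for q
  proof -
    have "?t < (1 + \<delta>) * ?t" using \<delta> t by simp
    then show ?thesis using that by (simp add: outer_def)
  qed
  have prim: "primitive q" if "q \<in> prim_part ` E n" for q
    using that primitive_prim_part lattice_E[OF elim(2)] by auto
  have "(\<delta> * ?t) * real (card (outer \<delta> n)) \<le> (\<Sum>q\<in>prim_part ` E n - Q ?t. H q - ?t)"
  proof (rule card_mult_le_sum)
    show "finite (prim_part ` E n - Q ?t)" using finite_E elim by simp
    show "outer \<delta> n \<subseteq> prim_part ` E n - Q ?t" using gt by (force simp: outer_def Q_def)
    show "0 \<le> H q - ?t" if "q \<in> prim_part ` E n - Q ?t" for q using that prim[of q] by (auto simp: Q_def)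
    show "\<delta> * ?t \<le> H q - ?t" if "q \<in> outer \<delta> n" for q using that by (simp add: outer_def algebra_simps)
  qed
  also have "\<dots> \<le> X n" unfolding X_def by (rule excess_ge_outer[OF fan[OF elim(2)]])
  finally have "(\<delta> * ?t) * real (card (outer \<delta> n)) \<le> \<eta> * \<delta> * ?t^3" using elim(1) by simp
  also have "\<dots> = (\<delta> * ?t) * (\<eta> * ?t\<^sup>2)" by (simp add: power2_eq_square power3_eq_cube)
  finally show ?case using t \<delta> by simp
  qed
qed

lemma exchange_not_cheaper:
  assumes n: "n \<ge> 3" and z0: "z0 \<in> E n" and A: "A \<subseteq> E n" "z0 \<notin> A"
    and B: "finite B" "b0 \<notin> B" "card B = card A"
    and new: "\<And>b. b \<in> insert b0 B \<Longrightarrow> primitive b \<and> b \<notin> prim_part ` E n"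
    and sum: "z0 + \<Sum>A = b0 + \<Sum>B"
  shows "H z0 + (\<Sum>a\<in>A. H a) \<le> H b0 + (\<Sum>b\<in>B. H b)"
proof -
  define N where "N = insert b0 B"
  define R where "R = E n - insert z0 A"
  have fin: "finite (E n)" "finite A" "finite N" "finite R"
    using finite_E[OF n] A(1) B(1) finite_subset by (auto simp: N_def R_def)
  have lat: "lattice_point z" "z \<noteq> 0" if "z \<in> E n" for z using lattice_E[OF n that] by auto
  have disj: "N \<inter> E n = {}"
  proof -
    have False if "b \<in> N" "b \<in> E n" for b
      using new[of b] that primitive_prim_part_eq[of b] by (metis N_def imageI)
    then show ?thesis by blast
  qed
  have sub: "insert z0 A \<subseteq> E n" using z0 A by simp
  have split: "sum f (R \<union> N) = sum f (E n) - (f z0 + sum f A) + (f b0 + sum f B)" for f :: "real^2 \<Rightarrow> 'b::ab_group_add"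
  proof -
    have "sum f (R \<union> N) = sum f R + sum f N" using fin disj by (intro sum.union_disjoint) (auto simp: R_def)
    moreover have "sum f R = sum f (E n) - sum f (insert z0 A)" unfolding R_def by (rule sum_diff[OF fin(1) sub])
    ultimately show ?thesis using fin A(2) B by (simp add: N_def)
  qed
  have "R \<union> N \<in> lattice_fans n"
    unfolding lattice_fans_def
  proof (intro CollectI conjI ballI impI)
    show "finite (R \<union> N)" using fin by simp
    have cE: "card (E n) = n" "\<Sum>(E n) = 0" using fan[OF n] by (auto simp: lattice_fans_def)
    have "card (R \<union> N) = card R + card N" using fin disj by (intro card_Un_disjoint) (auto simp: R_def)
    also have "card R = n - (card A + 1)" unfolding R_def using sub fin A(2) cE by (simp add: card_Diff_subset)
    also have "card N = card A + 1" using B by (simp add: N_def)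
    also have "n - (card A + 1) + (card A + 1) = n"
      using card_mono[OF fin(1) sub] fin A(2) cE by simp
    finally show "card (R \<union> N) = n" .
    show "\<Sum>(R \<union> N) = 0" using split[of "\<lambda>x. x"] cE(2) sum by simp
    show "lattice_point z" "z \<noteq> 0" if "z \<in> R \<union> N" for z
      using that lat[of z] new[of z] primitive_lattice[of z] primitive_nonzero[of z]
      unfolding R_def N_def by blast+
    show "x = y" if xy: "x \<in> R \<union> N" "y \<in> R \<union> N" and pp: "pos_parallel x y" for x y
    proof -
      have no: False if "u \<in> R" "v \<in> N" "pos_parallel u v" for u v
      proof -
        have v: "primitive v" "v \<notin> prim_part ` E n" using new that(2) by (auto simp: N_def)
        have "prim_part u = prim_part v"
          using that lat[of u] primitive_lattice[OF v(1)] primitive_nonzero[OF v(1)]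
          by (intro pos_parallel_imp_prim_part_eq) (auto simp: R_def)
        then show False using v that(1) primitive_prim_part_eq[OF v(1)] by (auto simp: R_def)
      qed
      consider "x \<in> R" "y \<in> R" | "x \<in> N" "y \<in> N" | "x \<in> R" "y \<in> N" | "x \<in> N" "y \<in> R" using xy by blast
      then show "x = y"
      proof cases
        case 1 then show ?thesis using fan[OF n] pp by (auto simp: lattice_fans_def R_def)
      next
        case 2 then show ?thesis using new pp primitive_pos_parallel_eq by (auto simp: N_def)
      next
        case 3 then show ?thesis using no pp by blast
      next
        case 4 then show ?thesis using no pp pos_parallel_sym by blast
      qed
    qed
  qed
  from minimal[OF n this] show ?thesis unfolding split[of H] by simp
qed

text \<open>The gauge \<open>y * T n\<close> of an outlier is not bounded in advance. Gain and
  number of swaps are both at most linear in \<open>y\<close>, so constants that depend on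
  \<open>\<epsilon>\<close> alone suffice.\<close>

lemma no_outliers:
  assumes \<epsilon>: "0 < \<epsilon>" "\<epsilon> < 1"
  shows "\<forall>\<^sub>F n in sequentially. \<forall>z\<in>E n. H z \<le> (1 + \<epsilon>) * T n"
proof -
  \<comment> \<open>\<open>5 * s * M = \<epsilon>/2\<close> makes displacements of norm up to
    \<open>5 * s\<close> satisfy the hypothesis \<open>H (- w) \<le> 1/2\<close> of
    \<open>chord\<close>, and puts every outlier at distance at least \<open>5 * s * T n\<close>
    from its substitute.\<close>
  define s where "s = \<epsilon> / (10 * M)"
  \<comment> \<open>There will be at most \<open>(y + 2) / (2 * (m * s))\<close> swaps, each losing
    at most \<open>2 * e * T n\<close>, so the total loss is at most
    \<open>\<epsilon> / 16 * (y + 2) * T n\<close>.\<close>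
  define e where "e = \<epsilon> * (m * s) / 16"
  have s: "s > 0" "5 * s * M = \<epsilon> / 2" using \<epsilon> M_pos by (auto simp: s_def)
  have ms: "m * s > 0" "m * s \<le> 1/10"
  proof -
    show "m * s > 0" using s m_pos by simp
    have "m * s \<le> M * s" using m_le_M s by (intro mult_right_mono) auto
    then show "m * s \<le> 1/10" using s(2) \<epsilon> by (simp add: algebra_simps)
  qed
  have e: "e > 0" "e \<le> m * s" "e \<le> \<epsilon> / 16" "e \<le> 1/2" "e / (m * s) = \<epsilon> / 16"
  proof -
    show "e > 0" using \<epsilon> ms by (simp add: e_def)
    have "\<epsilon> * (m * s) \<le> 1 * (m * s)" using \<epsilon> ms by (intro mult_right_mono) auto
    then show "e \<le> m * s" using ms unfolding e_def by linarith
    have "\<epsilon> * (m * s) \<le> \<epsilon> * 1" using \<epsilon> ms by (intro mult_left_mono) auto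
    then show "e \<le> \<epsilon> / 16" unfolding e_def by linarith
    then show "e \<le> 1/2" using \<epsilon> by linarith
    show "e / (m * s) = \<epsilon> / 16" using s m_pos by (simp add: e_def)
  qed
  define W :: "(real^2) set" where "W = cball 0 (5 * s) - ball 0 s"
  have Wmem: "w \<in> W \<longleftrightarrow> s \<le> norm w \<and> norm w \<le> 5 * s" for w by (auto simp: W_def)
  have W: "compact W" by (simp add: W_def compact_diff)
  have WH: "H w \<ge> e \<and> H (- w) \<le> 1/2" if "w \<in> W" for w
  proof
    have "m * s \<le> m * norm w" using that m_pos by (simp add: Wmem)
    then show "H w \<ge> e" using lower[of w] e(2) by linarith
    have "M * norm w \<le> M * (5 * s)" using that M_pos by (simp add: Wmem)
    then show "H (- w) \<le> 1/2" using upper[of "- w"] s(2) \<epsilon>(2) by (simp add: algebra_simps)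
  qed
  obtain \<eta> where \<eta>: "\<eta> > 0" "\<forall>\<^sub>F t in at_top. swappable e W \<eta> t"
    using uniformly_swappable[OF e(1,4) W WH] by blast
  have sw: "\<forall>\<^sub>F n in sequentially. swappable e W \<eta> (T n)"
    using eventually_compose_filterlim[OF \<eta>(2) T_at_top] .
  have im: "\<forall>\<^sub>F n in sequentially. real (card (inner_missing (e/4) n)) \<le> \<eta> / 8 * (T n)\<^sup>2"
    by (rule inner_missing_small) (use e \<eta> in auto)
  have ou: "\<forall>\<^sub>F n in sequentially. real (card (outer (e/4) n)) \<le> \<eta> / 8 * (T n)\<^sup>2"
    by (rule outer_small) (use e \<eta> in auto)
  have Xs: "\<forall>\<^sub>F n in sequentially. X n \<le> (\<eta> * (m * s) / 4) * T n^3"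
    by (rule X_le) (use ms \<eta> in simp)
  have T2: "filterlim (\<lambda>n. \<eta> / 8 * (T n)\<^sup>2) at_top sequentially"
    by (rule filterlim_tendsto_pos_mult_at_top[OF tendsto_const _ filterlim_pow_at_top[OF _ T_at_top]]) (use \<eta> in auto)
  have T2s: "\<forall>\<^sub>F n in sequentially. c \<le> \<eta> / 8 * (T n)\<^sup>2" for c
    using T2 by (simp add: filterlim_at_top)
  have Ts: "\<forall>\<^sub>F n in sequentially. c \<le> T n" for c using T_at_top by (simp add: filterlim_at_top)
  show ?thesis
    \<comment> \<open>In the bound on the forbidden set, 1 pays for \<open>b0\<close>, and
      \<open>3 / (2 * (m * s))\<close> for the part of the number of swaps that does not involve
      \<open>y - 1\<close>.\<close>
    using sw im ou Xs T2s[of "max 1 (3 / (2 * (m * s)))"] Ts[of "2 / s"] eventually_ge_at_top[of 3]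
  proof eventually_elim
    case (elim n)
    let ?t = "T n"
    have n: "n \<ge> 3" by (rule elim(7))
    have t: "?t > 0" using T_pos n by simp
    have st: "s * ?t \<ge> 2" using elim(6) s by (simp add: field_simps)
    show ?case
    proof (rule ccontr)
      assume "\<not> ?case"
      then obtain z0 where z0: "z0 \<in> E n" "H z0 > (1 + \<epsilon>) * ?t" by auto
      define F1 where "F1 = inner_missing (e/4) n \<union> outer (e/4) n"
      have finF1: "finite F1" using finite_E[OF n] by (simp add: F1_def outer_def)
      have "card F1 \<le> card (inner_missing (e/4) n) + card (outer (e/4) n)" unfolding F1_def by (rule card_Un_le)
      then have cF1: "real (card F1) \<le> \<eta> / 4 * ?t\<^sup>2" using elim(2,3) by linarith
      have inW: "(1 / ?t) *\<^sub>R r \<in> W" if "s * ?t \<le> norm r" "norm r \<le> 5 * s * ?t" for r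
        using that t by (simp add: Wmem field_simps)
      \<comment> \<open>Any displacement of admissible size will do: only the outer partner
        \<open>b0\<close> of the resulting pair is used, as the substitute for
        \<open>z0\<close>.\<close>
      define r0 where "r0 = lattice_vec (\<lceil>2 * s * ?t\<rceil>, 0)"
      have "norm r0 = of_int \<lceil>2 * s * ?t\<rceil>" using st by (simp add: r0_def norm_lattice_vec_axis)
      then have "s * ?t \<le> norm r0" "norm r0 \<le> 5 * s * ?t" using st by linarith+
      then have "(1 / ?t) *\<^sub>R r0 \<in> W" by (rule inW)
      moreover have "lattice_point r0" unfolding r0_def lattice_point_iff by blast
      moreover have "real (card F1) \<le> \<eta> * ?t\<^sup>2"
      proof -
        have "\<eta> / 4 * ?t\<^sup>2 \<le> \<eta> * ?t\<^sup>2" using \<eta>(1) by (intro mult_right_mono) auto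
        then show ?thesis using cF1 by linarith
      qed
      ultimately obtain a0 where a0: "a0 + r0 \<notin> F1" "swap_pair e ?t a0 (a0 + r0)"
        using elim(1) finF1 unfolding swappable_def by blast
      define b0 where "b0 = a0 + r0"
      have b0: "b0 \<notin> F1" "primitive b0" "(1 + e/4) * ?t \<le> H b0" "H b0 \<le> (1 + e) * ?t"
        using a0 by (auto simp: b0_def swap_pair_def)
      define r where "r = z0 - b0"
      have lr: "lattice_point r" unfolding r_def
        using lattice_E[OF n z0(1)] b0(2) by (intro lattice_point_diff) (auto simp: primitive_def)
      define y where "y = H z0 / ?t"
      have Hz0: "H z0 = y * ?t" using t by (simp add: y_def)
      have y: "y > 1 + \<epsilon>" using z0(2) t unfolding Hz0 by simp
      have nr_low: "5 * s * ?t \<le> norm r"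
      proof -
        have "H z0 \<le> H r + H b0" using subadd[of r b0] by (simp add: r_def)
        moreover have "e * ?t \<le> \<epsilon> / 16 * ?t" "(\<epsilon> / 2) * ?t \<le> \<epsilon> * ?t - \<epsilon> / 16 * ?t" "0 < \<epsilon> * ?t" using e(3) t \<epsilon> by auto
        ultimately have "(\<epsilon> / 2) * ?t \<le> M * norm r" using z0(2) b0(4) upper[of r] by (simp add: distrib_right)
        then have "M * (5 * s * ?t) \<le> M * norm r" using s(2) by (metis mult.assoc mult.commute)
        then show ?thesis using M_pos by simp
      qed
      have nr_up: "norm r \<le> (y + 2) * ?t / m"
      proof -
        have "m * norm r \<le> m * norm z0 + m * norm b0"
          using norm_triangle_ineq4[of z0 b0] m_pos by (simp add: r_def distrib_left[symmetric])
        also have "\<dots> \<le> H z0 + H b0" using lower[of z0] lower[of b0] by linarith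
        also have "\<dots> \<le> y * ?t + 2 * ?t"
        proof -
          have "(1 + e) * ?t \<le> 2 * ?t" using e(4) t by (intro mult_right_mono) auto
          then show ?thesis using b0(4) Hz0 by linarith
        qed
        finally show ?thesis using m_pos by (simp add: field_simps)
      qed
      \<comment> \<open>Cutting \<open>r\<close> into \<open>k\<close> parts gives norms between
        \<open>2 * s * ?t\<close> and \<open>4 * s * ?t\<close>. The wider window of
        \<open>W\<close>, from \<open>s\<close> to \<open>5 * s\<close>, absorbs the rounding error
        2 of \<open>lattice_split\<close>.\<close>
      define q where "q = norm r / (2 * s * ?t)"
      define k where "k = nat \<lfloor>q\<rfloor>"
      have q: "q \<ge> 5/2" using nr_low s t by (simp add: q_def field_simps)
      have k: "k \<ge> 1" "real k \<le> q" "q < real k + 1" using q unfolding k_def by linarith+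
      have nr: "norm r = q * (2 * s * ?t)" using s t by (simp add: q_def)
      have q_up: "q \<le> (y + 2) / (2 * (m * s))"
      proof -
        have "q * (2 * s * ?t) \<le> (y + 2) * ?t / m" using nr nr_up by simp
        then have "(m * (q * (2 * s))) * ?t \<le> (y + 2) * ?t" using m_pos by (simp add: field_simps)
        then have "m * (q * (2 * s)) \<le> y + 2" using t by (simp only: mult_le_cancel_right_pos)
        then show ?thesis using s(1) m_pos by (simp add: field_simps)
      qed
      obtain rs where rs: "length rs = k" "sum_list rs = r"
        "\<And>x. x \<in> set rs \<Longrightarrow> lattice_point x \<and> norm (x - (1 / real k) *\<^sub>R r) \<le> 2"
        using lattice_split[OF lr k(1)] by blast
      have rsW: "\<forall>x\<in>set rs. lattice_point x \<and> (1 / ?t) *\<^sub>R x \<in> W"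
      proof
        fix x assume x: "x \<in> set rs"
        have nk: "norm ((1 / real k) *\<^sub>R r) = q / real k * (2 * s * ?t)" by (simp add: nr)
        have qk: "1 \<le> q / real k" "q / real k \<le> 2" using k by (auto simp: field_simps)
        have "2 * s * ?t \<ge> 0" using s t by simp
        then have "1 * (2 * s * ?t) \<le> norm ((1 / real k) *\<^sub>R r)" "norm ((1 / real k) *\<^sub>R r) \<le> 2 * (2 * s * ?t)"
          unfolding nk using qk by (blast intro: mult_right_mono)+
        then have "2 * (s * ?t) \<le> norm ((1 / real k) *\<^sub>R r)" "norm ((1 / real k) *\<^sub>R r) \<le> 4 * (s * ?t)" by linarith+
        moreover have "norm ((1 / real k) *\<^sub>R r) \<le> norm x + 2" "norm x \<le> norm ((1 / real k) *\<^sub>R r) + 2"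
          using rs(3)[OF x] norm_triangle_ineq2[of x "(1 / real k) *\<^sub>R r"] norm_triangle_ineq3[of x "(1 / real k) *\<^sub>R r"] by linarith+
        ultimately have "s * ?t \<le> norm x" "norm x \<le> 5 * s * ?t" using st by linarith+
        then show "lattice_point x \<and> (1 / ?t) *\<^sub>R x \<in> W" using inW rs(3)[OF x] by blast
      qed
      \<comment> \<open>However far away \<open>z0\<close> is, the excess bounds
        \<open>y - 1\<close>, and thereby the number of swaps, by a small multiple of
        \<open>?t\<^sup>2\<close>.\<close>
      have budget: "real (card (insert b0 F1)) + 2 * real (length rs) \<le> \<eta> * ?t\<^sup>2"
      proof -
        have c: "real (card (insert b0 F1)) \<le> \<eta> / 4 * ?t\<^sup>2 + \<eta> / 8 * ?t\<^sup>2"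
          using cF1 elim(5) finF1 b0(1) by simp
        have "y * ?t - ?t \<le> X n" using excess_ge_single[OF fan[OF n] z0(1), of ?t] by (simp add: X_def Hz0)
        then have "(y - 1) * ?t \<le> (\<eta> * (m * s) / 4 * ?t\<^sup>2) * ?t"
          using elim(4) by (simp add: left_diff_distrib power2_eq_square power3_eq_cube mult.assoc)
        then have "y - 1 \<le> \<eta> * (m * s) / 4 * ?t\<^sup>2" using t by (simp only: mult_le_cancel_right_pos)
        then have "(y - 1) / (m * s) \<le> (\<eta> * (m * s) / 4 * ?t\<^sup>2) / (m * s)" using ms by (intro divide_right_mono) auto
        also have "\<dots> = \<eta> / 4 * ?t\<^sup>2" using s m_pos by simp
        finally have y1: "(y - 1) / (m * s) \<le> \<eta> / 4 * ?t\<^sup>2" .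
        have "2 * real k \<le> 2 * ((y + 2) / (2 * (m * s)))" using k(2) q_up by linarith
        also have "\<dots> = (y - 1) / (m * s) + 2 * (3 / (2 * (m * s)))"
          using s m_pos by (simp add: field_simps)
        also have "\<dots> \<le> \<eta> / 4 * ?t\<^sup>2 + 2 * (\<eta> / 8 * ?t\<^sup>2)" using y1 elim(5) by linarith
        finally have "2 * real k \<le> \<eta> / 2 * ?t\<^sup>2" by (simp add: field_simps)
        moreover have "\<eta> / 4 * ?t\<^sup>2 + \<eta> / 8 * ?t\<^sup>2 + \<eta> / 2 * ?t\<^sup>2 \<le> \<eta> * ?t\<^sup>2"
          using \<eta>(1) by (simp add: field_simps)
        ultimately show ?thesis using c rs(1) by linarith
      qed
      have "finite (insert b0 F1)" using finF1 by simp
      from swap_list[OF elim(1) this rsW budget]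
      obtain A B where AB: "finite A" "finite B" "card A = k" "card B = k" "A \<inter> insert b0 F1 = {}" "B \<inter> insert b0 F1 = {}"
        "\<Sum>B = \<Sum>A + r" "\<forall>a\<in>A. \<exists>b. swap_pair e ?t a b" "\<forall>b\<in>B. \<exists>a. swap_pair e ?t a b"
        unfolding rs(1,2) by blast
      have HA: "primitive a" "(1 - e) * ?t \<le> H a" "H a \<le> (1 - e/4) * ?t" if "a \<in> A" for a
        using AB(8) that by (auto simp: swap_pair_def)
      have HB: "primitive b" "(1 + e/4) * ?t \<le> H b" "H b \<le> (1 + e) * ?t" if "b \<in> B" for b
        using AB(9) that by (auto simp: swap_pair_def)
      have A_sub: "A \<subseteq> E n"
      proof
        fix a assume a: "a \<in> A"
        have "e/4 * ?t \<le> (1 - e) * ?t" using e(4) t by (intro mult_right_mono) auto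
        then have "e/4 * ?t \<le> H a" using HA(2)[OF a] by linarith
        moreover have "a \<notin> inner_missing (e/4) n" using AB(5) a by (auto simp: F1_def)
        ultimately show "a \<in> E n" using HA[OF a] by (simp add: inner_missing_def)
      qed
      have z0A: "z0 \<notin> A"
      proof
        assume "z0 \<in> A"
        then have "(1 + \<epsilon>) * ?t < (1 - e/4) * ?t" using HA(3) z0(2) by fastforce
        then show False using t \<epsilon> e(1) by simp
      qed
      have new: "primitive b \<and> b \<notin> prim_part ` E n" if "b \<in> insert b0 B" for b
      proof -
        have "primitive b" "(1 + e/4) * ?t \<le> H b" "b \<notin> outer (e/4) n"
          using that HB b0 AB(6) by (auto simp: F1_def)
        then show ?thesis by (auto simp: outer_def)
      qed
      have "H z0 + (\<Sum>a\<in>A. H a) \<le> H b0 + (\<Sum>b\<in>B. H b)"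
        by (rule exchange_not_cheaper[OF n z0(1) A_sub z0A AB(2)]) (use AB(3,4,6,7) new in \<open>auto simp: r_def\<close>)
      moreover have "real k * ((1 - e) * ?t) \<le> (\<Sum>a\<in>A. H a)"
        using sum_bounded_below[of A "(1 - e) * ?t" H] HA(2) AB(3) by simp
      moreover have "(\<Sum>b\<in>B. H b) \<le> real k * ((1 + e) * ?t)"
        using sum_bounded_above[of B H "(1 + e) * ?t"] HB(3) AB(4) by simp
      ultimately have "y * ?t \<le> (1 + e) * ?t + real k * ((1 + e) * ?t) - real k * ((1 - e) * ?t)"
        using b0(4) Hz0 by linarith
      also have "\<dots> = (1 + e + 2 * e * real k) * ?t" by (simp add: algebra_simps)
      finally have "y \<le> 1 + e + 2 * e * real k" using t by simp
      also have "2 * e * real k \<le> 2 * e * ((y + 2) / (2 * (m * s)))" using k(2) q_up e(1) by (intro mult_left_mono) auto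
      also have "\<dots> = e / (m * s) * (y + 2)" by simp
      also have "\<dots> = \<epsilon> / 16 * (y + 2)" by (simp only: e(5))
      finally have "y \<le> 1 + e + \<epsilon> / 16 * (y + 2)" by simp
      also have "\<epsilon> / 16 * (y + 2) = \<epsilon> / 16 * (y - 1) + 3 * \<epsilon> / 16" by (simp add: field_simps)
      also have "\<epsilon> / 16 * (y - 1) \<le> 1 / 16 * (y - 1)" using \<epsilon> y by (intro mult_right_mono) auto
      finally have "y \<le> 1 + e + (1 / 16 * (y - 1) + 3 * \<epsilon> / 16)" by simp
      moreover have "16 * (1 / 16 * (y - 1)) = y - 1" "16 * (3 * \<epsilon> / 16) = 3 * \<epsilon>" "16 * e \<le> \<epsilon>"
        using e(3) by simp_all
      \<comment> \<open>In total \<open>15 * (y - 1) \<le> 4 * \<epsilon>\<close>, against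
        \<open>y > 1 + \<epsilon>\<close>.\<close>
      moreover have False if "y \<le> 1 + e + (a + b)" "16 * a = y - 1" "16 * b = 3 * \<epsilon>" "16 * e \<le> \<epsilon>" for a b
        using that y \<epsilon>(1) by linarith
      ultimately show False by blast
    qed
  qed
qed

end

section \<open>Hausdorff limits of compact sets\<close>

lemma hausdorff_dist_bounds:
  assumes "A \<noteq> {}" "B \<noteq> {}" "\<And>a. a \<in> A \<Longrightarrow> infdist a B \<le> e" "\<And>b. b \<in> B \<Longrightarrow> infdist b A \<le> e"
  shows "0 \<le> hausdorff_dist A B" "hausdorff_dist A B \<le> e"
proof -
  obtain a where a: "a \<in> A" using assms(1) by blast
  have "0 \<le> infdist a B" by (rule infdist_nonneg)
  also have "\<dots> \<le> (SUP a\<in>A. infdist a B)"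
    by (rule cSUP_upper[OF a]) (use assms(3) in \<open>auto intro!: bdd_aboveI2\<close>)
  finally show "0 \<le> hausdorff_dist A B" by (simp add: hausdorff_dist_def le_max_iff_disj)
  show "hausdorff_dist A B \<le> e"
    unfolding hausdorff_dist_def using assms by (intro max.boundedI cSUP_least) auto
qed

lemma hausdorff_dist_upper:
  assumes "compact A" "compact B"
  shows "a \<in> A \<Longrightarrow> infdist a B \<le> hausdorff_dist A B" "b \<in> B \<Longrightarrow> infdist b A \<le> hausdorff_dist A B"
proof -
  have bdd: "bdd_above ((\<lambda>a. infdist a Y) ` X)" if "compact X" for X Y :: "'a set"
    using compact_continuous_image[OF continuous_on_infdist[OF continuous_on_id] that]
    by (intro bounded_imp_bdd_above compact_imp_bounded)
  show "infdist a B \<le> hausdorff_dist A B" if "a \<in> A"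
    unfolding hausdorff_dist_def by (intro max.coboundedI1 cSUP_upper[OF that] bdd assms)
  show "infdist b A \<le> hausdorff_dist A B" if "b \<in> B"
    unfolding hausdorff_dist_def by (intro max.coboundedI2 cSUP_upper[OF that] bdd assms)
qed

text \<open>Triangle inequality through a point of \<open>A n\<close> nearest to \<open>c\<close>.
  Used in both directions it gives uniqueness of the limit.\<close>

lemma hausdorff_limit_subset:
  fixes A :: "nat \<Rightarrow> 'a::heine_borel set"
  assumes A: "\<forall>\<^sub>F n in sequentially. compact (A n) \<and> A n \<noteq> {}"
    and C: "compact C1" "compact C2" "C2 \<noteq> {}"
    and lim: "(\<lambda>n. hausdorff_dist (A n) C1) \<longlonglongrightarrow> 0" "(\<lambda>n. hausdorff_dist (A n) C2) \<longlonglongrightarrow> 0"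
  shows "C1 \<subseteq> C2"
proof
  fix c assume c: "c \<in> C1"
  have "(\<lambda>n. hausdorff_dist (A n) C1 + hausdorff_dist (A n) C2) \<longlonglongrightarrow> 0 + 0"
    by (intro tendsto_add lim)
  moreover have "\<forall>\<^sub>F n in sequentially. infdist c C2 \<le> hausdorff_dist (A n) C1 + hausdorff_dist (A n) C2"
    using A
  proof eventually_elim
    case (elim n)
    then have cl: "closed (A n)" "A n \<noteq> {}" by (auto intro: compact_imp_closed)
    obtain a where a: "a \<in> A n" "infdist c (A n) = dist c a"
      by (rule infdist_attains_inf[OF cl])
    have "infdist c C2 \<le> infdist a C2 + dist c a" by (rule infdist_triangle)
    then show ?case
      using hausdorff_dist_upper(2)[of "A n" C1 c] hausdorff_dist_upper(1)[of "A n" C2 a] a c C elim by simp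
  qed
  ultimately have "infdist c C2 \<le> 0 + 0"
    by (intro tendsto_lowerbound[of _ _ sequentially]) auto
  then have "infdist c C2 = 0" using infdist_nonneg[of c C2] by linarith
  then show "c \<in> C2" using in_closed_iff_infdist_zero[OF compact_imp_closed[OF C(2)] C(3)] by simp
qed

section \<open>Convergence of the rescaled hulls\<close>

context minimal_fans
begin

text \<open>A small ball inside \<open>body\<close> contains of the order of
  \<open>(T n)\<^sup>2\<close> scaled primitive vectors, more than can be missing from
  \<open>E n\<close>.\<close>

lemma hits:
  assumes y: "y \<in> body" and r: "r > 0"
  shows "\<forall>\<^sub>F n in sequentially. \<exists>z\<in>E n. norm ((1 / T n) *\<^sub>R z - y) \<le> r"
proof -
  \<comment> \<open>Nothing is known about missing vectors near 0 and near the boundary, so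
    \<open>y\<close> is first moved to a level strictly between 0 and 1.\<close>
  obtain y' where y': "0 < H y'" "H y' < 1" "norm (y' - y) \<le> r / 2"
  proof (cases "y = 0")
    case True
    define c where "c = min (r / 2) (1 / (2 * M))"
    have c: "c > 0" "c \<le> r / 2" "M * c \<le> 1/2"
      using r M_pos by (auto simp: c_def min_def field_simps)
    define v where "v = c *\<^sub>R (axis 1 1 :: real^2)"
    have nv: "norm v = c" using c by (simp add: v_def)
    show ?thesis
    proof (rule that[of v])
      have "m * norm v > 0" using m_pos c nv by simp
      then show "0 < H v" using lower[of v] by linarith
      show "H v < 1" using upper[of v] c(3) nv by simp
      show "norm (v - y) \<le> r / 2" using True nv c by simp
    qed
  next
    case False
    define c where "c = min (1/2) (r / (2 * norm y))"
    have c: "c > 0" "c \<le> 1/2" "c * norm y \<le> r / 2" using r False by (auto simp: c_def min_def field_simps)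
    have Hy: "H y > 0" using lower[of y] m_pos False by (smt (verit) mult_pos_pos zero_less_norm_iff)
    have Hs: "H ((1 - c) *\<^sub>R y) = (1 - c) * H y" using c by (intro homog) simp
    show ?thesis
    proof (rule that[of "(1 - c) *\<^sub>R y"])
      show "0 < H ((1 - c) *\<^sub>R y)" using Hs Hy c by simp
      have "(1 - c) * H y \<le> (1 - c) * 1" using y c by (intro mult_left_mono) (auto simp: body_def)
      then show "H ((1 - c) *\<^sub>R y) < 1" unfolding Hs by (rule le_less_trans) (use c in simp)
      have "(1 - c) *\<^sub>R y - y = (- c) *\<^sub>R y" by (simp add: scaleR_diff_left)
      then show "norm ((1 - c) *\<^sub>R y - y) \<le> r / 2" using c by simp
    qed
  qed
  define \<delta> where "\<delta> = min (H y') (1 - H y') / 2"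
  have \<delta>: "\<delta> > 0" "\<delta> \<le> H y' - \<delta>" "H y' + \<delta> \<le> 1 - \<delta>" using y' by (auto simp: \<delta>_def min_def)
  define \<rho> where "\<rho> = min (r / 2) (\<delta> / M)"
  have \<rho>: "\<rho> > 0" "\<rho> \<le> r / 2" "M * \<rho> \<le> \<delta>" using r \<delta> M_pos by (auto simp: \<rho>_def min_def field_simps)
  define K where "K = cball y' \<rho>"
  define A where "A = measure lebesgue K"
  have A: "A > 0" using content_cball_pos[OF \<rho>(1), of y'] by (simp add: A_def K_def measure_completion)
  have "((\<lambda>t. real (card (prims_in t K)) / t\<^sup>2) \<longlongrightarrow> \<kappa> * A) at_top"
    using card_lattice_in_tendsto(2)[of K] by (simp add: \<kappa>_def A_def K_def)
  then have "\<forall>\<^sub>F n in sequentially. \<kappa> * A / 2 < real (card (prims_in (T n) K)) / (T n)\<^sup>2"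
    using \<kappa>_pos A by (intro order_tendstoD(1)[OF along_T]) auto
  moreover have "\<forall>\<^sub>F n in sequentially. real (card (inner_missing \<delta> n)) \<le> \<kappa> * A / 2 * (T n)\<^sup>2"
    using \<kappa>_pos A \<delta> by (intro inner_missing_small) auto
  ultimately show ?thesis using eventually_ge_at_top[of 3]
  proof eventually_elim
    case (elim n)
    let ?t = "T n"
    have t: "?t > 0" using T_pos elim by simp
    have "real (card (inner_missing \<delta> n)) < real (card (prims_in ?t K))" using elim(1,2) t by (simp add: field_simps)
    then have "\<not> prims_in ?t K \<subseteq> inner_missing \<delta> n"
      using card_mono[OF finite_inner_missing] by (metis not_le of_nat_le_iff)
    then obtain q where q: "q \<in> prims_in ?t K" "q \<notin> inner_missing \<delta> n" by blast
    define x where "x = (1 / ?t) *\<^sub>R q"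
    have x: "norm (x - y') \<le> \<rho>" using q(1) by (simp add: prims_in_def K_def x_def dist_norm norm_minus_commute)
    have "M * norm (x - y') \<le> M * \<rho>" using x M_pos by simp
    then have Hx: "\<delta> \<le> H x" "H x \<le> 1 - \<delta>" using lipschitz[of x y'] \<rho>(3) \<delta>(2,3) by linarith+
    have Hq: "H q = H x * ?t" using t by (simp add: x_def homog)
    have "\<delta> * ?t \<le> H q" "H q \<le> (1 - \<delta>) * ?t" unfolding Hq using Hx t by (auto intro: mult_right_mono)
    then have "q \<in> E n" using q by (auto simp: inner_missing_def prims_in_def)
    moreover have "norm (x - y) \<le> r" using norm_triangle_ineq[of "x - y'" "y' - y"] x y'(3) \<rho>(2) by simp
    ultimately show ?case unfolding x_def by blast
  qed
qed

lemma hits_uniformly: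
  assumes r: "r > 0"
  shows "\<forall>\<^sub>F n in sequentially. \<forall>y\<in>body. \<exists>z\<in>E n. norm ((1 / T n) *\<^sub>R z - y) \<le> r"
proof -
  obtain D where D: "D \<subseteq> body" "finite D" "body \<subseteq> (\<Union>w\<in>D. ball w (r/2))"
    using compactE_image[OF compact_body, of body "\<lambda>w. ball w (r/2)"] r
    by (metis (no_types, lifting) UN_I centre_in_ball half_gt_zero open_ball subsetI)
  have "\<forall>\<^sub>F n in sequentially. \<forall>w\<in>D. \<exists>z\<in>E n. norm ((1 / T n) *\<^sub>R z - w) \<le> r/2"
    using D(1,2) r hits[of _ "r/2"] by (intro eventually_ball_finite) auto
  then show ?thesis
  proof eventually_elim
    case (elim n)
    show ?case
    proof
      fix y assume "y \<in> body"
      then obtain w where w: "w \<in> D" "norm (w - y) < r/2" using D(3) by (auto simp: dist_norm)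
      then obtain z where z: "z \<in> E n" "norm ((1 / T n) *\<^sub>R z - w) \<le> r/2" using elim by blast
      have "norm ((1 / T n) *\<^sub>R z - y) \<le> r"
        using norm_triangle_ineq[of "(1 / T n) *\<^sub>R z - w" "w - y"] z(2) w(2) by simp
      then show "\<exists>z\<in>E n. norm ((1 / T n) *\<^sub>R z - y) \<le> r" using z(1) by blast
    qed
  qed
qed

definition S :: "nat \<Rightarrow> (real^2) set" where "S n = (\<lambda>x. (1 / T n) *\<^sub>R x) ` (convex hull (E n))"

lemma S_facts:
  assumes "n \<ge> 3" shows "compact (S n)" "convex (S n)" "S n \<noteq> {}"
proof -
  show "compact (S n)" unfolding S_def
    by (intro compact_scaling compact_convex_hull finite_imp_compact finite_E assms)
  show "convex (S n)" unfolding S_def by (intro convex_scaling convex_convex_hull)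
  have "E n \<noteq> {}" using fan[OF assms] assms by (auto simp: lattice_fans_def)
  then show "S n \<noteq> {}" by (simp add: S_def)
qed

lemma S_upper: "0 < \<epsilon> \<Longrightarrow> \<epsilon> < 1 \<Longrightarrow> \<forall>\<^sub>F n in sequentially. S n \<subseteq> {x. H x \<le> 1 + \<epsilon>}"
proof -
  assume "0 < \<epsilon>" "\<epsilon> < 1"
  then have "\<forall>\<^sub>F n in sequentially. \<forall>z\<in>E n. H z \<le> (1 + \<epsilon>) * T n" by (rule no_outliers)
  then show ?thesis using eventually_ge_at_top[of 3]
  proof eventually_elim
    case (elim n)
    then have t: "T n > 0" using T_pos by simp
    have "convex hull (E n) \<subseteq> {x. H x \<le> (1 + \<epsilon>) * T n}"
      using elim by (intro hull_minimal convex_sublevel) auto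
    then show ?case using t by (auto simp: S_def homog field_simps)
  qed
qed

lemma S_near: "r > 0 \<Longrightarrow> \<forall>\<^sub>F n in sequentially. \<forall>y\<in>body. \<exists>s\<in>S n. norm (s - y) \<le> r"
proof -
  assume "r > 0"
  from hits_uniformly[OF this] show ?thesis
  proof eventually_elim
    case (elim n)
    have "(1 / T n) *\<^sub>R z \<in> S n" if "z \<in> E n" for z
      unfolding S_def by (rule imageI[OF hull_inc[OF that]])
    then show ?case using elim by meson
  qed
qed

text \<open>Cancellation: \<open>body \<subseteq> S n + r \<cdot> ball\<close> and \<open>r \<cdot> ball \<subseteq> M r \<cdot> body\<close>, so \<open>(1 - M r) \<cdot> body \<subseteq> S n\<close>
  by comparing support functions.\<close>
lemma shrunk_body_subset:
  assumes n: "n \<ge> 3" and r: "0 < r" "M * r < 1" and near: "\<forall>y\<in>body. \<exists>s\<in>S n. norm (s - y) \<le> r"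
    and y: "y \<in> body"
  shows "(1 - M * r) *\<^sub>R y \<in> S n"
proof (rule ccontr)
  assume "(1 - M * r) *\<^sub>R y \<notin> S n"
  then obtain h b where hb: "h \<bullet> ((1 - M * r) *\<^sub>R y) < b" "\<And>x. x \<in> S n \<Longrightarrow> h \<bullet> x > b"
    using separating_hyperplane_closed_point[of "S n"] S_facts[OF n] compact_imp_closed by metis
  have ne: "body \<noteq> {}" using y by auto
  have "continuous_on body (\<lambda>x. h \<bullet> x)" by (intro continuous_intros)
  then obtain v where v: "v \<in> body" "\<And>x. x \<in> body \<Longrightarrow> h \<bullet> v \<le> h \<bullet> x"
    using continuous_attains_inf[OF compact_body ne] by blast
  \<comment> \<open>\<open>body\<close> contains the ball of radius \<open>1 / M\<close>, on which
    \<open>h\<close> attains the value \<open>- norm h / M\<close>; the minimum at \<open>v\<close>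
    is no larger.\<close>
  have c: "norm h \<le> - (M * (h \<bullet> v))"
  proof (cases "h = 0")
    case False
    define w where "w = (- (1 / (M * norm h))) *\<^sub>R h"
    have "norm w = 1 / M" using False M_pos by (simp add: w_def)
    then have "w \<in> body" using cball_subset_body by auto
    then have "h \<bullet> v \<le> h \<bullet> w" by (rule v(2))
    also have "h \<bullet> w = - (norm h / M)"
      using False M_pos by (simp add: w_def power2_norm_eq_inner[symmetric] power2_eq_square)
    finally show ?thesis using M_pos by (simp add: field_simps)
  qed simp
  obtain s where s: "s \<in> S n" "norm (s - v) \<le> r" using near v(1) by blast
  have "b < h \<bullet> s" by (rule hb(2)[OF s(1)])
  also have "h \<bullet> s = h \<bullet> v + h \<bullet> (s - v)" by (simp add: inner_diff_right)
  also have "h \<bullet> (s - v) \<le> norm h * r"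
    using norm_cauchy_schwarz[of h "s - v"] s(2) by (meson mult_left_mono norm_ge_zero order_trans)
  also have "norm h * r \<le> - (M * (h \<bullet> v)) * r" using c r by (intro mult_right_mono) auto
  also have "h \<bullet> v + - (M * (h \<bullet> v)) * r = (1 - M * r) * (h \<bullet> v)" by (simp add: algebra_simps)
  also have "\<dots> \<le> (1 - M * r) * (h \<bullet> y)" using v(2)[OF y] r by (intro mult_left_mono) auto
  finally show False using hb(1) by simp
qed

lemma measure_scaled_body: "c \<ge> 0 \<Longrightarrow> measure lebesgue ((\<lambda>x. c *\<^sub>R x) ` body) = c\<^sup>2"
  using measure_lebesgue_affine[of c 0 body] area_body by (simp add: power2_eq_square)

text \<open>Eventually \<open>S n\<close> lies between the multiples \<open>1 - \<epsilon>\<close>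
  and \<open>1 + \<epsilon>\<close> of \<open>body\<close>, which has area 1.\<close>

lemma area_S: "(\<lambda>n. measure lebesgue (S n)) \<longlonglongrightarrow> 1"
proof (rule LIMSEQ_I)
  fix d :: real assume d: "d > 0"
  define \<epsilon> where "\<epsilon> = min (1/2) (d / 4)"
  have \<epsilon>: "0 < \<epsilon>" "\<epsilon> < 1" "\<epsilon> \<le> d / 4" using d by (auto simp: \<epsilon>_def)
  define r where "r = \<epsilon> / M"
  have r: "r > 0" "M * r = \<epsilon>" using \<epsilon> M_pos by (auto simp: r_def)
  have "\<forall>\<^sub>F n in sequentially. norm (measure lebesgue (S n) - 1) < d"
    using S_upper[OF \<epsilon>(1,2)] S_near[OF r(1)] eventually_ge_at_top[of 3]
  proof eventually_elim
    case (elim n)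
    have cS: "S n \<in> lmeasurable" using S_facts[OF elim(3)] by (simp add: lmeasurable_compact)
    have cc: "(\<lambda>x. c *\<^sub>R x) ` body \<in> lmeasurable" for c :: real
      by (intro lmeasurable_compact compact_scaling compact_body)
    have "S n \<subseteq> (\<lambda>x. (1 + \<epsilon>) *\<^sub>R x) ` body"
    proof
      fix x assume "x \<in> S n"
      then have "H x \<le> 1 + \<epsilon>" using elim(1) by auto
      then have "(1 / (1 + \<epsilon>)) *\<^sub>R x \<in> body" using scale_mem_body[of "1 + \<epsilon>" x] \<epsilon> by simp
      moreover have "x = (1 + \<epsilon>) *\<^sub>R ((1 / (1 + \<epsilon>)) *\<^sub>R x)" using \<epsilon> by simp
      ultimately show "x \<in> (\<lambda>x. (1 + \<epsilon>) *\<^sub>R x) ` body" by (rule rev_image_eqI)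
    qed
    from measure_mono_fmeasurable[OF this fmeasurableD[OF cS] cc]
    have "measure lebesgue (S n) \<le> (1 + \<epsilon>)\<^sup>2" using \<epsilon> by (simp add: measure_scaled_body)
    also have "\<dots> \<le> 1 + 3 * \<epsilon>" using \<epsilon> by (simp add: power2_eq_square algebra_simps)
    finally have up: "measure lebesgue (S n) \<le> 1 + 3 * \<epsilon>" .
    have "(\<lambda>x. (1 - \<epsilon>) *\<^sub>R x) ` body \<subseteq> S n"
      using shrunk_body_subset[OF elim(3) r(1) _ elim(2)] \<epsilon>(2) r(2) by auto
    from measure_mono_fmeasurable[OF this fmeasurableD[OF cc] cS]
    have "(1 - \<epsilon>)\<^sup>2 \<le> measure lebesgue (S n)" using \<epsilon> by (simp add: measure_scaled_body)
    moreover have "1 - 2 * \<epsilon> \<le> (1 - \<epsilon>)\<^sup>2" by (simp add: power2_eq_square algebra_simps)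
    ultimately show ?case using up \<epsilon> d by (simp add: abs_less_iff)
  qed
  then show "\<exists>no. \<forall>n\<ge>no. norm (measure lebesgue (S n) - 1) < d" by (simp add: eventually_sequentially)
qed

text \<open>The factor \<open>\<sigma> n\<close> makes up for normalising by the actual area instead
  of by \<open>T n\<close>; it is harmless because \<open>S n\<close> stays bounded.\<close>

lemma hausdorff_S:
  assumes \<sigma>: "\<sigma> \<longlonglongrightarrow> 1"
  shows "(\<lambda>n. hausdorff_dist ((\<lambda>x. \<sigma> n *\<^sub>R x) ` S n) body) \<longlonglongrightarrow> 0"
proof (rule LIMSEQ_I)
  fix d :: real assume d: "d > 0"
  \<comment> \<open>Points of \<open>S n\<close> have norm at most \<open>2 / m\<close>, so
    rescaling by \<open>\<sigma> n\<close> and shrinking into \<open>body\<close> each move them by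
    at most \<open>d / 4\<close>.\<close>
  define \<epsilon> where "\<epsilon> = min (1/2) (min (d / 4) (d * m / 8))"
  have \<epsilon>: "0 < \<epsilon>" "\<epsilon> < 1" "\<epsilon> \<le> d / 4" "\<epsilon> * 2 / m \<le> d / 4"
  proof -
    show "0 < \<epsilon>" using d m_pos by (simp add: \<epsilon>_def)
    show "\<epsilon> < 1" "\<epsilon> \<le> d / 4" unfolding \<epsilon>_def by linarith+
    have "\<epsilon> \<le> d * m / 8" unfolding \<epsilon>_def by linarith
    then show "\<epsilon> * 2 / m \<le> d / 4" using m_pos by (simp add: field_simps)
  qed
  have "\<forall>\<^sub>F n in sequentially. dist (\<sigma> n) 1 < \<epsilon>" by (rule tendstoD[OF \<sigma> \<epsilon>(1)])
  then have "\<forall>\<^sub>F n in sequentially. norm (hausdorff_dist ((\<lambda>x. \<sigma> n *\<^sub>R x) ` S n) body - 0) < d"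
    using S_upper[OF \<epsilon>(1,2)] S_near[OF \<epsilon>(1)] eventually_ge_at_top[of 3]
  proof eventually_elim
    case (elim n)
    have ns: "norm s \<le> 2 / m" if "s \<in> S n" for s
    proof -
      have "m * norm s \<le> 2" using lower[of s] elim(2) that \<epsilon>(2) by fastforce
      then show ?thesis using m_pos by (simp add: field_simps)
    qed
    have close: "norm (\<sigma> n *\<^sub>R s - s) \<le> d / 4" if "s \<in> S n" for s
    proof -
      have "\<sigma> n *\<^sub>R s - s = (\<sigma> n - 1) *\<^sub>R s" by (simp add: scaleR_diff_left)
      then have "norm (\<sigma> n *\<^sub>R s - s) = \<bar>\<sigma> n - 1\<bar> * norm s" by simp
      also have "\<dots> \<le> \<epsilon> * (2 / m)" using elim(1) ns[OF that] \<epsilon>(1) by (intro mult_mono) (auto simp: dist_real_def)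
      finally show ?thesis using \<epsilon>(4) by simp
    qed
    have ne: "(\<lambda>x. \<sigma> n *\<^sub>R x) ` S n \<noteq> {}" "body \<noteq> {}" using S_facts[OF elim(4)] area_body by auto
    have 1: "infdist a body \<le> d / 2" if "a \<in> (\<lambda>x. \<sigma> n *\<^sub>R x) ` S n" for a
    proof -
      obtain s where s: "s \<in> S n" "a = \<sigma> n *\<^sub>R s" using \<open>a \<in> _\<close> by auto
      define y where "y = (1 / (1 + \<epsilon>)) *\<^sub>R s"
      have "H s \<le> 1 + \<epsilon>" using elim(2) s(1) by auto
      then have y: "y \<in> body" using scale_mem_body[of "1 + \<epsilon>" s] \<epsilon> by (simp add: y_def)
      have "s - y = (\<epsilon> / (1 + \<epsilon>)) *\<^sub>R s"
      proof -
        have "1 - 1 / (1 + \<epsilon>) = \<epsilon> / (1 + \<epsilon>)" using \<epsilon> by (simp add: field_simps)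
        then show ?thesis by (metis scaleR_diff_left scaleR_one y_def)
      qed
      then have "norm (s - y) = \<epsilon> / (1 + \<epsilon>) * norm s" using \<epsilon> by simp
      also have "\<dots> \<le> \<epsilon> * (2 / m)" using ns[OF s(1)] \<epsilon>(1) m_pos by (intro mult_mono) (auto simp: field_simps)
      finally have "norm (s - y) \<le> d / 4" using \<epsilon>(4) by simp
      then have "norm (a - y) \<le> d / 2" using close[OF s(1)] norm_triangle_ineq[of "a - s" "s - y"] s(2) by simp
      then show ?thesis using infdist_le[OF y, of a] by (simp add: dist_norm)
    qed
    have 2: "infdist y ((\<lambda>x. \<sigma> n *\<^sub>R x) ` S n) \<le> d / 2" if "y \<in> body" for y
    proof -
      obtain s where s: "s \<in> S n" "norm (s - y) \<le> \<epsilon>" using elim(3) \<open>y \<in> body\<close> by blast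
      have le: "dist y (\<sigma> n *\<^sub>R s) \<le> d / 2"
        using close[OF s(1)] s(2) \<epsilon>(3) norm_triangle_ineq[of "\<sigma> n *\<^sub>R s - s" "s - y"]
        by (simp add: dist_norm norm_minus_commute)
      have "\<sigma> n *\<^sub>R s \<in> (\<lambda>x. \<sigma> n *\<^sub>R x) ` S n" by (rule imageI[OF s(1)])
      from infdist_le[OF this] show ?thesis using le by (rule order_trans)
    qed
    show ?case using hausdorff_dist_bounds[OF ne 1 2] d by simp
  qed
  then show "\<exists>no. \<forall>n\<ge>no. norm (hausdorff_dist ((\<lambda>x. \<sigma> n *\<^sub>R x) ` S n) body - 0) < d"
    by (simp add: eventually_sequentially)
qed

lemma normalised_hull_tendsto:
  "(\<lambda>n. hausdorff_dist ((\<lambda>x. (measure lebesgue (convex hull (E n)) powr (-1/2)) *\<^sub>R x) ` (convex hull (E n))) body) \<longlonglongrightarrow> 0"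
proof (rule Lim_transform_eventually)
  define \<sigma> where "\<sigma> n = measure lebesgue (S n) powr (-1/2)" for n
  have "\<sigma> \<longlonglongrightarrow> 1 powr (-1/2)" unfolding \<sigma>_def by (intro tendsto_powr area_S tendsto_const) simp
  then have "\<sigma> \<longlonglongrightarrow> 1" by simp
  then show "(\<lambda>n. hausdorff_dist ((\<lambda>x. \<sigma> n *\<^sub>R x) ` S n) body) \<longlonglongrightarrow> 0" by (rule hausdorff_S)
  show "\<forall>\<^sub>F n in sequentially. hausdorff_dist ((\<lambda>x. \<sigma> n *\<^sub>R x) ` S n) body =
      hausdorff_dist ((\<lambda>x. (measure lebesgue (convex hull (E n)) powr (-1/2)) *\<^sub>R x) ` (convex hull (E n))) body"
    using eventually_gt_at_top[of 0]
  proof eventually_elim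
    case (elim n)
    have t: "T n > 0" by (rule T_pos[OF elim])
    let ?a = "measure lebesgue (convex hull (E n))"
    \<comment> \<open>Area scales with the square of the factor, so \<open>\<sigma> n / T n\<close>
      is the normalising factor of the unscaled hull.\<close>
    have "measure lebesgue (S n) = (1 / T n)\<^sup>2 * ?a"
      unfolding S_def using measure_lebesgue_affine[of "1 / T n" 0 "convex hull (E n)"] t
      by (simp add: power2_eq_square)
    then have "\<sigma> n = ((1 / T n)\<^sup>2) powr (-1/2) * ?a powr (-1/2)" by (simp add: \<sigma>_def powr_mult)
    also have "((1 / T n)\<^sup>2) powr (-1/2) = T n"
    proof -
      have "((1 / T n)\<^sup>2) powr (-1/2) = ((1 / T n) powr 2) powr (-1/2)" using t by (simp add: powr_realpow)
      also have "\<dots> = (1 / T n) powr (-1)" by (simp add: powr_powr)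
      also have "\<dots> = T n" using t by (simp add: powr_minus_divide powr_one)
      finally show ?thesis .
    qed
    finally have "\<sigma> n * (1 / T n) = ?a powr (-1/2)" using t by simp
    then show ?case by (simp add: S_def image_image)
  qed
qed

end

section \<open>Back to polygons and to the norm of \<open>D\<close>\<close>

lemma Per_nonneg:
  assumes "gauge (norm_D D) m M" "P \<in> lattice_ngons n" "n \<ge> 3" shows "Per D P \<ge> 0"
  unfolding polygon_edges(2)[OF assms(2,3)] using gauge.nonneg[OF assms(1)] by (rule sum_nonneg)

text \<open>Every competing fan is the edge set of a polygon, and since perimeters are nonnegative
  the infimum \<open>L n D\<close> is a genuine lower bound.\<close>

lemma minimizer_edges_minimal:
  assumes g: "gauge (norm_D D) m M" and P: "minimizer n D P" and n: "n \<ge> 3" and F: "F \<in> lattice_fans n"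
  shows "(\<Sum>z\<in>edge_set P. norm_D D z) \<le> (\<Sum>z\<in>F. norm_D D z)"
proof -
  obtain P' where P': "P' \<in> lattice_ngons n" "edge_set P' = F" using fan_polygon[OF F n] by blast
  have "bdd_below (Per D ` lattice_ngons n)" using Per_nonneg[OF g _ n] by (auto intro!: bdd_belowI2)
  then have "L n D \<le> Per D P'" unfolding L_def by (rule cINF_lower) (rule P'(1))
  also have "Per D P' = (\<Sum>z\<in>F. norm_D D z)" using polygon_edges(2)[OF P'(1) n] P'(2) by simp
  also have "L n D = (\<Sum>z\<in>edge_set P. norm_D D z)"
    using P polygon_edges(2)[OF _ n, of P D] by (simp add: minimizer_def)
  finally show ?thesis .
qed

theorem theorem2p2:
  fixes D :: "(real^2) set" and P :: "nat \<Rightarrow> (real^2) set"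
  assumes "convex D" and "compact D" and "0 \<in> interior D"
    and "\<And>n. n \<ge> 3 \<Longrightarrow> minimizer n D (P n)"
  shows "(\<exists>!C. C \<in> convex_bodies \<and> limit_shape P C) \<and>
    (\<forall>C. C \<in> convex_bodies \<and> limit_shape P C \<longrightarrow>
       centre_of_gravity C = 0 \<and>
       (\<lambda>n. real n powr (-3/2) * L n D) \<longlonglongrightarrow>
         pi / sqrt 6 * integral C (norm_D D))"
proof -
  obtain m M where g: "gauge (norm_D D) m M" using norm_D_gauge assms(1-3) by blast
  obtain \<mu> u m' M' where \<mu>: "\<mu> > 0" and H: "gauge (\<lambda>x. (norm_D D x - u \<bullet> x) / \<mu>) m' M'"
    and area: "measure lebesgue {x. (norm_D D x - u \<bullet> x) / \<mu> \<le> 1} = 1"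
    and cent: "\<And>w. integral {x. (norm_D D x - u \<bullet> x) / \<mu> \<le> 1} (\<lambda>x. w \<bullet> x) = 0"
    using exists_centred_gauge[OF g] by blast
  define h where "h x = (norm_D D x - u \<bullet> x) / \<mu>" for x
  interpret gauge h m' M' using H by (simp add: h_def[abs_def])
  have body_eq: "body = {x. (norm_D D x - u \<bullet> x) / \<mu> \<le> 1}" by (simp add: body_def h_def)
  have D_eq: "norm_D D x = \<mu> * h x + u \<bullet> x" for x using \<mu> by (simp add: h_def)
  have tot: "(\<Sum>z\<in>F. norm_D D z) = \<mu> * (\<Sum>z\<in>F. h z)" if "F \<in> lattice_fans n" for F n
  proof -
    have "(\<Sum>z\<in>F. norm_D D z) = \<mu> * (\<Sum>z\<in>F. h z) + u \<bullet> \<Sum>F"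
      by (simp add: D_eq sum.distrib sum_distrib_left inner_sum_right)
    then show ?thesis using that by (simp add: lattice_fans_def)
  qed
  have ng: "P n \<in> lattice_ngons n" "Per D (P n) = L n D" if "n \<ge> 3" for n
    using assms(4)[OF that] by (auto simp: minimizer_def)
  interpret minimal_fans h m' M' "\<lambda>n. edge_set (P n)"
  proof unfold_locales
    show "measure lebesgue body = 1" "integral body (\<lambda>x. w \<bullet> x) = 0" for w
      unfolding body_eq by (rule area, rule cent)
    show fan: "edge_set (P n) \<in> lattice_fans n" if "n \<ge> 3" for n
      using polygon_edges(1)[OF ng(1)] that by blast
    show "(\<Sum>z\<in>edge_set (P n). h z) \<le> (\<Sum>z\<in>F. h z)" if "n \<ge> 3" "F \<in> lattice_fans n" for n F
      using minimizer_edges_minimal[OF g assms(4) that(1,2)] that \<mu>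
      unfolding tot[OF fan[OF that(1)]] tot[OF that(2)] by simp
  qed
  have lim: "limit_shape P body" unfolding limit_shape_def by (rule normalised_hull_tendsto)
  have uniq: "C = body" if C: "C \<in> convex_bodies" "limit_shape P C" for C
  proof -
    let ?A = "\<lambda>n. (\<lambda>x. (area (convex hull edge_set (P n)) powr (-1/2)) *\<^sub>R x) ` (convex hull edge_set (P n))"
    have ev: "\<forall>\<^sub>F n in sequentially. compact (?A n) \<and> ?A n \<noteq> {}"
      using eventually_ge_at_top[of 3]
    proof eventually_elim
      case (elim n)
      have "edge_set (P n) \<noteq> {}" using S_facts(3)[OF elim] by (auto simp: S_def)
      then show ?case
        by (intro conjI compact_scaling compact_convex_hull finite_imp_compact finite_E[OF elim]) simp
    qed
    have "compact C" "C \<noteq> {}" using C(1) by (auto simp: convex_bodies_def)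
    moreover have "body \<noteq> {}" using area_body by auto
    ultimately show ?thesis
      using hausdorff_limit_subset[OF ev _ compact_body _ C(2)[unfolded limit_shape_def] lim[unfolded limit_shape_def]]
        hausdorff_limit_subset[OF ev compact_body _ _ lim[unfolded limit_shape_def] C(2)[unfolded limit_shape_def]]
      by blast
  qed
  have "centre_of_gravity body = 0"
  proof -
    have int: "(\<lambda>x::real^2. x) integrable_on body"
      using set_borel_integral_eq_integral(1)[of body "\<lambda>x. x"]
        borel_integrable_compact[OF compact_body, of "\<lambda>x. x"]
      by (simp add: set_integrable_def)
    have "w \<bullet> integral body (\<lambda>x. x) = 0" for w
      using integral_linear[OF int bounded_linear_inner_right[of w]] centred[of w] by (simp add: o_def)
    then have "integral body (\<lambda>x. x) = 0" by (metis inner_eq_zero_iff)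
    then show ?thesis by (simp add: centre_of_gravity_def)
  qed
  moreover have "(\<lambda>n. real n powr (-3/2) * L n D) \<longlonglongrightarrow> pi / sqrt 6 * integral body (norm_D D)"
  proof (rule Lim_transform_eventually)
    \<comment> \<open>Centroid 0 removes the linear part from the integral, just as the sum 0
      removes it from the total over a fan.\<close>
    have J: "integral body (norm_D D) = \<mu> * J"
    proof -
      have "integral body (norm_D D) = integral body (\<lambda>x. \<mu> * h x) + integral body (\<lambda>x. u \<bullet> x)"
        unfolding D_eq[abs_def]
        by (rule Henstock_Kurzweil_Integration.integral_add;
            rule integrable_on_compact[OF compact_body]; intro continuous_intros continuous)
      then show ?thesis by (simp add: centred J_def)
    qed
    \<comment> \<open>The constant of the theorem is \<open>1 / sqrt \<kappa>\<close>: the factor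
      \<open>\<kappa>\<close> of the limit meets \<open>\<kappa> * sqrt \<kappa>\<close>, which
      comes from \<open>T n^3\<close>.\<close>
    have k: "\<mu> / (\<kappa> * sqrt \<kappa>) * (\<kappa> * J) = pi / sqrt 6 * integral body (norm_D D)"
    proof -
      have "sqrt \<kappa> = sqrt 6 / pi" by (simp add: \<kappa>_def real_sqrt_divide)
      then show ?thesis using \<kappa>_pos by (simp add: J)
    qed
    show "(\<lambda>n. \<mu> / (\<kappa> * sqrt \<kappa>) * ((\<Sum>z\<in>edge_set (P n). h z) / T n^3)) \<longlonglongrightarrow> pi / sqrt 6 * integral body (norm_D D)"
      unfolding k[symmetric] by (intro tendsto_mult tendsto_const total_tendsto)
    show "\<forall>\<^sub>F n in sequentially. \<mu> / (\<kappa> * sqrt \<kappa>) * ((\<Sum>z\<in>edge_set (P n). h z) / T n^3) = real n powr (-3/2) * L n D"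
      using eventually_ge_at_top[of 3]
    proof eventually_elim
      case (elim n)
      have n0: "real n > 0" using elim by simp
      have L: "L n D = \<mu> * (\<Sum>z\<in>edge_set (P n). h z)"
        using polygon_edges(2)[OF ng(1)[OF elim] elim, of D] ng(2)[OF elim] tot[OF fan[OF elim]] by simp
      have "(T n)\<^sup>2 = real n / \<kappa>" using \<kappa>_pos by (simp add: T_def)
      moreover have "T n = sqrt (real n) / sqrt \<kappa>" by (simp add: T_def real_sqrt_divide)
      moreover have "(T n)^3 = (T n)\<^sup>2 * T n" by (simp add: power2_eq_square power3_eq_cube)
      ultimately have T3: "(T n)^3 = (real n / \<kappa>) * (sqrt (real n) / sqrt \<kappa>)" by metis
      have "real n powr (3/2) = real n powr (1 + 1/2)" by simp
      also have "\<dots> = real n powr 1 * real n powr (1/2)" by (rule powr_add)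
      also have "\<dots> = real n * sqrt (real n)" using n0 by (simp add: powr_half_sqrt)
      finally have "real n powr (-3/2) = 1 / (real n * sqrt (real n))" using powr_minus_divide[of "real n" "3/2"] by simp
      then show ?case using \<kappa>_pos n0 unfolding L T3 by simp
    qed
  qed
  ultimately show ?thesis using lim uniq body_in_convex_bodies by blast
qed

end
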